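(* There exists an absolute constant $C>0$ such that for every probability measure $\nu$ on $S^1$ that is attainable, there exist a sequence $\{n_i\}\subseteq\mathcal N$ with $n_i\to\infty$ and a probability measure $\widetilde\nu$ supported on at most $C$ points of $S^1$ such that $\mu_{n_i}\Rightarrow\nu\star\widetilde\nu$ (weak-$*$ convergence). Moreover, whether or not $\nu$ is supported on a finite number of points, the sequence may be chosen so that in addition $|\Gamma^{n_i}|\to\infty$.
   Context: Let $S^1\cong\mathbb R/2\pi\mathbb Z$ and let $\star$ denote convolution of measures on the group $S^1$. Hyperbolic measures: let $\Gamma=\mathrm{PSL}_2(\mathbb Z)=\mathrm{SL}_2(\mathbb Z)/\{\pm I\}$ act on the upper half plane by Möbius transformations $\gamma(z)=\frac{az+b}{cz+d}$ for $\gamma=\begin{pmatrix}a&b\\c&d\end{pmatrix}$, put $\|\gamma\|^2=a^2+b^2+c^2+d^2$, and for $n\in\mathbb N$ let $\Gamma^n=\{\gamma\in\Gamma:\|\gamma\|^2=n\}$ and $\mathcal N=\{n\in\mathbb N:|\Gamma^n|>0\}$. Let $f(z)=\frac{z-i}{1-iz}$ and $\theta(\gamma)=\arg f(\gamma(i))$ for $\gamma(i)\ne i$. For $n\in\mathcal N$, $n>2$, define the probability measure $\mu_n=\frac1{|\Gamma^n|}\sum_{\gamma\in\Gamma^n}\delta_{\theta(\gamma)}$ on $S^1$. Euclidean measures: let $\mathcal S$ be the set of positive integers $n$ that are sums of two integer squares, $r(n)=|\{(x,y)\in\mathbb Z^2:x^2+y^2=n\}|$, and for $n\in\mathcal S$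 let $\nu_n=\frac1{r(n)}\sum_{(x,y)\in\mathbb Z^2:\,x^2+y^2=n}\delta_{\arg(x+iy)}$. A probability measure on $S^1$ is called attainable if it is a weak-$*$ partial limit of $\{\nu_n\}_{n\in\mathcal S}$, i.e. the weak-$*$ limit of some subsequence of $\{\nu_n\}_{n\in\mathcal S}$. *)

theory Defs
  imports "HOL-Probability.Probability" "HOL-Algebra.Coset"
begin

section \<open>Measures on the circle\<close>

text \<open>The circle group is realised as the multiplicative group of complex numbers of modulus 1;
  the class of a real number t modulo 2 pi corresponds to the point cis t.\<close>

abbreviation unit_circle :: "complex set" where
  "unit_circle \<equiv> sphere 0 1"

definition circle_borel :: "complex measure" where
  "circle_borel = restrict_space borel unit_circle"

definition circle_prob :: "complex measure \<Rightarrow> bool" where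
  "circle_prob M \<longleftrightarrow> prob_space M \<and> sets M = sets circle_borel"

text \<open>Addition of angles is multiplication of points.\<close>

definition circle_convolution :: "complex measure \<Rightarrow> complex measure \<Rightarrow> complex measure" where
  "circle_convolution M N = distr (M \<Otimes>\<^sub>M N) circle_borel (\<lambda>(x, y). x * y)"

definition circle_weak_conv :: "(nat \<Rightarrow> complex measure) \<Rightarrow> complex measure \<Rightarrow> bool" where
  "circle_weak_conv M N \<longleftrightarrow>
     (\<forall>g :: complex \<Rightarrow> real. continuous_on unit_circle g \<longrightarrow>
        (\<lambda>i. integral\<^sup>L (M i) g) \<longlonglongrightarrow> integral\<^sup>L N g)"

definition supported_on_at_most :: "complex measure \<Rightarrow> nat \<Rightarrow> bool" where
  "supported_on_at_most M k \<longleftrightarrow>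
     (\<exists>F. finite F \<and> F \<subseteq> unit_circle \<and> card F \<le> k \<and> emeasure M (unit_circle - F) = 0)"

section \<open>Hyperbolic measures\<close>

definition SL2Z :: "(int ^ 2 ^ 2) monoid" where
  "SL2Z = \<lparr>carrier = {A. det A = 1}, mult = (**), one = mat 1\<rparr>"

definition PSL2Z :: "(int ^ 2 ^ 2) set monoid" where
  "PSL2Z = SL2Z Mod {mat 1, - mat 1}"

definition mat_norm_sq :: "int ^ 2 ^ 2 \<Rightarrow> int" where
  "mat_norm_sq A = (A $ 1 $ 1)\<^sup>2 + (A $ 1 $ 2)\<^sup>2 + (A $ 2 $ 1)\<^sup>2 + (A $ 2 $ 2)\<^sup>2"

definition mat_moebius :: "int ^ 2 ^ 2 \<Rightarrow> complex \<Rightarrow> complex" where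
  "mat_moebius A z =
     (of_int (A $ 1 $ 1) * z + of_int (A $ 1 $ 2)) / (of_int (A $ 2 $ 1) * z + of_int (A $ 2 $ 2))"

text \<open>An element of PSL2Z is a coset of the form {A, -A}. Both functions above are constant on such
  a coset, so they descend to PSL2Z; see the lemmas below.\<close>

definition psl_norm_sq :: "(int ^ 2 ^ 2) set \<Rightarrow> int" where
  "psl_norm_sq \<gamma> = the_elem (mat_norm_sq ` \<gamma>)"

definition psl_moebius :: "(int ^ 2 ^ 2) set \<Rightarrow> complex \<Rightarrow> complex" where
  "psl_moebius \<gamma> z = the_elem ((\<lambda>A. mat_moebius A z) ` \<gamma>)"

lemma carrier_PSL2Z: "carrier PSL2Z = {{A, - A} | A. det A = 1}"
proof -
  have *: "(- mat 1 :: int ^ 2 ^ 2) ** A = - A" for A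
    by (simp add: vec_eq_iff matrix_matrix_mult_def mat_def sum_2 forall_2)
  show ?thesis
    by (auto simp: PSL2Z_def SL2Z_def FactGroup_def RCOSETS_def r_coset_def *)
qed

lemma psl_norm_sq_coset: "psl_norm_sq {A, - A} = mat_norm_sq A"
  by (simp add: psl_norm_sq_def mat_norm_sq_def)

lemma psl_moebius_coset: "psl_moebius {A, - A} z = mat_moebius A z"
proof -
  have "mat_moebius (- A) z = mat_moebius A z"
    using minus_divide_divide[of "of_int (A $ 1 $ 1) * z + of_int (A $ 1 $ 2)"
        "of_int (A $ 2 $ 1) * z + of_int (A $ 2 $ 2)"]
    by (simp add: mat_moebius_def)
  thus ?thesis by (simp add: psl_moebius_def)
qed

definition Gamma_sphere :: "nat \<Rightarrow> (int ^ 2 ^ 2) set set" where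
  "Gamma_sphere n = {\<gamma> \<in> carrier PSL2Z. psl_norm_sq \<gamma> = int n}"

text \<open>These sets are finite, so that card is the genuine cardinality.\<close>

lemma finite_Gamma_sphere: "finite (Gamma_sphere n)"
proof -
  define m where "m a b c d = (vector [vector [a, b], vector [c, d]] :: int ^ 2 ^ 2)" for a b c d
  define I where "I = {- int n..int n}"
  have bound: "x \<in> I" if "x\<^sup>2 \<le> int n" for x
  proof -
    have "\<bar>x\<bar> \<le> x\<^sup>2"
      using self_le_power[of "\<bar>x\<bar>" 2] by (cases "x = 0") auto
    thus ?thesis using that by (auto simp: I_def)
  qed
  have "Gamma_sphere n \<subseteq> (\<lambda>(a, b, c, d). {m a b c d, - m a b c d}) ` (I \<times> I \<times> I \<times> I)"
  proof
    fix \<gamma> assume "\<gamma> \<in> Gamma_sphere n"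
    then obtain A where A: "\<gamma> = {A, - A}" "mat_norm_sq A = int n"
      by (auto simp: Gamma_sphere_def carrier_PSL2Z psl_norm_sq_coset)
    have "A = m (A $ 1 $ 1) (A $ 1 $ 2) (A $ 2 $ 1) (A $ 2 $ 2)"
      by (simp add: m_def vec_eq_iff forall_2)
    moreover have "A $ 1 $ 1 \<in> I" "A $ 1 $ 2 \<in> I" "A $ 2 $ 1 \<in> I" "A $ 2 $ 2 \<in> I"
      by (auto intro!: bound simp flip: A(2) simp: mat_norm_sq_def)
    ultimately show "\<gamma> \<in> (\<lambda>(a, b, c, d). {m a b c d, - m a b c d}) ` (I \<times> I \<times> I \<times> I)"
      unfolding A(1)
      by (intro image_eqI[of _ _ "(A $ 1 $ 1, A $ 1 $ 2, A $ 2 $ 1, A $ 2 $ 2)"]) auto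
  qed
  thus ?thesis by (rule finite_subset) (auto simp: I_def)
qed

definition hyp_radii :: "nat set" where
  "hyp_radii = {n. card (Gamma_sphere n) > 0}"

definition disc_map :: "complex \<Rightarrow> complex" where
  "disc_map z = (z - \<i>) / (1 - \<i> * z)"

definition hyp_angle :: "(int ^ 2 ^ 2) set \<Rightarrow> real" where
  "hyp_angle \<gamma> = Arg (disc_map (psl_moebius \<gamma> \<i>))"

text \<open>Meaningful for n in hyp_radii with n > 2 only: for n = 2 one has
  disc_map (psl_moebius g i) = 0, whose argument is set to 0 by convention.\<close>

definition hyp_measure :: "nat \<Rightarrow> complex measure" where
  "hyp_measure n =
     distr (uniform_count_measure (Gamma_sphere n)) circle_borel (\<lambda>\<gamma>. cis (hyp_angle \<gamma>))"

section \<open>Euclidean measures\<close>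

definition lattice_circle :: "nat \<Rightarrow> (int \<times> int) set" where
  "lattice_circle n = {(x, y). x\<^sup>2 + y\<^sup>2 = int n}"

definition sums_of_two_squares :: "nat set" where
  "sums_of_two_squares = {n. n > 0 \<and> (\<exists>x y :: int. int n = x\<^sup>2 + y\<^sup>2)}"

definition euc_measure :: "nat \<Rightarrow> complex measure" where
  "euc_measure n =
     distr (uniform_count_measure (lattice_circle n)) circle_borel
       (\<lambda>(x, y). cis (Arg (Complex (real_of_int x) (real_of_int y))))"

definition attainable :: "complex measure \<Rightarrow> bool" where
  "attainable M \<longleftrightarrow> circle_prob M \<and>
     (\<exists>s. strict_mono s \<and> range s \<subseteq> sums_of_two_squares \<and>
          circle_weak_conv (\<lambda>k. euc_measure (s k)) M)"

end

theory Submission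
  imports Defs "HOL-Number_Theory.Cong" "HOL-Real_Asymp.Real_Asymp"
begin

text \<open>A matrix with entries a, b, c, d of determinant 1 and squared norm n = 4M + 2 corresponds to the pair of
Gaussian integers z, w given by 2z = (a + d) + (b - c)i and 2w = (a - d) + (b + c)i, and the conditions
on the matrix become |z|^2 = M + 1 and |w|^2 = M. The angle attached to the matrix is that of
i z conj(w). So, for n of this form, the hyperbolic measure is the law of the product of two independent
random directions, one from each of the circles of squared radius M and M + 1
(\<open>card_Gamma_sphere\<close>, \<open>integral_hyp_measure\<close>).

The directions on a circle are governed by unique factorisation: for coprime m and u the circle of m u
is the product of the circles of m and u up to units (\<open>sum_circ_mult\<close>). Let nu be the limit of the
Euclidean measures of s(i). The idea is to take M = s(i) * q * u with q a prime power whose circle has many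
points, all of them close to the four units, and with both u and M + 1 having boundedly many representations
as a sum of two squares. Then q hardly changes the measure but makes the number of points grow, and u and
M + 1 contribute a random direction with at most C values; by compactness these values converge along a
subsequence.

Two arithmetic facts are behind this. The first is that u exists (\<open>almost_prime_neighbours\<close>). If m is odd
and is the norm of a primitive w, then there is a one-parameter family of v for which m |v|^2 + 1 is
again a norm, namely that of w v + 1 + 2i. Here |v|^2 and |w v + 1 + 2i|^2 are quadratic polynomials in the
parameter t, and a lower bound sieve of dimension 4 (\<open>sieve_of_dimension_4\<close>) gives t such that neither
value has a prime factor between 5 and a fixed power of t. Hence both have boundedly many prime factors
from 5 onwards, and so boundedly many representations, with a bound that is independent of m.
The sieve is the one of Brun and Hooley: the primes are cut into doubly exponential blocks, and within each
block the inclusion-exclusion formula is truncated.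

The second fact is that there are Gaussian primes with arbitrarily small argument
(\<open>gaussian_primes_near_axis\<close>); the powers of their norms serve as q. This is the analogue for the angular
characters z |-> (z/|z|)^(4k) of Dirichlet's theorem: the L-series of the character is bounded and
Lipschitz near s = 1, because splitting it into the residue classes modulo 2 + i reproduces it, up to a convergent series, with a factor that
is not 1; the inequality 3 + 4 cos x + cos 2x \<ge> 0 shows that it does not vanish at 1; and a trigonometric
polynomial concentrated at 0 then detects primes near the axis.\<close>

section \<open>Elementary symmetric sums and the Bonferroni inequalities\<close>

definition elem_sym :: "nat \<Rightarrow> 'a set \<Rightarrow> ('a \<Rightarrow> real) \<Rightarrow> real" where
  "elem_sym k Q h = (\<Sum>E | E \<subseteq> Q \<and> card E = k. \<Prod>p\<in>E. h p)"

definition alt_elem_sym :: "nat \<Rightarrow> 'a set \<Rightarrow> ('a \<Rightarrow> real) \<Rightarrow> real" where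
  "alt_elem_sym b Q h = (\<Sum>k\<le>b. (-1) ^ k * elem_sym k Q h)"

lemma elem_sym_0: "finite Q \<Longrightarrow> elem_sym 0 Q h = 1"
proof -
  assume "finite Q"
  then have "{E. E \<subseteq> Q \<and> card E = 0} = {{}}"
    by (auto dest: finite_subset)
  then show ?thesis by (simp add: elem_sym_def)
qed

lemma elem_sym_Suc_empty: "elem_sym (Suc k) {} h = 0"
proof -
  have "{E. E \<subseteq> {} \<and> card E = Suc k} = ({} :: 'a set set)" by auto
  then show ?thesis by (simp only: elem_sym_def) simp
qed

lemma elem_sym_Suc_insert:
  assumes "finite Q" "q \<notin> Q"
  shows "elem_sym (Suc k) (insert q Q) h = elem_sym (Suc k) Q h + h q * elem_sym k Q h"
proof -
  have split: "{E. E \<subseteq> insert q Q \<and> card E = Suc k} =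
      {E. E \<subseteq> Q \<and> card E = Suc k} \<union> insert q ` {E. E \<subseteq> Q \<and> card E = k}" (is "?L = ?A \<union> ?B")
  proof (intro Set.set_eqI iffI)
    fix E assume E: "E \<in> ?L"
    then have fin: "finite E" using assms finite_subset by auto
    show "E \<in> ?A \<union> ?B"
    proof (cases "q \<in> E")
      case True
      then have "E = insert q (E - {q})" "E - {q} \<subseteq> Q" "card (E - {q}) = k" using E fin by auto
      then show ?thesis by blast
    qed (use E in auto)
  next
    fix E assume "E \<in> ?A \<union> ?B"
    moreover have "card (insert q F) = Suc (card F)" if "F \<subseteq> Q" for F
      using that assms finite_subset by (subst card_insert_disjoint) auto
    ultimately show "E \<in> ?L" by auto
  qed
  have inj: "inj_on (insert q) {E. E \<subseteq> Q \<and> card E = k}"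
    using assms by (auto simp: inj_on_def)
  have "elem_sym (Suc k) (insert q Q) h = (\<Sum>E\<in>?A. \<Prod>p\<in>E. h p) + (\<Sum>E\<in>?B. \<Prod>p\<in>E. h p)"
    unfolding elem_sym_def split using assms
    by (subst sum.union_disjoint) auto
  also have "(\<Sum>E\<in>?B. \<Prod>p\<in>E. h p) = (\<Sum>E | E \<subseteq> Q \<and> card E = k. \<Prod>p\<in>insert q E. h p)"
    by (subst sum.reindex[OF inj]) simp
  also have "\<dots> = (\<Sum>E | E \<subseteq> Q \<and> card E = k. h q * (\<Prod>p\<in>E. h p))"
    using assms by (intro sum.cong refl prod.insert) (auto dest: finite_subset)
  finally show ?thesis by (simp add: elem_sym_def sum_distrib_left)
qed

lemma elem_sym_nonneg: "(\<And>p. p \<in> Q \<Longrightarrow> 0 \<le> h p) \<Longrightarrow> 0 \<le> elem_sym k Q h"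
  unfolding elem_sym_def by (intro sum_nonneg prod_nonneg) auto

lemma alt_elem_sym_Suc_insert:
  assumes "finite Q" "q \<notin> Q"
  shows "alt_elem_sym (Suc b) (insert q Q) h = alt_elem_sym (Suc b) Q h - h q * alt_elem_sym b Q h"
proof -
  have "alt_elem_sym (Suc b) (insert q Q) h
      = elem_sym 0 (insert q Q) h + (\<Sum>k\<le>b. (-1) ^ Suc k * elem_sym (Suc k) (insert q Q) h)"
    unfolding alt_elem_sym_def by (subst sum.atMost_Suc_shift) simp
  also have "\<dots> = (elem_sym 0 Q h + (\<Sum>k\<le>b. (-1) ^ Suc k * elem_sym (Suc k) Q h))
      - h q * (\<Sum>k\<le>b. (-1) ^ k * elem_sym k Q h)"
    using assms by (simp add: elem_sym_0 elem_sym_Suc_insert sum_distrib_left ring_distribs sum.distrib sum_subtractf sum_negf mult.left_commute)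
  also have "elem_sym 0 Q h + (\<Sum>k\<le>b. (-1) ^ Suc k * elem_sym (Suc k) Q h) = alt_elem_sym (Suc b) Q h"
    unfolding alt_elem_sym_def sum.atMost_Suc_shift[of _ b] by simp
  finally show ?thesis by (simp add: alt_elem_sym_def)
qed

text \<open>Truncating the expansion of a product of factors 1 - h p after an even (odd) number of steps gives an upper
(lower) bound. The values of h may be any reals in the unit interval, so the same statement covers
indicator functions, which give the pointwise sieve inequality, and local densities, which give its average.\<close>

lemma bonferroni:
  assumes "finite Q" "\<And>p. p \<in> Q \<Longrightarrow> 0 \<le> h p \<and> h p \<le> 1"
  shows "(even b \<longrightarrow> (\<Prod>p\<in>Q. 1 - h p) \<le> alt_elem_sym b Q h) \<and>
         (odd b \<longrightarrow> alt_elem_sym b Q h \<le> (\<Prod>p\<in>Q. 1 - h p))"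
  using assms
proof (induction Q arbitrary: b rule: finite_induct)
  case empty
  have "alt_elem_sym b {} h = 1" for b
  proof (induction b)
    case (Suc b)
    then show ?case by (simp add: alt_elem_sym_def elem_sym_Suc_empty)
  qed (simp add: alt_elem_sym_def elem_sym_0)
  then show ?case by simp
next
  case (insert q Q)
  note IH = insert.IH[OF insert.prems]
  show ?case
  proof (cases b)
    case 0
    then show ?thesis using insert by (auto simp: alt_elem_sym_def elem_sym_0 intro!: mult_le_one prod_le_1 prod_nonneg)
  next
    case (Suc c)
    have "0 \<le> h q" using insert.prems by simp
    then show ?thesis
      using IH[of "Suc c"] IH[of c] mult_left_mono[of "alt_elem_sym c Q h" "\<Prod>p\<in>Q. 1 - h p" "h q"]
        mult_left_mono[of "\<Prod>p\<in>Q. 1 - h p" "alt_elem_sym c Q h" "h q"]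
      by (auto simp: Suc alt_elem_sym_Suc_insert insert.hyps algebra_simps)
  qed
qed

lemma power_Suc_add_ge:
  fixes S x :: real
  assumes "0 \<le> S" "0 \<le> x"
  shows "S ^ Suc k + real (Suc k) * x * S ^ k \<le> (S + x) ^ Suc k"
proof (induction k)
  case (Suc k)
  have "S ^ Suc (Suc k) + real (Suc (Suc k)) * x * S ^ Suc k
      \<le> (S + x) * (S ^ Suc k + real (Suc k) * x * S ^ k)"
    using assms by (simp add: algebra_simps)
  also have "\<dots> \<le> (S + x) * (S + x) ^ Suc k"
    using Suc assms by (intro mult_left_mono) auto
  finally show ?case by simp
qed simp

text \<open>Expanding the k-th power of the sum of the h p produces every squarefree monomial of degree k exactly k!
times, next to other nonnegative terms.\<close>

lemma elem_sym_le:
  assumes "finite Q" "\<And>p. p \<in> Q \<Longrightarrow> 0 \<le> h p"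
  shows "elem_sym k Q h \<le> (\<Sum>p\<in>Q. h p) ^ k / fact k"
  using assms
proof (induction Q arbitrary: k rule: finite_induct)
  case empty
  then show ?case by (cases k) (auto simp: elem_sym_0 elem_sym_Suc_empty)
next
  case (insert q Q)
  define S where "S = (\<Sum>p\<in>Q. h p)"
  have S: "0 \<le> S" "0 \<le> h q" unfolding S_def using insert.prems by (auto intro: sum_nonneg)
  show ?case
  proof (cases k)
    case 0
    then show ?thesis using insert by (simp add: elem_sym_0)
  next
    case (Suc c)
    have "elem_sym k (insert q Q) h \<le> S ^ Suc c / fact (Suc c) + h q * (S ^ c / fact c)"
      unfolding Suc elem_sym_Suc_insert[OF insert.hyps] S_def
      using insert by (intro add_mono mult_left_mono insert.IH) auto
    also have "\<dots> = (S ^ Suc c + real (Suc c) * h q * S ^ c) / fact (Suc c)"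
    proof -
      have "h q * (S ^ c / fact c) = real (Suc c) * h q * S ^ c / fact (Suc c)" by simp
      then show ?thesis by (simp only: add_divide_distrib)
    qed
    also have "\<dots> \<le> (S + h q) ^ Suc c / fact (Suc c)"
      using S by (intro divide_right_mono power_Suc_add_ge) auto
    finally show ?thesis using insert.hyps by (simp add: Suc S_def add.commute)
  qed
qed

lemma sum_elem_sym_const_le:
  assumes "finite Q" "0 \<le> c"
  shows "(\<Sum>k\<le>n. elem_sym k Q (\<lambda>_. c)) \<le> (1 + c * real (card Q)) ^ n"
proof -
  have "(\<Sum>k\<le>n. elem_sym k Q (\<lambda>_. c)) \<le> (\<Sum>k\<le>n. real (n choose k) * (c * real (card Q)) ^ k * 1 ^ (n - k))"
  proof (rule sum_mono)
    fix k assume k: "k \<in> {..n}"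
    have "elem_sym k Q (\<lambda>_. c) \<le> (c * real (card Q)) ^ k / fact k"
      using elem_sym_le[of Q "\<lambda>_. c" k] assms by (simp add: mult.commute)
    also have "\<dots> \<le> (c * real (card Q)) ^ k / 1"
      using assms by (intro divide_left_mono) auto
    also have "\<dots> \<le> real (n choose k) * (c * real (card Q)) ^ k"
    proof -
      have "0 < n choose k" using k by simp
      then have "1 \<le> real (n choose k)" by linarith
      then show ?thesis using assms mult_right_mono[of 1 "real (n choose k)" "(c * real (card Q)) ^ k"] by simp
    qed
    finally show "elem_sym k Q (\<lambda>_. c) \<le> real (n choose k) * (c * real (card Q)) ^ k * 1 ^ (n - k)" by simp
  qed
  also have "\<dots> = (c * real (card Q) + 1) ^ n" by (simp only: binomial_ring)
  finally show ?thesis by (simp add: add.commute)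
qed

section \<open>Sieve weights\<close>

text \<open>For h the indicator function of a set A this is the sum of w over the subsets of A, for h the local
densities it is the main term of the sieve with weights w, and for a constant h it bounds the remainder.\<close>

definition weight_sum :: "('a set \<Rightarrow> real) \<Rightarrow> 'a set \<Rightarrow> ('a \<Rightarrow> real) \<Rightarrow> real" where
  "weight_sum w P h = (\<Sum>D\<in>Pow P. w D * (\<Prod>p\<in>D. h p))"

lemma weight_sum_mult:
  assumes "finite P" "finite Q" "P \<inter> Q = {}"
  shows "weight_sum (\<lambda>D. v (D \<inter> P) * w (D \<inter> Q)) (P \<union> Q) h = weight_sum v P h * weight_sum w Q h"
proof -
  have bij: "bij_betw (\<lambda>(D, E). D \<union> E) (Pow P \<times> Pow Q) (Pow (P \<union> Q))"
    by (rule bij_betw_byWitness[where f' = "\<lambda>D. (D \<inter> P, D \<inter> Q)"]) (use assms in auto)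
  have "weight_sum (\<lambda>D. v (D \<inter> P) * w (D \<inter> Q)) (P \<union> Q) h =
     (\<Sum>(D, E)\<in>Pow P \<times> Pow Q. v ((D \<union> E) \<inter> P) * w ((D \<union> E) \<inter> Q) * (\<Prod>p\<in>D \<union> E. h p))"
    unfolding weight_sum_def by (subst sum.reindex_bij_betw[OF bij, symmetric]) (simp add: case_prod_beta)
  also have "\<dots> = (\<Sum>(D, E)\<in>Pow P \<times> Pow Q. (v D * (\<Prod>p\<in>D. h p)) * (w E * (\<Prod>p\<in>E. h p)))"
  proof (intro sum.cong refl, clarify)
    fix D E assume DE: "D \<subseteq> P" "E \<subseteq> Q"
    then have "(D \<union> E) \<inter> P = D" "(D \<union> E) \<inter> Q = E" "D \<inter> E = {}" "finite D" "finite E"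
      using assms finite_subset by auto
    then show "v ((D \<union> E) \<inter> P) * w ((D \<union> E) \<inter> Q) * (\<Prod>p\<in>D \<union> E. h p)
        = (v D * (\<Prod>p\<in>D. h p)) * (w E * (\<Prod>p\<in>E. h p))"
      by (simp add: prod.union_disjoint)
  qed
  also have "\<dots> = weight_sum v P h * weight_sum w Q h"
    unfolding weight_sum_def by (simp add: sum_product sum.cartesian_product)
  finally show ?thesis .
qed

definition trunc_moebius :: "nat \<Rightarrow> 'a set \<Rightarrow> real" where
  "trunc_moebius b E = (if card E \<le> b then (-1) ^ card E else 0)"

lemma weight_sum_trunc_moebius:
  assumes "finite Q"
  shows "weight_sum (trunc_moebius b) Q h = alt_elem_sym b Q h"
    and "weight_sum (\<lambda>E. \<bar>trunc_moebius b E\<bar>) Q h = (\<Sum>k\<le>b. elem_sym k Q h)"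
    and "weight_sum (\<lambda>E. of_bool (card E = k)) Q h = elem_sym k Q h"
proof -
  have grp: "(\<Sum>E\<in>Pow Q. if card E \<le> b then c (card E) * (\<Prod>p\<in>E. h p) else 0)
     = (\<Sum>k\<le>b. c k * elem_sym k Q h)" for c :: "nat \<Rightarrow> real"
  proof -
    have "(\<Sum>E\<in>Pow Q. if card E \<le> b then c (card E) * (\<Prod>p\<in>E. h p) else 0)
        = (\<Sum>E\<in>{E \<in> Pow Q. card E \<le> b}. c (card E) * (\<Prod>p\<in>E. h p))"
      using assms by (subst sum.inter_filter[symmetric]) auto
    also have "\<dots> = (\<Sum>k\<le>b. \<Sum>E\<in>{E \<in> {E \<in> Pow Q. card E \<le> b}. card E = k}. c (card E) * (\<Prod>p\<in>E. h p))"
      using assms by (intro sum.group[symmetric]) auto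
    also have "\<dots> = (\<Sum>k\<le>b. c k * elem_sym k Q h)"
      unfolding elem_sym_def sum_distrib_left by (intro sum.cong refl) auto
    finally show ?thesis .
  qed
  show "weight_sum (trunc_moebius b) Q h = alt_elem_sym b Q h"
    unfolding weight_sum_def alt_elem_sym_def grp[symmetric] by (intro sum.cong refl) (auto simp: trunc_moebius_def)
  show "weight_sum (\<lambda>E. \<bar>trunc_moebius b E\<bar>) Q h = (\<Sum>k\<le>b. elem_sym k Q h)"
    using grp[of "\<lambda>_. 1"] unfolding weight_sum_def
    by (simp add: trunc_moebius_def if_distrib[of abs] if_distrib[of "\<lambda>x. x * _"] cong: if_cong)
  show "weight_sum (\<lambda>E. of_bool (card E = k)) Q h = elem_sym k Q h"
    unfolding weight_sum_def elem_sym_def using assms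
    by (intro sum.mono_neutral_cong_right) auto
qed

text \<open>Lower and upper bound sieve weights. Since h ranges over all functions into the unit interval, and not only
over indicator functions, the property is preserved when a new block of primes is adjoined.\<close>

definition sieve_weights :: "'a set \<Rightarrow> ('a set \<Rightarrow> real) \<Rightarrow> ('a set \<Rightarrow> real) \<Rightarrow> bool" where
  "sieve_weights P lo up \<longleftrightarrow> (\<forall>h. (\<forall>p\<in>P. 0 \<le> h p \<and> h p \<le> 1) \<longrightarrow>
     weight_sum lo P h \<le> (\<Prod>p\<in>P. 1 - h p) \<and> (\<Prod>p\<in>P. 1 - h p) \<le> weight_sum up P h)"

lemma weight_sum_mono:
  "(\<And>p. p \<in> P \<Longrightarrow> 0 \<le> h p) \<Longrightarrow> (\<And>D. D \<subseteq> P \<Longrightarrow> v D \<le> w D) \<Longrightarrow> weight_sum v P h \<le> weight_sum w P h"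
  unfolding weight_sum_def by (intro sum_mono mult_right_mono prod_nonneg) auto

lemma weight_sum_diff: "weight_sum (\<lambda>D. v D - w D) P h = weight_sum v P h - weight_sum w P h"
  and weight_sum_add: "weight_sum (\<lambda>D. v D + w D) P h = weight_sum v P h + weight_sum w P h"
  by (simp_all add: weight_sum_def ring_distribs sum_subtractf sum.distrib)

lemma weight_sum_nonneg:
  "(\<And>p. p \<in> P \<Longrightarrow> 0 \<le> h p) \<Longrightarrow> (\<And>D. D \<subseteq> P \<Longrightarrow> 0 \<le> w D) \<Longrightarrow> 0 \<le> weight_sum w P h"
  unfolding weight_sum_def by (intro sum_nonneg mult_nonneg_nonneg prod_nonneg) auto

text \<open>The Brun-Hooley step. Let X and x be the indicators of not being sifted out by P and by Q, and let y be the
truncation of the expansion of x after an even number b of steps. Then y - x is at least 0 and at most the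
(b + 1)-st elementary symmetric sum e, so X x = X y - X (y - x) lies between X y - X e and X y. Replacing X
by its lower bound in the first term and by its upper bound in the second one gives the new lower weights.\<close>

definition ext_lower where
  "ext_lower P Q b lo up D = lo (D \<inter> P) * trunc_moebius b (D \<inter> Q) - up (D \<inter> P) * of_bool (card (D \<inter> Q) = Suc b)"
definition ext_upper where
  "ext_upper P Q b up D = up (D \<inter> P) * trunc_moebius b (D \<inter> Q)"

lemma weight_sum_ext:
  assumes "finite P" "finite Q" "P \<inter> Q = {}"
  shows "weight_sum (ext_lower P Q b lo up) (P \<union> Q) h
       = weight_sum lo P h * alt_elem_sym b Q h - weight_sum up P h * elem_sym (Suc b) Q h"
    and "weight_sum (ext_upper P Q b up) (P \<union> Q) h = weight_sum up P h * alt_elem_sym b Q h"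
  unfolding ext_lower_def[abs_def] ext_upper_def[abs_def]
  using assms by (simp_all add: weight_sum_diff weight_sum_mult weight_sum_mult[of _ _ _ "\<lambda>E. of_bool (card E = Suc b)"]
      weight_sum_trunc_moebius)

lemma sieve_weights_ext:
  assumes "finite P" "finite Q" "P \<inter> Q = {}" "even b" "sieve_weights P lo up"
  shows "sieve_weights (P \<union> Q) (ext_lower P Q b lo up) (ext_upper P Q b up)"
  unfolding sieve_weights_def
proof (intro allI impI)
  fix h :: "'a \<Rightarrow> real"
  assume h: "\<forall>p\<in>P \<union> Q. 0 \<le> h p \<and> h p \<le> 1"
  define V W where "V = (\<Prod>p\<in>P. 1 - h p)" and "W = (\<Prod>p\<in>Q. 1 - h p)"
  have VW: "(\<Prod>p\<in>P \<union> Q. 1 - h p) = V * W" using assms by (simp add: V_def W_def prod.union_disjoint)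
  have nn: "0 \<le> V" "0 \<le> W" unfolding V_def W_def using h by (auto intro: prod_nonneg)
  have lu: "weight_sum lo P h \<le> V" "V \<le> weight_sum up P h"
    using assms(5) h unfolding sieve_weights_def V_def by auto
  have bf: "W \<le> alt_elem_sym b Q h" "alt_elem_sym (Suc b) Q h \<le> W"
    using bonferroni[of Q h b] bonferroni[of Q h "Suc b"] assms h by (auto simp: W_def)
  have e: "alt_elem_sym (Suc b) Q h = alt_elem_sym b Q h - elem_sym (Suc b) Q h"
    using assms(4) by (simp add: alt_elem_sym_def)
  have en: "0 \<le> elem_sym (Suc b) Q h" using h by (intro elem_sym_nonneg) auto
  have "weight_sum lo P h * alt_elem_sym b Q h - weight_sum up P h * elem_sym (Suc b) Q h
      \<le> V * alt_elem_sym b Q h - V * elem_sym (Suc b) Q h"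
    using lu bf nn en by (intro diff_mono mult_right_mono) auto
  also have "\<dots> = V * alt_elem_sym (Suc b) Q h" by (simp add: e algebra_simps)
  also have "\<dots> \<le> V * W" using bf nn by (intro mult_left_mono)
  finally have 1: "weight_sum lo P h * alt_elem_sym b Q h - weight_sum up P h * elem_sym (Suc b) Q h \<le> V * W" .
  have 2: "V * W \<le> weight_sum up P h * alt_elem_sym b Q h" using lu bf nn by (intro mult_mono) auto
  show "weight_sum (ext_lower P Q b lo up) (P \<union> Q) h \<le> (\<Prod>p\<in>P \<union> Q. 1 - h p) \<and>
     (\<Prod>p\<in>P \<union> Q. 1 - h p) \<le> weight_sum (ext_upper P Q b up) (P \<union> Q) h"
    using 1 2 assms by (simp add: weight_sum_ext VW)
qed

text \<open>The constant 5 is the base of the error term in the count of integers in given residue classes, see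
\<open>card_sieved_progression\<close>.\<close>

lemma remainder_ext:
  assumes "finite P" "finite Q" "P \<inter> Q = {}"
    and "weight_sum (\<lambda>D. \<bar>lo D\<bar>) P (\<lambda>_. 5) \<le> \<rho>" "weight_sum (\<lambda>D. \<bar>up D\<bar>) P (\<lambda>_. 5) \<le> \<rho>"
  shows "weight_sum (\<lambda>D. \<bar>ext_lower P Q b lo up D\<bar>) (P \<union> Q) (\<lambda>_. 5) \<le> \<rho> * (1 + 5 * real (card Q)) ^ Suc b"
    and "weight_sum (\<lambda>D. \<bar>ext_upper P Q b up D\<bar>) (P \<union> Q) (\<lambda>_. 5) \<le> \<rho> * (1 + 5 * real (card Q)) ^ Suc b"
proof -
  let ?y = "\<Sum>k\<le>b. elem_sym k Q (\<lambda>_. 5)" and ?e = "elem_sym (Suc b) Q (\<lambda>_. 5)"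
  have nn: "0 \<le> ?y" "0 \<le> ?e" by (auto intro!: sum_nonneg elem_sym_nonneg)
  have rho: "0 \<le> \<rho>" using assms(4) weight_sum_nonneg[of P "\<lambda>_. 5" "\<lambda>D. \<bar>lo D\<bar>"] by auto
  have tot: "?y + ?e \<le> (1 + 5 * real (card Q)) ^ Suc b"
    using sum_elem_sym_const_le[of Q 5 "Suc b"] assms by simp
  have "weight_sum (\<lambda>D. \<bar>ext_lower P Q b lo up D\<bar>) (P \<union> Q) (\<lambda>_. 5)
     \<le> weight_sum (\<lambda>D. \<bar>lo (D \<inter> P)\<bar> * \<bar>trunc_moebius b (D \<inter> Q)\<bar> + \<bar>up (D \<inter> P)\<bar> * of_bool (card (D \<inter> Q) = Suc b)) (P \<union> Q) (\<lambda>_. 5)"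
    by (intro weight_sum_mono) (auto simp: ext_lower_def abs_mult intro: order_trans[OF abs_triangle_ineq4])
  also have "\<dots> = weight_sum (\<lambda>D. \<bar>lo D\<bar>) P (\<lambda>_. 5) * ?y + weight_sum (\<lambda>D. \<bar>up D\<bar>) P (\<lambda>_. 5) * ?e"
    using assms weight_sum_mult[OF assms(1-3), of "\<lambda>D. \<bar>lo D\<bar>" "\<lambda>D. \<bar>trunc_moebius b D\<bar>"]
      weight_sum_mult[OF assms(1-3), of "\<lambda>D. \<bar>up D\<bar>" "\<lambda>D. of_bool (card D = Suc b)"]
    by (simp add: weight_sum_add weight_sum_trunc_moebius)
  also have "\<dots> \<le> \<rho> * ?y + \<rho> * ?e"
    using assms nn by (intro add_mono mult_right_mono) auto
  also have "\<dots> \<le> \<rho> * (1 + 5 * real (card Q)) ^ Suc b"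
    using tot rho by (metis distrib_left mult_left_mono)
  finally show "weight_sum (\<lambda>D. \<bar>ext_lower P Q b lo up D\<bar>) (P \<union> Q) (\<lambda>_. 5) \<le> \<rho> * (1 + 5 * real (card Q)) ^ Suc b" .
  have "weight_sum (\<lambda>D. \<bar>ext_upper P Q b up D\<bar>) (P \<union> Q) (\<lambda>_. 5)
     = weight_sum (\<lambda>D. \<bar>up D\<bar>) P (\<lambda>_. 5) * ?y"
    using assms weight_sum_mult[OF assms(1-3), of "\<lambda>D. \<bar>up D\<bar>" "\<lambda>D. \<bar>trunc_moebius b D\<bar>"]
    by (simp add: weight_sum_trunc_moebius ext_upper_def abs_mult)
  also have "\<dots> \<le> \<rho> * ?y" using assms nn by (intro mult_right_mono) auto
  also have "\<dots> \<le> \<rho> * (1 + 5 * real (card Q)) ^ Suc b" using tot rho nn by (intro mult_left_mono) auto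
  finally show "weight_sum (\<lambda>D. \<bar>ext_upper P Q b up D\<bar>) (P \<union> Q) (\<lambda>_. 5) \<le> \<rho> * (1 + 5 * real (card Q)) ^ Suc b" .
qed

section \<open>Integers in given residue classes\<close>

lemma card_linear_residues:
  fixes q p :: nat
  assumes "coprime q p" "0 < p" "R \<subseteq> {..<p}"
  shows "card {r. r < p \<and> (a + q * r) mod p \<in> R} = card R"
proof -
  let ?f = "\<lambda>r. (a + q * r) mod p"
  have inj: "inj_on ?f {..<p}"
  proof (rule inj_onI)
    fix r s assume rs: "r \<in> {..<p}" "s \<in> {..<p}" "?f r = ?f s"
    have "[a + q * r = a + q * s] (mod p)" using rs by (simp add: cong_def)
    then have "[q * r = q * s] (mod p)" by (simp add: cong_add_lcancel_nat)
    then have "[r = s] (mod p)" using assms(1) by (simp add: cong_mult_lcancel_nat)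
    then show "r = s" using rs by (simp add: cong_def)
  qed
  have surj: "?f ` {..<p} = {..<p}"
    by (rule endo_inj_surj[OF _ _ inj]) (use assms in auto)
  have "?f ` {r. r < p \<and> ?f r \<in> R} = R"
  proof (intro equalityI subsetI)
    fix y assume y: "y \<in> R"
    then have "y \<in> ?f ` {..<p}" using assms(3) surj by auto
    then show "y \<in> ?f ` {r. r < p \<and> ?f r \<in> R}" using y by auto
  qed auto
  moreover have "inj_on ?f {r. r < p \<and> ?f r \<in> R}"
    by (rule inj_on_subset[OF inj]) auto
  ultimately show ?thesis using card_image[of ?f "{r. r < p \<and> ?f r \<in> R}"] by simp
qed

text \<open>Induction on the set of moduli: an integer k in one of the admissible classes r modulo p is written as
r + p k', and k' runs through an interval and satisfies conditions of the same kind. There are at most 4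
classes, so the error grows from E to at most 4 (E + 1), and 5^n - 1 satisfies this recursion.\<close>

lemma card_sieved_progression:
  fixes R :: "nat \<Rightarrow> nat set"
  assumes "finite D" "\<And>p. p \<in> D \<Longrightarrow> prime p \<and> R p \<subseteq> {..<p} \<and> card (R p) \<le> 4"
    "\<And>p. p \<in> D \<Longrightarrow> coprime q p"
  shows "\<bar>real (card {k. k < T \<and> (\<forall>p\<in>D. (a + q * k) mod p \<in> R p)})
      - real T * (\<Prod>p\<in>D. real (card (R p)) / real p)\<bar> \<le> 5 ^ card D - 1"
  using assms
proof (induction D arbitrary: a q T rule: finite_induct)
  case empty
  then show ?case by simp
next
  case (insert p D)
  define G where "G = (\<Prod>p\<in>D. real (card (R p)) / real p)"
  have p: "prime p" "R p \<subseteq> {..<p}" "card (R p) \<le> 4" "coprime q p" using insert.prems by auto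
  have p0: "0 < p" using p prime_gt_0_nat by auto
  have G: "0 \<le> G" "G \<le> 1"
  proof -
    have "real (card (R p')) / real p' \<le> 1" if "p' \<in> D" for p'
    proof -
      have "card (R p') \<le> card {..<p'}" using insert.prems(1) that by (intro card_mono) auto
      then show ?thesis by (auto simp: divide_le_eq_1)
    qed
    then show "0 \<le> G" "G \<le> 1" unfolding G_def by (auto intro!: prod_nonneg prod_le_1)
  qed
  define S where "S = {r. r < p \<and> (a + q * r) mod p \<in> R p}"
  have S: "finite S" "card S = card (R p)"
    using card_linear_residues[OF p(4) p0 p(2), of a] by (auto simp: S_def)
  define X where "X r = {k. k < T \<and> k mod p = r \<and> (\<forall>p'\<in>D. (a + q * k) mod p' \<in> R p')}" for r
  have key: "{k. k < T \<and> (\<forall>p'\<in>insert p D. (a + q * k) mod p' \<in> R p')} = (\<Union>r\<in>S. X r)"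
  proof -
    have "(a + q * k) mod p = (a + q * (k mod p)) mod p" for k
      by (metis mod_add_right_eq mod_mult_right_eq)
    then show ?thesis using p0 unfolding S_def X_def by auto
  qed
  have "card (\<Union>r\<in>S. X r) = (\<Sum>r\<in>S. card (X r))"
    using S by (intro card_UN_disjoint) (auto simp: X_def)
  then have cardeq: "real (card {k. k < T \<and> (\<forall>p'\<in>insert p D. (a + q * k) mod p' \<in> R p')}) = (\<Sum>r\<in>S. real (card (X r)))"
    unfolding key by simp
  have bound: "\<bar>real (card (X r)) - real T * G / real p\<bar> \<le> 5 ^ card D" if "r \<in> S" for r
  proof -
    have r: "r < p" using that by (simp add: S_def)
    \<comment> \<open>the number of k with r + p k below T\<close>
    define t where "t = (T + p - 1 - r) div p"
    have t_iff: "k < t \<longleftrightarrow> r + p * k < T" for k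
    proof -
      have "k < t \<longleftrightarrow> Suc k * p \<le> T + p - 1 - r"
        unfolding t_def using p0 less_eq_div_iff_mult_less_eq[of p "Suc k" "T + p - 1 - r"] by (simp add: Suc_le_eq)
      also have "\<dots> \<longleftrightarrow> r + p * k < T" using r by (simp add: mult.commute[of k]) linarith
      finally show ?thesis .
    qed
    have shift: "(a + q * r) + (q * p) * k = a + q * (r + p * k)" for k by (simp add: algebra_simps)
    have "bij_betw (\<lambda>k. r + p * k) {k. k < t \<and> (\<forall>p'\<in>D. ((a + q * r) + (q * p) * k) mod p' \<in> R p')} (X r)"
      unfolding X_def shift
    proof (intro bij_betw_byWitness[where f' = "\<lambda>k. k div p"] ballI subsetI)
      fix k assume "k \<in> {k. k < T \<and> k mod p = r \<and> (\<forall>p'\<in>D. (a + q * k) mod p' \<in> R p')}"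
      then show "r + p * (k div p) = k" by (auto simp: mod_mult_div_eq)
    next
      fix k assume "k \<in> (\<lambda>k. k div p) ` {k. k < T \<and> k mod p = r \<and> (\<forall>p'\<in>D. (a + q * k) mod p' \<in> R p')}"
      then obtain l where l: "k = l div p" "l < T" "l mod p = r" "\<forall>p'\<in>D. (a + q * l) mod p' \<in> R p'" by auto
      then have "r + p * k = l" by (auto simp: mod_mult_div_eq)
      then show "k \<in> {k. k < t \<and> (\<forall>p'\<in>D. (a + q * (r + p * k)) mod p' \<in> R p')}"
        using l unfolding mem_Collect_eq t_iff by simp
    qed (use r in \<open>auto simp: t_iff\<close>)
    then have "card (X r) = card {k. k < t \<and> (\<forall>p'\<in>D. ((a + q * r) + (q * p) * k) mod p' \<in> R p')}"
      by (rule bij_betw_same_card[symmetric])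
    moreover have "coprime (q * p) p'" if "p' \<in> D" for p'
    proof -
      have "p \<noteq> p'" using that insert.hyps by auto
      then have "coprime p p'" using insert.prems(1)[of p'] that p(1) by (intro primes_coprime) auto
      then show ?thesis using insert.prems(2)[of p'] that by simp
    qed
    ultimately have 1: "\<bar>real (card (X r)) - real t * G\<bar> \<le> 5 ^ card D - 1"
      using insert.IH[of "q * p" t "a + q * r"] insert.prems by (simp add: G_def)
    have "real t \<le> real T / real p + 1"
    proof -
      have "t * p \<le> T + p - 1 - r" unfolding t_def by simp
      then have "real t * real p \<le> real T + real p" by (simp flip: of_nat_mult of_nat_add)
      then show ?thesis using p0 by (simp add: field_simps)
    qed
    moreover have "real T / real p - 1 \<le> real t"
    proof -
      have "\<not> r + p * t < T" using t_iff[of t] by simp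
      then have "T \<le> p * t + p" using r by simp
      then have "real T \<le> real p * real t + real p" by (simp flip: of_nat_mult of_nat_add)
      then show ?thesis using p0 by (simp add: field_simps)
    qed
    ultimately have "\<bar>real t - real T / real p\<bar> * G \<le> 1 * 1" using G by (intro mult_mono) auto
    moreover have "\<bar>real t * G - real T * G / real p\<bar> = \<bar>real t - real T / real p\<bar> * G"
    proof -
      have "real t * G - real T * G / real p = (real t - real T / real p) * G" by (simp add: left_diff_distrib)
      then show ?thesis using G by (simp add: abs_mult)
    qed
    ultimately have "\<bar>real t * G - real T * G / real p\<bar> \<le> 1" by simp
    then show ?thesis using 1 by linarith
  qed
  have "\<bar>(\<Sum>r\<in>S. real (card (X r))) - real (card S) * (real T * G / real p)\<bar>
      = \<bar>\<Sum>r\<in>S. (real (card (X r)) - real T * G / real p)\<bar>" by (simp add: sum_subtractf)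
  also have "\<dots> \<le> (\<Sum>r\<in>S. \<bar>real (card (X r)) - real T * G / real p\<bar>)" by (rule sum_abs)
  also have "\<dots> \<le> (\<Sum>r\<in>S. 5 ^ card D)" by (intro sum_mono bound)
  also have "\<dots> = real (card S) * 5 ^ card D" by simp
  also have "\<dots> \<le> 4 * 5 ^ card D" using p(3) S(2) by (intro mult_right_mono) auto
  also have "\<dots> \<le> 5 ^ Suc (card D) - 1" by simp
  finally show ?case
    unfolding cardeq using insert.hyps S(2) by (simp add: G_def mult_ac)
qed

section \<open>Sums over primes in doubly exponential blocks\<close>

lemma prod_primes_dvd:
  fixes N :: nat
  assumes "finite S" "\<And>p. p \<in> S \<Longrightarrow> prime p \<and> p dvd N"
  shows "\<Prod>S dvd N"
  using assms
proof (induction S rule: finite_induct)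
  case (insert p S)
  have "coprime p (\<Prod>S)"
    using insert by (intro prod_coprime_right) (metis insert_iff primes_coprime)
  then show ?case using insert by (simp add: divides_mult)
qed simp

text \<open>Chebyshev's argument: every prime between n and 2n divides the central binomial coefficient, which is at
most 4^n.\<close>

lemma card_primes_dyadic:
  "k * card {p. prime p \<and> 2 ^ k < p \<and> p \<le> (2::nat) ^ Suc k} \<le> 2 * 2 ^ k"
proof -
  define n :: nat where "n = 2 ^ k"
  define S where "S = {p. prime p \<and> n < p \<and> p \<le> 2 * n}"
  have fin: "finite S" by (rule finite_subset[of _ "{..2 * n}"]) (auto simp: S_def)
  have dv: "prime p \<and> p dvd (2 * n choose n)" if "p \<in> S" for p
  proof -
    have p: "prime p" "n < p" "p \<le> 2 * n" using that by (auto simp: S_def)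
    have "p dvd fact (2 * n)" using p by (simp add: prime_dvd_fact_iff)
    also have "fact (2 * n) = fact n * fact n * (2 * n choose n)"
      using binomial_fact_lemma[of n "2 * n"] by simp
    finally have "p dvd fact n * fact n * (2 * n choose n)" .
    moreover have "\<not> p dvd fact n" using p by (simp add: prime_dvd_fact_iff)
    ultimately show ?thesis using p by (simp add: prime_dvd_mult_iff)
  qed
  have "n ^ card S \<le> \<Prod>S"
    using prod_mono[of S "\<lambda>_. n" "\<lambda>p. p"] by (auto simp: S_def)
  also have "\<dots> \<le> (2 * n choose n)"
    using prod_primes_dvd[OF fin dv] by (intro dvd_imp_le) auto
  also have "\<dots> \<le> 2 ^ (2 * n)" by (rule binomial_le_pow2)
  finally have "(2::nat) ^ (k * card S) \<le> 2 ^ (2 * n)" by (simp add: n_def power_mult)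
  then have "k * card S \<le> 2 * n" by (rule power_le_imp_le_exp[rotated]) simp
  then show ?thesis by (simp add: S_def n_def)
qed

text \<open>With exponents doubling from block to block the sum of the reciprocals of the primes in a block is bounded,
while a product of primes from the j-th block below the top is only a 2^j-th root as large (on a
logarithmic scale) as one from the top block. So the truncation point may grow as the blocks get smaller.\<close>

definition prime_block :: "nat \<Rightarrow> nat set" where
  "prime_block j = {p. prime p \<and> 2 ^ (2 ^ j) < p \<and> p \<le> 2 ^ (2 ^ Suc j)}"

lemma finite_prime_block: "finite (prime_block j)"
  by (rule finite_subset[of _ "{..2 ^ (2 ^ Suc j)}"]) (auto simp: prime_block_def)

lemma sum_inverse_primes_dyadic:
  assumes "0 < k"
  shows "(\<Sum>p | prime p \<and> 2 ^ k < p \<and> p \<le> (2::nat) ^ Suc k. 1 / real p) \<le> 2 / real k"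
proof -
  let ?S = "{p. prime p \<and> 2 ^ k < p \<and> p \<le> (2::nat) ^ Suc k}"
  have "(\<Sum>p\<in>?S. 1 / real p) \<le> (\<Sum>p\<in>?S. 1 / 2 ^ k)"
  proof (intro sum_mono divide_left_mono)
    fix p assume "p \<in> ?S"
    then have "2 ^ k < p" by simp
    then show "2 ^ k \<le> real p" by (metis less_imp_le numeral_power_le_of_nat_cancel_iff)
    then show "0 < real p * 2 ^ k" using order_less_le_trans[OF _ \<open>2 ^ k \<le> real p\<close>, of 0] by simp
  qed simp
  also have "\<dots> = real (card ?S) / 2 ^ k" by simp
  also have "\<dots> \<le> 2 / real k"
  proof -
    have "real (k * card ?S) \<le> real (2 * 2 ^ k)" using card_primes_dyadic[of k] by (simp only: of_nat_le_iff)
    then show ?thesis using assms by (simp add: field_simps)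
  qed
  finally show ?thesis .
qed

lemma sum_inverse_prime_block: "(\<Sum>p\<in>prime_block j. 1 / real p) \<le> 2"
proof -
  have "(\<Sum>p | prime p \<and> 2 ^ a < p \<and> p \<le> (2::nat) ^ (a + d). 1 / real p) \<le> (\<Sum>i<d. 2 / real (a + i))"
    if "0 < a" for a d
  proof (induction d)
    case 0
    then show ?case by (auto intro: order.trans[OF eq_refl[OF sum.neutral]])
  next
    case (Suc d)
    have "{p. prime p \<and> 2 ^ a < p \<and> p \<le> (2::nat) ^ (a + Suc d)}
       = {p. prime p \<and> 2 ^ a < p \<and> p \<le> (2::nat) ^ (a + d)} \<union> {p. prime p \<and> 2 ^ (a + d) < p \<and> p \<le> (2::nat) ^ Suc (a + d)}"
    proof -
      define x y z :: nat where "x = 2 ^ a" and "y = 2 ^ (a + d)" and "z = 2 ^ Suc (a + d)"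
      have "x \<le> y" "y \<le> z" unfolding x_def y_def z_def by (intro power_increasing; simp)+
      then show ?thesis unfolding add_Suc_right x_def[symmetric] y_def[symmetric] z_def[symmetric] by auto
    qed
    moreover have "finite {p. prime p \<and> 2 ^ a < p \<and> p \<le> (2::nat) ^ (a + d)}"
      by (rule finite_subset[of _ "{..2 ^ (a + d)}"]) auto
    moreover have "finite {p. prime p \<and> 2 ^ (a + d) < p \<and> p \<le> (2::nat) ^ Suc (a + d)}"
      by (rule finite_subset[of _ "{..2 ^ Suc (a + d)}"]) auto
    ultimately have "(\<Sum>p | prime p \<and> 2 ^ a < p \<and> p \<le> (2::nat) ^ (a + Suc d). 1 / real p)
      = (\<Sum>p | prime p \<and> 2 ^ a < p \<and> p \<le> (2::nat) ^ (a + d). 1 / real p)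
      + (\<Sum>p | prime p \<and> 2 ^ (a + d) < p \<and> p \<le> (2::nat) ^ Suc (a + d). 1 / real p)"
      by (simp only:) (rule sum.union_disjoint, auto)
    then show ?case using Suc sum_inverse_primes_dyadic[of "a + d"] that by simp
  qed
  from this[of "2 ^ j" "2 ^ j"] have "(\<Sum>p\<in>prime_block j. 1 / real p) \<le> (\<Sum>i<(2::nat) ^ j. 2 / real (2 ^ j + i))"
    by (simp add: prime_block_def mult_2)
  also have "\<dots> \<le> (\<Sum>i<(2::nat) ^ j. 2 / 2 ^ j)"
    by (intro sum_mono divide_left_mono) (auto intro!: mult_pos_pos add_pos_nonneg)
  also have "\<dots> = 2" by simp
  finally show ?thesis .
qed

section \<open>The block sieve\<close>

lemma exp_le_one_minus:
  fixes x :: real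
  assumes "0 \<le> x" "x \<le> 1 / 2"
  shows "exp (- 2 * x) \<le> 1 - x"
proof -
  have "1 \<le> (1 + 2 * x) * (1 - x)" using assms mult_nonneg_nonneg[of x "1 - 2 * x"] by (simp add: algebra_simps)
  also have "\<dots> \<le> exp (2 * x) * (1 - x)" using assms exp_ge_add_one_self[of "2 * x"] by (intro mult_right_mono) auto
  finally show ?thesis by (simp add: exp_minus field_simps)
qed

lemma exp_le_prod_one_minus:
  fixes g :: "'a \<Rightarrow> real"
  assumes "\<And>p. p \<in> Q \<Longrightarrow> 0 \<le> g p \<and> g p \<le> 1 / 2"
  shows "exp (- 2 * (\<Sum>p\<in>Q. g p)) \<le> (\<Prod>p\<in>Q. 1 - g p)"
proof -
  have "exp (- 2 * (\<Sum>p\<in>Q. g p)) = (\<Prod>p\<in>Q. exp (- 2 * g p))"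
    by (cases "finite Q") (simp_all add: sum_distrib_left exp_sum)
  also have "\<dots> \<le> (\<Prod>p\<in>Q. 1 - g p)"
    using assms exp_le_one_minus[of "g _"] by (intro prod_mono) (auto simp del: mult_minus_left)
  finally show ?thesis .
qed

lemma weight_sum_moebius:
  assumes "finite P"
  shows "weight_sum (\<lambda>D. (-1) ^ card D) P h = (\<Prod>p\<in>P. 1 - h p)"
proof -
  have "(\<Prod>p\<in>P. - h p + 1) = (\<Sum>D\<in>Pow P. (\<Prod>p\<in>D. - h p) * (\<Prod>p\<in>P - D. 1))"
    using prod_add[OF assms, of "\<lambda>p. - h p" "\<lambda>_. 1"] by simp
  also have "\<dots> = weight_sum (\<lambda>D. (-1) ^ card D) P h"
    unfolding weight_sum_def by (simp add: prod_uminus)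
  finally show ?thesis by simp
qed

text \<open>At most 4 classes are removed modulo each prime, so from 5 onwards something is left.\<close>

definition primes_5_upto :: "nat \<Rightarrow> nat set" where
  "primes_5_upto j = {p. prime p \<and> 5 \<le> p \<and> p \<le> 2 ^ (2 ^ j)}"

lemma finite_primes_5_upto: "finite (primes_5_upto j)"
  by (rule finite_subset[of _ "{..2 ^ (2 ^ j)}"]) (auto simp: primes_5_upto_def)

lemma primes_5_upto_Suc:
  assumes "2 \<le> j"
  shows "primes_5_upto (Suc j) = primes_5_upto j \<union> prime_block j" "primes_5_upto j \<inter> prime_block j = {}"
    "p \<in> prime_block j \<Longrightarrow> 8 \<le> p"
proof -
  define x y :: nat where "x = 2 ^ (2 ^ j)" and "y = 2 ^ (2 ^ Suc j)"
  have "(2::nat) ^ 2 \<le> 2 ^ j" by (rule power_increasing) (use assms in auto)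
  then have "(2::nat) ^ 4 \<le> x" unfolding x_def by (intro power_increasing) auto
  moreover have "x \<le> y" unfolding x_def y_def by (intro power_increasing) auto
  ultimately show "primes_5_upto (Suc j) = primes_5_upto j \<union> prime_block j" "primes_5_upto j \<inter> prime_block j = {}"
    "p \<in> prime_block j \<Longrightarrow> 8 \<le> p"
    unfolding primes_5_upto_def prime_block_def x_def[symmetric] y_def[symmetric] by auto
qed

text \<open>The sum of the densities over a block is at most 8, and the product of the complementary densities is at
least exp(-16); this chooses the truncation so late that the relative error in a block is tiny.\<close>

lemma ex_truncation:
  obtains B :: nat where "\<And>k. B \<le> k \<Longrightarrow> 8 ^ k / fact k * exp (16::real) \<le> (1 / 2) ^ k"
proof -
  have "(\<lambda>k. inverse (fact k) * (16::real) ^ k) \<longlonglongrightarrow> 0"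
    by (rule summable_LIMSEQ_zero[OF summable_exp])
  then have "\<forall>\<^sub>F k in sequentially. inverse (fact k) * (16::real) ^ k < exp (- 16)"
    by (rule order_tendstoD) simp
  then obtain B where B: "\<And>k. B \<le> k \<Longrightarrow> inverse (fact k) * (16::real) ^ k < exp (- 16)"
    by (auto simp: eventually_sequentially)
  have "8 ^ k / fact k * exp (16::real) \<le> (1 / 2) ^ k" if "B \<le> k" for k
  proof -
    have "(16::real) ^ k = 8 ^ k * 2 ^ k" by (simp flip: power_mult_distrib)
    then show ?thesis using B[OF that] by (simp add: exp_minus field_simps)
  qed
  then show ?thesis by (rule that)
qed

text \<open>The primes up to 16 are treated by the full inclusion-exclusion formula, and then the blocks are adjoined one
after the other. The i-th block from the top is truncated at 2 (B + i), with a relative loss of at most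
2^(-i-1) in the main term, so that at least half of the main term survives. The exponent in the remainder
is at most a constant times 2^J by \<open>sum_pow2_linear_le\<close>.\<close>

lemma block_sieve:
  fixes g :: "nat \<Rightarrow> real"
  assumes B: "\<And>k. B \<le> k \<Longrightarrow> 8 ^ k / fact k * exp (16::real) \<le> (1 / 2) ^ k"
    and g: "\<And>p. prime p \<Longrightarrow> 5 \<le> p \<Longrightarrow> 0 \<le> g p \<and> g p \<le> 4 / real p"
    and j: "2 \<le> j" "j \<le> J"
  shows "\<exists>lo up. sieve_weights (primes_5_upto j) lo up
      \<and> (1 / 5) ^ card (primes_5_upto 2) * exp (- 16 * real j) \<le> weight_sum up (primes_5_upto j) g
      \<and> (1 - (1 / 2) ^ Suc (J - j)) * weight_sum up (primes_5_upto j) g \<le> weight_sum lo (primes_5_upto j) g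
      \<and> weight_sum (\<lambda>D. \<bar>lo D\<bar>) (primes_5_upto j) (\<lambda>_. 5) \<le> 6 ^ card (primes_5_upto 2) * 2 ^ (\<Sum>i<j. 6 * 2 ^ i * (2 * (B + (J - i)) + 1))
      \<and> weight_sum (\<lambda>D. \<bar>up D\<bar>) (primes_5_upto j) (\<lambda>_. 5) \<le> 6 ^ card (primes_5_upto 2) * 2 ^ (\<Sum>i<j. 6 * 2 ^ i * (2 * (B + (J - i)) + 1))"
  using j
proof (induction j rule: dec_induct)
  case base
  let ?P = "primes_5_upto 2" and ?mu = "\<lambda>D :: nat set. (-1) ^ card D :: real"
  let ?E = "\<Sum>i<2. 6 * 2 ^ i * (2 * (B + (J - i)) + 1)"
  note fin = finite_primes_5_upto[of 2]
  have w: "sieve_weights ?P ?mu ?mu" by (simp add: sieve_weights_def weight_sum_moebius[OF fin])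
  have "(1 / 5) ^ card ?P * exp (- 16 * real 2) \<le> (1 / 5) ^ card ?P * 1" by (intro mult_left_mono) auto
  also have "\<dots> = (\<Prod>p\<in>?P. 1 / 5)" by simp
  also have "\<dots> \<le> (\<Prod>p\<in>?P. 1 - g p)"
  proof (intro prod_mono conjI)
    fix p assume p: "p \<in> ?P"
    then have "g p \<le> 4 / real p" using g[of p] by (auto simp: primes_5_upto_def)
    also have "\<dots> \<le> 4 / 5" using p by (intro divide_left_mono) (auto simp: primes_5_upto_def)
    finally show "1 / 5 \<le> 1 - g p" by simp
  qed auto
  finally have Y: "(1 / 5) ^ card ?P * exp (- 16 * real 2) \<le> (\<Prod>p\<in>?P. 1 - g p)" .
  have "0 \<le> (\<Prod>p\<in>?P. 1 - g p)" by (rule order.trans[OF _ Y]) simp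
  then have lo: "(1 - (1 / 2) ^ Suc (J - 2)) * (\<Prod>p\<in>?P. 1 - g p) \<le> (\<Prod>p\<in>?P. 1 - g p)"
    by (intro mult_left_le_one_le) (auto simp del: power_Suc simp: power_le_one)
  have "weight_sum (\<lambda>D. \<bar>?mu D\<bar>) ?P (\<lambda>_. 5) = (\<Prod>p\<in>?P. 1 - (- 5))"
    unfolding weight_sum_moebius[OF fin, symmetric] weight_sum_def by (intro sum.cong refl) (simp add: power_minus_Bit0 flip: power_mult_distrib)
  also have "\<dots> = 6 ^ card ?P" by simp
  also have "\<dots> \<le> 6 ^ card ?P * 2 ^ ?E" by simp
  finally have R: "weight_sum (\<lambda>D. \<bar>?mu D\<bar>) ?P (\<lambda>_. 5) \<le> 6 ^ card ?P * 2 ^ ?E" .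
  show ?case
    by (intro exI[of _ ?mu] conjI w R) (use Y lo in \<open>simp_all only: weight_sum_moebius[OF fin]\<close>)
next
  case (step j)
  let ?P = "primes_5_upto j" and ?Q = "prime_block j" and ?c = "card (primes_5_upto 2)"
  let ?E = "\<lambda>j. \<Sum>i<j. 6 * 2 ^ i * (2 * (B + (J - i)) + 1)"
  define b where "b = 2 * (B + (J - j))"
  obtain lo up where
    w: "sieve_weights ?P lo up" and
    Y: "(1 / 5) ^ ?c * exp (- 16 * real j) \<le> weight_sum up ?P g" and
    lo: "(1 - (1 / 2) ^ Suc (J - j)) * weight_sum up ?P g \<le> weight_sum lo ?P g" and
    R: "weight_sum (\<lambda>D. \<bar>lo D\<bar>) ?P (\<lambda>_. 5) \<le> 6 ^ ?c * 2 ^ ?E j"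
       "weight_sum (\<lambda>D. \<bar>up D\<bar>) ?P (\<lambda>_. 5) \<le> 6 ^ ?c * 2 ^ ?E j"
    using step.IH step.prems by auto
  note PQ = primes_5_upto_Suc[OF step.hyps(1)]
  note fin = finite_primes_5_upto[of j] finite_prime_block[of j] PQ(2)
  have gQ: "0 \<le> g p \<and> g p \<le> 4 / real p \<and> g p \<le> 1 / 2" if "p \<in> ?Q" for p
  proof -
    have p: "prime p" "8 \<le> p" using that PQ(3) by (auto simp: prime_block_def)
    have "4 / real p \<le> 4 / 8" using p by (intro divide_left_mono) auto
    moreover have "0 \<le> g p \<and> g p \<le> 4 / real p" using g[of p] p by auto
    ultimately show ?thesis by linarith
  qed
  define S where "S = (\<Sum>p\<in>?Q. g p)"
  have S: "0 \<le> S" "S \<le> 8"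
  proof -
    show "0 \<le> S" using gQ by (auto simp: S_def intro: sum_nonneg)
    have "S \<le> (\<Sum>p\<in>?Q. 4 * (1 / real p))" unfolding S_def using gQ by (intro sum_mono) auto
    also have "\<dots> \<le> 8" using sum_inverse_prime_block[of j] by (simp only: sum_distrib_left[symmetric])
    finally show "S \<le> 8" .
  qed
  define T where "T = alt_elem_sym b ?Q g"
  have T: "exp (- 16) \<le> T"
  proof -
    have "exp (- 16) \<le> exp (- 2 * S)" using S by simp
    also have "\<dots> \<le> (\<Prod>p\<in>?Q. 1 - g p)" unfolding S_def using gQ by (intro exp_le_prod_one_minus) auto
    also have "\<dots> \<le> T" unfolding T_def using bonferroni[of ?Q g b] gQ fin by (force simp: b_def)
    finally show ?thesis .
  qed
  have Tpos: "0 < T" by (rule less_le_trans[OF _ T]) simp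
  have e: "elem_sym (Suc b) ?Q g \<le> (1 / 2) ^ Suc (J - j) * T"
  proof -
    have "elem_sym (Suc b) ?Q g \<le> S ^ Suc b / fact (Suc b)"
      unfolding S_def using gQ fin by (intro elem_sym_le) auto
    also have "\<dots> \<le> 8 ^ Suc b / fact (Suc b)" using S by (intro divide_right_mono power_mono) auto
    also have "\<dots> = (8 ^ Suc b / fact (Suc b) * exp 16) * exp (- 16)" by (simp add: exp_minus)
    also have "\<dots> \<le> (1 / 2) ^ Suc b * exp (- 16)" by (intro mult_right_mono B) (auto simp: b_def)
    also have "\<dots> \<le> (1 / 2) ^ Suc (J - j) * T" by (intro mult_mono T power_decreasing) (auto simp: b_def)
    finally show ?thesis .
  qed
  define Y1 where "Y1 = weight_sum up ?P g"
  have Y1: "0 < Y1" unfolding Y1_def by (rule less_le_trans[OF _ Y]) simp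
  define lo' up' where "lo' = ext_lower ?P ?Q b lo up" and "up' = ext_upper ?P ?Q b up"
  have up': "weight_sum up' (primes_5_upto (Suc j)) g = Y1 * T"
    unfolding PQ(1) up'_def Y1_def T_def using weight_sum_ext[OF fin] by simp
  have w': "sieve_weights (primes_5_upto (Suc j)) lo' up'"
    unfolding PQ(1) lo'_def up'_def by (intro sieve_weights_ext fin w) (simp add: b_def)
  have "(1 / 5) ^ ?c * exp (- 16 * real (Suc j)) = ((1 / 5) ^ ?c * exp (- 16 * real j)) * exp (- 16)"
    by (simp add: exp_add[symmetric] algebra_simps)
  also have "\<dots> \<le> Y1 * T" using Y T by (intro mult_mono) (auto simp: Y1_def[symmetric] intro: less_imp_le[OF Y1])
  finally have Y': "(1 / 5) ^ ?c * exp (- 16 * real (Suc j)) \<le> Y1 * T" .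
  have "Suc (J - Suc j) = J - j" using step.hyps step.prems by simp
  then have "(1 - (1 / 2) ^ Suc (J - Suc j)) * (Y1 * T)
      = (1 - (1 / 2) ^ Suc (J - j)) * Y1 * T - Y1 * ((1 / 2) ^ Suc (J - j) * T)"
    by (simp only:) (simp add: algebra_simps)
  also have "\<dots> \<le> weight_sum lo ?P g * T - Y1 * elem_sym (Suc b) ?Q g"
    using lo e Y1 Tpos by (intro diff_mono mult_right_mono mult_left_mono) (auto simp: Y1_def)
  also have "\<dots> = weight_sum lo' (primes_5_upto (Suc j)) g"
    unfolding PQ(1) lo'_def Y1_def T_def using weight_sum_ext[OF fin] by simp
  finally have lo': "(1 - (1 / 2) ^ Suc (J - Suc j)) * (Y1 * T) \<le> weight_sum lo' (primes_5_upto (Suc j)) g" .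
  have size: "6 ^ ?c * 2 ^ ?E j * (1 + 5 * real (card ?Q)) ^ Suc b \<le> 6 ^ ?c * 2 ^ ?E (Suc j)"
  proof -
    have "card ?Q \<le> card {0<..(2::nat) ^ 2 ^ Suc j}" by (intro card_mono) (auto simp: prime_block_def prime_gt_0_nat)
    then have "card ?Q \<le> 2 ^ 2 ^ Suc j" by simp
    moreover have "1 \<le> (2::nat) ^ 2 ^ Suc j" by (rule one_le_power) simp
    ultimately have "1 + 5 * card ?Q \<le> 8 * 2 ^ 2 ^ Suc j" by linarith
    also have "(8::nat) = 2 ^ 3" by simp
    finally have "1 + 5 * card ?Q \<le> 2 ^ 3 * 2 ^ 2 ^ Suc j" .
    also have "\<dots> = 2 ^ (3 + 2 ^ Suc j)" by (simp only: power_add)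
    also have "\<dots> \<le> 2 ^ (6 * 2 ^ j)"
    proof (intro power_increasing)
      have "1 \<le> (2::nat) ^ j" by simp
      then have "3 + 2 * 2 ^ j \<le> 6 * (2::nat) ^ j" by linarith
      then show "3 + 2 ^ Suc j \<le> 6 * (2::nat) ^ j" by simp
    qed simp
    finally have "real (1 + 5 * card ?Q) \<le> real (2 ^ (6 * 2 ^ j))" by (simp only: of_nat_le_iff)
    then have "(1 + 5 * real (card ?Q)) ^ Suc b \<le> (2 ^ (6 * 2 ^ j)) ^ Suc b" by (intro power_mono) auto
    also have "\<dots> = 2 ^ (6 * 2 ^ j * (2 * (B + (J - j)) + 1))" by (simp only: power_mult[symmetric] b_def Suc_eq_plus1)
    finally have "6 ^ ?c * 2 ^ ?E j * (1 + 5 * real (card ?Q)) ^ Suc b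
        \<le> 6 ^ ?c * 2 ^ ?E j * 2 ^ (6 * 2 ^ j * (2 * (B + (J - j)) + 1))" by (intro mult_left_mono) auto
    also have "\<dots> = 6 ^ ?c * 2 ^ ?E (Suc j)" by (simp only: sum.lessThan_Suc power_add mult.assoc)
    finally show ?thesis .
  qed
  show ?case
    using w' Y' lo' remainder_ext[OF fin R, of b] size
    by (intro exI[of _ lo'] exI[of _ up'] conjI) (simp_all only: up', auto simp: PQ(1) lo'_def up'_def intro: order.trans)
qed

lemma sum_pow2_linear_le: "(\<Sum>i<J. 6 * 2 ^ i * (2 * (B + (J - i)) + 1)) \<le> 6 * (2 * B + 5) * (2::nat) ^ J"
proof -
  have 1: "(\<Sum>i<J. 2 ^ i * (J - i)) \<le> 2 * (2::nat) ^ J"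
  proof (induction J)
    case (Suc J)
    have "(\<Sum>i<Suc J. 2 ^ i * (Suc J - i)) = (\<Sum>i<J. 2 ^ i * (J - i)) + (\<Sum>i<Suc J. (2::nat) ^ i)"
    proof -
      have "(\<Sum>i<J. 2 ^ i * (Suc J - i)) = (\<Sum>i<J. 2 ^ i * (J - i) + 2 ^ i)"
        by (intro sum.cong refl) (simp add: Suc_diff_le)
      then show ?thesis by (simp add: sum.distrib)
    qed
    also have "(\<Sum>i<Suc J. (2::nat) ^ i) \<le> 2 ^ Suc J" using sum_power2[of "Suc J"] by (simp only: lessThan_atLeast0)
    finally show ?case using Suc by simp
  qed simp
  have 2: "(\<Sum>i<J. (2::nat) ^ i) \<le> 2 ^ J" using sum_power2[of J] by (simp add: lessThan_atLeast0)
  have "(\<Sum>i<J. 6 * 2 ^ i * (2 * (B + (J - i)) + 1)) = 6 * (2 * B + 1) * (\<Sum>i<J. 2 ^ i) + 12 * (\<Sum>i<J. 2 ^ i * (J - i))"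
    by (simp add: sum_distrib_left sum.distrib[symmetric] algebra_simps)
  also have "\<dots> \<le> 6 * (2 * B + 1) * 2 ^ J + 12 * (2 * 2 ^ J)"
    using 1 2 by (intro add_mono mult_left_mono) auto
  also have "\<dots> = 6 * (2 * B + 5) * 2 ^ J" by (simp add: algebra_simps)
  finally show ?thesis .
qed

text \<open>The length of the interval in which the unsifted element is found is a fixed power of the sifting limit
2^(2^J). All constants are absolute, the sets R being arbitrary.\<close>

theorem sieve_of_dimension_4:
  "\<exists>C J0. \<forall>J\<ge>J0. \<forall>R :: nat \<Rightarrow> nat set.
     (\<forall>p. prime p \<longrightarrow> 5 \<le> p \<longrightarrow> R p \<subseteq> {..<p} \<and> card (R p) \<le> 4) \<longrightarrow>
     (\<exists>s < 2 ^ (C * 2 ^ J). \<forall>p. prime p \<longrightarrow> 5 \<le> p \<longrightarrow> p \<le> 2 ^ (2 ^ J) \<longrightarrow> s mod p \<notin> R p)"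
proof -
  obtain B where B: "\<And>k. B \<le> k \<Longrightarrow> 8 ^ k / fact k * exp (16::real) \<le> (1 / 2) ^ k" using ex_truncation by blast
  define c where "c = card (primes_5_upto 2)"
  define C1 where "C1 = 6 * (2 * B + 5)"
  have "filterlim (\<lambda>J. 2 ^ (2 ^ J) * exp (- 16 * real J)) at_top sequentially"
    by real_asymp
  then have "\<forall>\<^sub>F J in sequentially. 2 * 5 ^ c * 6 ^ c < 2 ^ (2 ^ J) * exp (- 16 * real J)"
    by (simp add: filterlim_at_top_dense)
  then obtain J1 where J1: "\<And>J. J1 \<le> J \<Longrightarrow> 2 * 5 ^ c * 6 ^ c < 2 ^ (2 ^ J) * exp (- 16 * real J)"
    by (auto simp: eventually_sequentially)
  have main: "\<exists>s < 2 ^ (Suc C1 * 2 ^ J). \<forall>p :: nat. prime p \<and> 5 \<le> p \<and> p \<le> 2 ^ (2 ^ J) \<longrightarrow> s mod p \<notin> R p"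
    if J: "max 2 J1 \<le> J" and R: "\<And>p. prime p \<Longrightarrow> 5 \<le> p \<Longrightarrow> R p \<subseteq> {..<p} \<and> card (R p) \<le> 4" for J R
  proof (rule ccontr)
    define T :: nat where "T = 2 ^ (Suc C1 * 2 ^ J)"
    \<comment> \<open>otherwise the lower weights have a sum of at most 0 over the interval, while their main term exceeds the remainder\<close>
    assume "\<not> (\<exists>s < 2 ^ (Suc C1 * 2 ^ J). \<forall>p :: nat. prime p \<and> 5 \<le> p \<and> p \<le> 2 ^ (2 ^ J) \<longrightarrow> s mod p \<notin> R p)"
    then have no: "\<exists>p\<in>primes_5_upto J. s mod p \<in> R p" if "s < T" for s
      using that by (auto simp: T_def primes_5_upto_def)
    define g where "g p = real (card (R p)) / real p" for p
    have g: "0 \<le> g p \<and> g p \<le> 4 / real p" if "prime p" "5 \<le> p" for p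
      using R[OF that] by (auto simp: g_def intro: divide_right_mono)
    let ?P = "primes_5_upto J"
    note fin = finite_primes_5_upto[of J]
    obtain lo up where w: "sieve_weights ?P lo up"
      and Y: "(1 / 5) ^ c * exp (- 16 * real J) \<le> weight_sum up ?P g"
      and lo: "(1 - (1 / 2) ^ Suc (J - J)) * weight_sum up ?P g \<le> weight_sum lo ?P g"
      and rem: "weight_sum (\<lambda>D. \<bar>lo D\<bar>) ?P (\<lambda>_. 5) \<le> 6 ^ c * 2 ^ (\<Sum>i<J. 6 * 2 ^ i * (2 * (B + (J - i)) + 1))"
    proof -
      have "2 \<le> J" using J by simp
      from block_sieve[of B g J J, OF B g this order.refl] show ?thesis using that unfolding c_def by blast
    qed
    define h where "h s p = (of_bool (s mod p \<in> R p) :: real)" for s p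
    have "(\<Sum>s<T. weight_sum lo ?P (h s)) \<le> (\<Sum>s<T. 0)"
    proof (rule sum_mono)
      fix s assume s: "s \<in> {..<T}"
      have "weight_sum lo ?P (h s) \<le> (\<Prod>p\<in>?P. 1 - h s p)" 
      proof -
        have "\<forall>p\<in>?P. 0 \<le> h s p \<and> h s p \<le> 1" by (simp add: h_def)
        then show ?thesis using w unfolding sieve_weights_def by blast
      qed
      also have "\<dots> = 0" using no[of s] s fin by (auto simp: h_def intro!: prod_zero)
      finally show "weight_sum lo ?P (h s) \<le> 0" .
    qed
    moreover have "real T * weight_sum lo ?P g - weight_sum (\<lambda>D. \<bar>lo D\<bar>) ?P (\<lambda>_. 5) \<le> (\<Sum>s<T. weight_sum lo ?P (h s))"
    proof -
      have "(\<Sum>s<T. weight_sum lo ?P (h s)) = (\<Sum>D\<in>Pow ?P. lo D * (\<Sum>s<T. \<Prod>p\<in>D. h s p))"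
        unfolding weight_sum_def by (subst sum.swap) (simp add: sum_distrib_left)
      also have "\<dots> = (\<Sum>D\<in>Pow ?P. lo D * real (card {s. s < T \<and> (\<forall>p\<in>D. s mod p \<in> R p)}))"
      proof (intro sum.cong refl arg_cong2[of _ _ _ _ "(*)"])
        fix D assume "D \<in> Pow ?P"
        then have D: "finite D" using fin finite_subset by auto
        have "(\<Sum>s<T. \<Prod>p\<in>D. h s p) = (\<Sum>s<T. of_bool (\<forall>p\<in>D. s mod p \<in> R p))"
        proof (intro sum.cong refl)
          fix s show "(\<Prod>p\<in>D. h s p) = of_bool (\<forall>p\<in>D. s mod p \<in> R p)"
            using D by (cases "\<forall>p\<in>D. s mod p \<in> R p") (auto simp: h_def intro!: prod_zero)
        qed
        also have "\<dots> = real (card {s \<in> {..<T}. \<forall>p\<in>D. s mod p \<in> R p})"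
          by (simp add: of_bool_def sum.If_cases Int_def)
        also have "{s \<in> {..<T}. \<forall>p\<in>D. s mod p \<in> R p} = {s. s < T \<and> (\<forall>p\<in>D. s mod p \<in> R p)}" by auto
        finally show "(\<Sum>s<T. \<Prod>p\<in>D. h s p) = real (card {s. s < T \<and> (\<forall>p\<in>D. s mod p \<in> R p)})" .
      qed
      also have "\<dots> \<ge> (\<Sum>D\<in>Pow ?P. lo D * (real T * (\<Prod>p\<in>D. g p)) - \<bar>lo D\<bar> * (\<Prod>p\<in>D. 5))"
      proof (rule sum_mono)
        fix D assume D: "D \<in> Pow ?P"
        then have finD: "finite D" using fin finite_subset by auto
        define N where "N = real (card {s. s < T \<and> (\<forall>p\<in>D. s mod p \<in> R p)})"
        have "\<bar>real (card {k. k < T \<and> (\<forall>p\<in>D. (0 + 1 * k) mod p \<in> R p)})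
            - real T * (\<Prod>p\<in>D. real (card (R p)) / real p)\<bar> \<le> 5 ^ card D - 1"
          using D R by (intro card_sieved_progression finD) (auto simp: primes_5_upto_def)
        then have "\<bar>N - real T * (\<Prod>p\<in>D. g p)\<bar> \<le> 5 ^ card D" by (simp add: N_def g_def)
        then have "\<bar>lo D\<bar> * \<bar>real T * (\<Prod>p\<in>D. g p) - N\<bar> \<le> \<bar>lo D\<bar> * 5 ^ card D"
          by (intro mult_left_mono) (auto simp: abs_minus_commute)
        then have "lo D * (real T * (\<Prod>p\<in>D. g p) - N) \<le> \<bar>lo D\<bar> * 5 ^ card D"
          unfolding abs_mult[symmetric] by linarith
        then show "lo D * (real T * (\<Prod>p\<in>D. g p)) - \<bar>lo D\<bar> * (\<Prod>p\<in>D. 5) \<le> lo D * N"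
          by (simp add: algebra_simps)
      qed
      also have "(\<Sum>D\<in>Pow ?P. lo D * (real T * (\<Prod>p\<in>D. g p)) - \<bar>lo D\<bar> * (\<Prod>p\<in>D. 5))
          = real T * weight_sum lo ?P g - weight_sum (\<lambda>D. \<bar>lo D\<bar>) ?P (\<lambda>_. 5)"
        unfolding weight_sum_def by (simp add: sum_subtractf sum_distrib_left mult_ac)
      finally show ?thesis .
    qed
    moreover have "6 ^ c * 2 ^ (C1 * 2 ^ J) < real T * weight_sum lo ?P g"
    proof -
      have "6 ^ c * 2 ^ (C1 * 2 ^ J) = 2 ^ (C1 * 2 ^ J) * ((1 / 2) * (1 / 5) ^ c * (2 * 5 ^ c * 6 ^ c :: real))"
        by (simp add: power_one_over)
      also have "\<dots> < 2 ^ (C1 * 2 ^ J) * ((1 / 2) * (1 / 5) ^ c * (2 ^ (2 ^ J) * exp (- 16 * real J)))"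
        using J1[of J] J by (intro mult_strict_left_mono) auto
      also have "\<dots> = real T * ((1 / 2) * ((1 / 5) ^ c * exp (- 16 * real J)))" by (simp add: T_def power_add)
      also have "\<dots> \<le> real T * weight_sum lo ?P g" using Y lo by (intro mult_left_mono) auto
      finally show ?thesis .
    qed
    moreover have "weight_sum (\<lambda>D. \<bar>lo D\<bar>) ?P (\<lambda>_. 5) \<le> 6 ^ c * 2 ^ (C1 * 2 ^ J)"
    proof -
      have "(2::real) ^ (\<Sum>i<J. 6 * 2 ^ i * (2 * (B + (J - i)) + 1)) \<le> 2 ^ (C1 * 2 ^ J)"
        unfolding C1_def by (intro power_increasing sum_pow2_linear_le) simp
      then show ?thesis using rem by (meson mult_left_mono order_trans zero_le_numeral zero_le_power)
    qed
    ultimately show False by simp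
  qed
  show ?thesis
  proof (rule exI[of _ "Suc C1"], rule exI[of _ "max 2 J1"], intro allI impI)
    fix J and R :: "nat \<Rightarrow> nat set"
    assume "max 2 J1 \<le> J" "\<forall>p. prime p \<longrightarrow> 5 \<le> p \<longrightarrow> R p \<subseteq> {..<p} \<and> card (R p) \<le> 4"
    then show "\<exists>s < 2 ^ (Suc C1 * 2 ^ J). \<forall>p. prime p \<longrightarrow> 5 \<le> p \<longrightarrow> p \<le> 2 ^ (2 ^ J) \<longrightarrow> s mod p \<notin> R p"
      using main[of J R] by blast
  qed
qed

section \<open>Gaussian integers\<close>

datatype gauss = Gauss (gRe: int) (gIm: int)

lemma gauss_eq_iff: "z = w \<longleftrightarrow> gRe z = gRe w \<and> gIm z = gIm w"
  by (auto intro: gauss.expand)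

instantiation gauss :: comm_ring_1
begin
definition "0 = Gauss 0 0"
definition "1 = Gauss 1 0"
definition "z + w = Gauss (gRe z + gRe w) (gIm z + gIm w)"
definition "z - w = Gauss (gRe z - gRe w) (gIm z - gIm w)"
definition "- z = Gauss (- gRe z) (- gIm z)"
definition "z * w = Gauss (gRe z * gRe w - gIm z * gIm w) (gRe z * gIm w + gIm z * gRe w)"
instance
  by standard
    (simp_all add: zero_gauss_def one_gauss_def plus_gauss_def minus_gauss_def uminus_gauss_def
      times_gauss_def gauss_eq_iff algebra_simps)
end

lemma gauss_sel [simp]:
  "gRe 0 = 0" "gIm 0 = 0" "gRe 1 = 1" "gIm 1 = 0"
  "gRe (z + w) = gRe z + gRe w" "gIm (z + w) = gIm z + gIm w"
  "gRe (z - w) = gRe z - gRe w" "gIm (z - w) = gIm z - gIm w"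
  "gRe (- z) = - gRe z" "gIm (- z) = - gIm z"
  "gRe (z * w) = gRe z * gRe w - gIm z * gIm w"
  "gIm (z * w) = gRe z * gIm w + gIm z * gRe w"
  by (simp_all add: zero_gauss_def one_gauss_def plus_gauss_def minus_gauss_def uminus_gauss_def
      times_gauss_def)

lemma gauss_of_nat_sel [simp]: "gRe (of_nat n) = int n" "gIm (of_nat n) = 0"
  by (induction n) auto

lemma gauss_of_int_sel [simp]: "gRe (of_int k) = k" "gIm (of_int k) = 0"
  by (cases k; simp)+

lemma gauss_numeral_sel [simp]: "gRe (numeral k) = numeral k" "gIm (numeral k) = 0"
  using gauss_of_int_sel[of "numeral k"] by simp_all

definition gnorm :: "gauss \<Rightarrow> int" where "gnorm z = (gRe z)\<^sup>2 + (gIm z)\<^sup>2"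
definition gcnj :: "gauss \<Rightarrow> gauss" where "gcnj z = Gauss (gRe z) (- gIm z)"
definition gI :: gauss where "gI = Gauss 0 1"

lemma gcnj_sel [simp]: "gRe (gcnj z) = gRe z" "gIm (gcnj z) = - gIm z" by (simp_all add: gcnj_def)
lemma gI_sel [simp]: "gRe gI = 0" "gIm gI = 1" by (simp_all add: gI_def)

lemma gnorm_mult: "gnorm (z * w) = gnorm z * gnorm w"
  by (simp add: gnorm_def power2_eq_square algebra_simps)
lemma gnorm_nonneg [simp]: "0 \<le> gnorm z" by (simp add: gnorm_def)
lemma gnorm_eq_0_iff [simp]: "gnorm z = 0 \<longleftrightarrow> z = 0"
  by (auto simp: gnorm_def gauss_eq_iff sum_power2_eq_zero_iff)
lemma gnorm_pos_iff [simp]: "0 < gnorm z \<longleftrightarrow> z \<noteq> 0"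
  using gnorm_nonneg[of z] gnorm_eq_0_iff[of z] by linarith
lemma gnorm_simps [simp]: "gnorm 0 = 0" "gnorm 1 = 1" "gnorm gI = 1" "gnorm (gcnj z) = gnorm z"
  "gnorm (- z) = gnorm z" "gnorm (of_nat n) = (int n)\<^sup>2" "gnorm (of_int k) = k\<^sup>2"
  by (simp_all add: gnorm_def)
lemma gnorm_power: "gnorm (z ^ n) = gnorm z ^ n"
  by (induction n) (auto simp: gnorm_mult)

lemma gcnj_simps [simp]: "gcnj (z * w) = gcnj z * gcnj w" "gcnj (gcnj z) = z" "gcnj (z + w) = gcnj z + gcnj w"
  "gcnj 1 = 1" "gcnj 0 = 0" "gcnj (of_nat n) = of_nat n" "gcnj z = 0 \<longleftrightarrow> z = 0"
  by (auto simp: gauss_eq_iff algebra_simps)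
lemma mult_gcnj: "z * gcnj z = of_int (gnorm z)"
  by (simp add: gauss_eq_iff gnorm_def power2_eq_square algebra_simps)
lemma mult_gcnj_nat: "gnorm z = int n \<Longrightarrow> z * gcnj z = of_nat n"
  by (simp add: mult_gcnj)

instance gauss :: idom
proof
  fix a b :: gauss assume "a \<noteq> 0" "b \<noteq> 0"
  then have "gnorm (a * b) \<noteq> 0" by (simp add: gnorm_mult)
  then show "a * b \<noteq> 0" by auto
qed

lemma gnorm_eq_1_iff: "gnorm z = 1 \<longleftrightarrow> z \<in> {1, - 1, gI, - gI}"
proof
  assume z: "gnorm z = 1"
  then have "(gRe z)\<^sup>2 + (gIm z)\<^sup>2 = 1" by (simp add: gnorm_def)
  then have "(gRe z)\<^sup>2 \<le> 1\<^sup>2" "(gIm z)\<^sup>2 \<le> 1\<^sup>2"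
    using zero_le_power2[of "gRe z"] zero_le_power2[of "gIm z"] by (simp_all only: one_power2)
  then have "\<bar>gRe z\<bar> \<le> 1" "\<bar>gIm z\<bar> \<le> 1" by (simp_all add: abs_square_le_1)
  then have "gRe z \<in> {-1, 0, 1}" "gIm z \<in> {-1, 0, 1}" by auto
  then show "z \<in> {1, - 1, gI, - gI}" using z by (auto simp: gauss_eq_iff gnorm_def)
qed auto

lemma gnorm_dvd: "z dvd w \<Longrightarrow> gnorm z dvd gnorm w"
  by (auto simp: gnorm_mult elim!: dvdE)

lemma gnorm_1_dvd: "gnorm e = 1 \<Longrightarrow> e dvd z"
proof -
  assume "gnorm e = 1"
  then have "e * gcnj e = 1" by (simp add: mult_gcnj)
  then have "z = e * (gcnj e * z)" by (simp flip: mult.assoc)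
  then show "e dvd z" by (rule dvdI)
qed

lemma associated_if_gnorm_eq:
  assumes "g dvd d" "gnorm g = gnorm d" "d \<noteq> 0"
  shows "d dvd g"
proof -
  obtain h where h: "d = g * h" using assms(1) by auto
  have "gnorm h = 1" using assms(2,3) by (auto simp: h gnorm_mult)
  then have "h * gcnj h = 1" by (simp add: mult_gcnj)
  then have "g = d * gcnj h" by (simp add: h mult.assoc)
  then show ?thesis by (rule dvdI)
qed

text \<open>Rounding both coordinates of the exact quotient leaves a remainder of at most half the norm of b.\<close>

lemma gauss_division:
  assumes "b \<noteq> 0"
  obtains q where "gnorm (a - q * b) < gnorm b"
proof -
  define N where "N = gnorm b"
  have N: "0 < N" using assms by (simp add: N_def)
  \<comment> \<open>the nearest integer k to x / N\<close>
  have near: "\<exists>k. (2 * (x - k * N))\<^sup>2 \<le> N\<^sup>2" for x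
  proof -
    define k where "k = (2 * x + N) div (2 * N)"
    have "(2 * N) * k + (2 * x + N) mod (2 * N) = 2 * x + N" by (simp add: k_def)
    moreover have "0 \<le> (2 * x + N) mod (2 * N)" "(2 * x + N) mod (2 * N) < 2 * N" using N by auto
    ultimately have "\<bar>2 * (x - k * N)\<bar> \<le> \<bar>N\<bar>" by (auto simp: algebra_simps)
    then show ?thesis by (auto simp: abs_le_square_iff)
  qed
  obtain k l where kl: "(2 * (gRe (a * gcnj b) - k * N))\<^sup>2 \<le> N\<^sup>2" "(2 * (gIm (a * gcnj b) - l * N))\<^sup>2 \<le> N\<^sup>2"
    using near by meson
  define q where "q = Gauss k l"
  have "(a - q * b) * gcnj b = a * gcnj b - q * of_int N"
    by (simp add: left_diff_distrib mult.assoc mult_gcnj N_def)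
  then have "gnorm (a - q * b) * N = gnorm (a * gcnj b - q * of_int N)"
    using gnorm_mult[of "a - q * b" "gcnj b"] by (simp only: N_def gnorm_simps)
  also have "\<dots> = (gRe (a * gcnj b) - k * N)\<^sup>2 + (gIm (a * gcnj b) - l * N)\<^sup>2"
    by (simp add: gnorm_def q_def)
  finally have "4 * (gnorm (a - q * b) * N)
      = (2 * (gRe (a * gcnj b) - k * N))\<^sup>2 + (2 * (gIm (a * gcnj b) - l * N))\<^sup>2"
    by (simp only: power_mult_distrib) simp
  also have "\<dots> \<le> 2 * N\<^sup>2" using kl by simp
  also have "\<dots> < 4 * N\<^sup>2" using N by simp
  finally have "gnorm (a - q * b) * N < N * N" by (simp add: power2_eq_square)
  then have "gnorm (a - q * b) < N" using N by simp
  then show ?thesis using that N_def by blast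
qed

lemma gauss_bezout:
  obtains g x y where "g = a * x + b * y" "g dvd a" "g dvd (b :: gauss)"
proof -
  have "\<exists>g x y. g = a * x + b * y \<and> g dvd a \<and> g dvd b"
  proof (induction "nat (gnorm b)" arbitrary: a b rule: less_induct)
    case less
    show ?case
    proof (cases "b = 0")
      case True
      then show ?thesis by (intro exI[of _ a] exI[of _ 1] exI[of _ 0]) auto
    next
      case False
      obtain q where q: "gnorm (a - q * b) < gnorm b" using gauss_division[OF False] .
      then have "nat (gnorm (a - q * b)) < nat (gnorm b)" using False by simp
      from less[OF this] obtain g x y where g: "g = b * x + (a - q * b) * y" "g dvd b" "g dvd a - q * b" by blast
      have "g = a * y + b * (x - q * y)" by (simp add: g(1) algebra_simps)
      moreover have "g dvd a"
      proof -
        have "g dvd (a - q * b) + q * b" using g by (intro dvd_add dvd_mult)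
        then show ?thesis by simp
      qed
      ultimately show ?thesis using g(2) by blast
    qed
  qed
  then show ?thesis using that by blast
qed

text \<open>Prime elements; the units are excluded by their norm.\<close>

definition gprime :: "gauss \<Rightarrow> bool" where
  "gprime p \<longleftrightarrow> p \<noteq> 0 \<and> gnorm p \<noteq> 1 \<and> (\<forall>a b. p dvd a * b \<longrightarrow> p dvd a \<or> p dvd b)"

text \<open>Irreducible elements are prime, by Bezout's identity.\<close>

lemma gprimeI:
  assumes "d \<noteq> 0" "gnorm d \<noteq> 1" "\<And>g. g dvd d \<Longrightarrow> gnorm g = 1 \<or> gnorm g = gnorm d"
  shows "gprime d"
  unfolding gprime_def
proof (intro conjI allI impI assms(1,2))
  fix a b assume ab: "d dvd a * b"
  obtain g x y where g: "g = d * x + a * y" "g dvd d" "g dvd a" by (rule gauss_bezout[of d a])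
  from assms(3)[OF g(2)] show "d dvd a \<or> d dvd b"
  proof
    assume "gnorm g = gnorm d"
    then have "d dvd g" by (rule associated_if_gnorm_eq[OF g(2) _ assms(1)])
    from dvd_trans[OF this g(3)] show ?thesis by simp
  next
    assume "gnorm g = 1"
    then have "g dvd b" by (rule gnorm_1_dvd)
    moreover have "d dvd g * b"
    proof -
      have e: "g * b = d * (x * b) + (a * b) * y" unfolding g(1) by (simp add: algebra_simps)
      show ?thesis unfolding e by (intro dvd_add dvd_triv_left dvd_mult2 ab)
    qed
    moreover have "g * gcnj g = 1" using \<open>gnorm g = 1\<close> by (simp add: mult_gcnj)
    ultimately have "d dvd (g * b) * gcnj g" by (metis dvd_mult2)
    moreover have "(g * b) * gcnj g = b * (g * gcnj g)" by (simp add: mult_ac)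
    ultimately show ?thesis using \<open>g * gcnj g = 1\<close> by simp
  qed
qed

lemma gprime_if_gnorm_prime:
  assumes "gnorm d = int p" "prime p"
  shows "gprime d"
proof (rule gprimeI)
  show "d \<noteq> 0" "gnorm d \<noteq> 1" using assms prime_gt_1_nat[of p] by auto
  fix g assume "g dvd d"
  then have "gnorm g dvd int p" using gnorm_dvd assms(1) by metis
  then have "nat (gnorm g) dvd p" by (simp add: nat_dvd_iff)
  then have "nat (gnorm g) = 1 \<or> nat (gnorm g) = p" using assms(2) prime_nat_iff by blast
  then show "gnorm g = 1 \<or> gnorm g = gnorm d" using assms(1) gnorm_nonneg[of g] by linarith
qed

lemma ex_gprime_dvd:
  assumes "1 < gnorm z"
  obtains d where "gprime d" "d dvd z"
proof -
  define S where "S = {d. d dvd z \<and> 1 < gnorm d}"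
  have "z \<in> S" using assms by (simp add: S_def)
  then obtain d where d: "d \<in> S" and min: "\<And>g. g \<in> S \<Longrightarrow> nat (gnorm d) \<le> nat (gnorm g)"
    using ex_has_least_nat[of "\<lambda>d. d \<in> S" z "\<lambda>d. nat (gnorm d)"] by blast
  have d0: "d \<noteq> 0" using d by (auto simp: S_def)
  have "gprime d"
  proof (rule gprimeI)
    show "d \<noteq> 0" "gnorm d \<noteq> 1" using d by (auto simp: S_def)
    fix g assume g: "g dvd d"
    then have le: "gnorm g \<le> gnorm d" using gnorm_dvd[OF g] d0 by (intro zdvd_imp_le) auto
    have g0: "g \<noteq> 0" using g d0 by auto
    then have "1 \<le> gnorm g" using gnorm_pos_iff[of g] by linarith
    moreover have "nat (gnorm d) \<le> nat (gnorm g)" if "1 < gnorm g"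
      using that g d by (intro min) (auto simp: S_def intro: dvd_trans)
    ultimately show "gnorm g = 1 \<or> gnorm g = gnorm d" using le by fastforce
  qed
  then show ?thesis using that d by (auto simp: S_def)
qed

lemma gauss_of_nat_dvd_iff: "of_nat n dvd z \<longleftrightarrow> int n dvd gRe z \<and> int n dvd gIm z"
proof
  assume "int n dvd gRe z \<and> int n dvd gIm z"
  then obtain a b where "gRe z = int n * a" "gIm z = int n * b" by (elim conjE dvdE) blast
  then have "z = of_nat n * Gauss a b" by (simp add: gauss_eq_iff)
  then show "of_nat n dvd z" by (rule dvdI)
qed (auto elim!: dvdE)

text \<open>The greatest common divisor of p and z has norm 1, p or p^2, and the first case is impossible.\<close>

lemma prime_dvd_gnorm_cases:
  assumes "prime p" "int p dvd gnorm z"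
  shows "of_nat p dvd z \<or> (\<exists>d. gnorm d = int p \<and> d dvd z)"
proof -
  obtain g x y where g: "g = of_nat p * x + z * y" "g dvd of_nat p" "g dvd z" by (rule gauss_bezout[of "of_nat p" z])
  have p0: "of_nat p \<noteq> (0 :: gauss)" using assms(1) by (auto simp: gauss_eq_iff)
  have "gnorm g dvd int p ^ 2" using gnorm_dvd[OF g(2)] by simp
  then have "nat (gnorm g) dvd p ^ 2" by (simp add: nat_dvd_iff)
  then obtain i where i: "i \<le> 2" "nat (gnorm g) = p ^ i" using assms(1) divides_primepow_nat by blast
  then have gi: "gnorm g = int p ^ i" using gnorm_nonneg[of g] by (metis int_nat_eq of_nat_power)
  consider "i = 0" | "i = 1" | "i = 2" using i by linarith
  then show ?thesis
  proof cases
    case 1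
    then have g1: "g * gcnj g = 1" using gi by (simp add: mult_gcnj)
    have "of_nat p dvd g * gcnj z"
    proof -
      have "g * gcnj z = of_nat p * (x * gcnj z) + z * gcnj z * y" unfolding g(1) by (simp add: algebra_simps)
      moreover have "of_nat p dvd z * gcnj z"
        using assms(2) by (auto simp: mult_gcnj gauss_of_nat_dvd_iff)
      ultimately show ?thesis by simp
    qed
    then have "of_nat p dvd (g * gcnj z) * gcnj g" by (rule dvd_mult2)
    moreover have "(g * gcnj z) * gcnj g = gcnj z * (g * gcnj g)" by (simp add: mult_ac)
    ultimately have "of_nat p dvd gcnj z" using g1 by simp
    then show ?thesis by (simp add: gauss_of_nat_dvd_iff)
  next
    case 2
    then show ?thesis using gi g(3) by auto
  next
    case 3
    then have "of_nat p dvd g" using gi associated_if_gnorm_eq[OF g(2) _ p0] by simp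
    from dvd_trans[OF this g(3)] show ?thesis by simp
  qed
qed

section \<open>Gaussian integers of given norm\<close>

definition circ :: "nat \<Rightarrow> gauss set" where "circ n = {z. gnorm z = int n}"

lemma finite_circ [simp]: "finite (circ n)"
proof (rule finite_subset)
  show "circ n \<subseteq> (\<lambda>(a, b). Gauss a b) ` ({- int n..int n} \<times> {- int n..int n})"
  proof
    fix z assume "z \<in> circ n"
    then have z: "(gRe z)\<^sup>2 + (gIm z)\<^sup>2 = int n" by (simp add: circ_def gnorm_def)
    have "\<bar>x\<bar> \<le> x\<^sup>2" for x :: int using self_le_power[of "\<bar>x\<bar>" 2] by (cases "x = 0") auto
    from this[of "gRe z"] this[of "gIm z"]
    have "\<bar>gRe z\<bar> \<le> int n" "\<bar>gIm z\<bar> \<le> int n"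
      using z zero_le_power2[of "gRe z"] zero_le_power2[of "gIm z"] by linarith+
    then show "z \<in> (\<lambda>(a, b). Gauss a b) ` ({- int n..int n} \<times> {- int n..int n})"
      by (intro image_eqI[of _ _ "(gRe z, gIm z)"]) auto
  qed
qed auto

lemma circ_1: "circ 1 = {1, - 1, gI, - gI}" by (auto simp: circ_def gnorm_eq_1_iff)
lemma card_circ_1: "card (circ 1) = 4" unfolding circ_1 by (simp add: gauss_eq_iff)

lemma circ_nonzero: "0 < n \<Longrightarrow> z \<in> circ n \<Longrightarrow> z \<noteq> 0" by (auto simp: circ_def)

text \<open>Used for the ramified prime 2 and for inert primes, where the divisor d is common to all elements.\<close>

lemma circ_mult_image:
  assumes d: "d \<noteq> 0" "gnorm d = int k" and dv: "\<And>z. z \<in> circ n \<Longrightarrow> d dvd z" and n: "n = k * l"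
  shows "circ n = (*) d ` circ l"
proof -
  have k0: "0 < k" using d gnorm_pos_iff[of d] by simp
  show ?thesis
  proof (intro equalityI subsetI)
    fix z assume z: "z \<in> circ n"
    obtain w where w: "z = d * w" using dv[OF z] by auto
    then have "w \<in> circ l" using z d k0 by (auto simp: circ_def gnorm_mult n)
    then show "z \<in> (*) d ` circ l" using w by blast
  qed (use d n in \<open>auto simp: circ_def gnorm_mult\<close>)
qed

lemma inj_on_gauss_mult: "d \<noteq> (0 :: gauss) \<Longrightarrow> inj_on ((*) d) A"
  by (auto simp: inj_on_def)

lemma card_circ_mult_image: "d \<noteq> 0 \<Longrightarrow> card ((*) d ` circ l) = card (circ l)"
  by (intro card_image inj_on_gauss_mult)

lemma circ_even: "circ (2 * n) = (*) (1 + gI) ` circ n"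
proof (rule circ_mult_image)
  show "1 + gI \<noteq> 0" "gnorm (1 + gI) = int 2" by (simp_all add: gauss_eq_iff gnorm_def)
  fix z assume "z \<in> circ (2 * n)"
  then have "even ((gRe z)\<^sup>2 + (gIm z)\<^sup>2)" by (simp add: circ_def gnorm_def)
  then have "even (gRe z + gIm z)" by simp
  then obtain k where k: "gRe z + gIm z = 2 * k" by (elim evenE)
  have "z = (1 + gI) * Gauss k (k - gRe z)" using k by (simp add: gauss_eq_iff)
  then show "1 + gI dvd z" by (rule dvdI)
qed simp

lemma circ_inert:
  assumes "prime p" "\<And>z. z \<in> circ n \<Longrightarrow> of_nat p dvd z" "circ n \<noteq> {}"
  obtains l where "n = p\<^sup>2 * l" "circ n = (*) (of_nat p) ` circ l"
proof -
  have p0: "of_nat p \<noteq> (0 :: gauss)" using assms(1) by (auto simp: gauss_eq_iff)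
  obtain z where z: "z \<in> circ n" using assms(3) by auto
  have "int (p\<^sup>2) dvd int n" using gnorm_dvd[OF assms(2)[OF z]] z by (simp add: circ_def)
  then obtain l where l: "n = p\<^sup>2 * l" by (auto simp: of_nat_dvd_iff simp del: of_nat_power)
  then show ?thesis using that assms p0 by (intro that[of l] circ_mult_image) auto
qed

lemma circ_split_subset:
  assumes "prime p" "gnorm d = int p"
  shows "circ (p * n) \<subseteq> (*) d ` circ n \<union> (*) (gcnj d) ` circ n"
proof
  fix z assume z: "z \<in> circ (p * n)"
  have p0: "0 < p" using assms(1) prime_gt_0_nat by auto
  have "d dvd z * gcnj z"
  proof -
    have "z * gcnj z = d * gcnj d * of_nat n"
      using z assms(2) by (simp add: mult_gcnj circ_def)
    then show ?thesis by (simp add: mult.assoc)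
  qed
  then have "d dvd z \<or> d dvd gcnj z" using gprime_if_gnorm_prime[OF assms(2,1)] by (simp add: gprime_def)
  moreover have "d dvd gcnj z \<Longrightarrow> gcnj d dvd z" by (metis dvd_def gcnj_simps(1,2))
  moreover have "z \<in> (*) e ` circ n" if "e dvd z" "gnorm e = int p" for e
    using that z p0 by (auto simp: circ_def gnorm_mult elim!: dvdE)
  ultimately show "z \<in> (*) d ` circ n \<union> (*) (gcnj d) ` circ n" using assms(2) by auto
qed

lemma gnorm_neq_3: "gnorm d \<noteq> 3"
proof
  assume d: "gnorm d = 3"
  then have "(gRe d)\<^sup>2 + (gIm d)\<^sup>2 = 3" by (simp add: gnorm_def)
  then have "(gRe d)\<^sup>2 < 4" "(gIm d)\<^sup>2 < 4"
    using zero_le_power2[of "gRe d"] zero_le_power2[of "gIm d"] by linarith+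
  then have "\<bar>gRe d\<bar> < 2" "\<bar>gIm d\<bar> < 2"
    using abs_le_square_iff[of 2 "gRe d"] abs_le_square_iff[of 2 "gIm d"] by simp_all
  then have "gRe d \<in> {-1, 0, 1}" "gIm d \<in> {-1, 0, 1}" by auto
  then show False using d by (auto simp: gnorm_def)
qed

text \<open>Removing the primes one by one: the primes 2 and 3 and inert primes do not increase the number of
representations, and a split prime at most doubles it. There are at most k prime factors exceeding Z.\<close>

lemma card_circ_le:
  assumes "0 < n" "1 \<le> Z" "\<And>p. prime p \<Longrightarrow> p dvd n \<Longrightarrow> 5 \<le> p \<Longrightarrow> Z < p" "n < Z ^ Suc k"
  shows "card (circ n) \<le> 4 * 2 ^ k"
  using assms(1,3,4)
proof (induction n arbitrary: k rule: less_induct)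
  case (less n)
  show ?case
  proof (cases "n = 1")
    case True
    then show ?thesis using card_circ_1 by simp
  next
    case False
    then obtain p where p: "prime p" "p dvd n" using prime_factor_nat by blast
    have p1: "1 < p" using p prime_gt_1_nat by auto
    have smaller: "card (circ l) \<le> 4 * 2 ^ k" if "l dvd n" "l < n" for l
    proof (rule less.IH)
      show "0 < l" using that less.prems by (auto intro: dvd_pos_nat)
      show "Z < q" if "prime q" "q dvd l" "5 \<le> q" for q
        using that \<open>l dvd n\<close> by (intro less.prems) (auto intro: dvd_trans)
    qed (use that less.prems in auto)
    show ?thesis
    proof (cases "\<exists>d. gnorm d = int p")
      case True
      then obtain d where d: "gnorm d = int p" by auto
      then have d0: "d \<noteq> 0" "gcnj d \<noteq> 0" using p1 by auto
      obtain l where l: "n = p * l" using p by auto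
      have ln: "l dvd n" "l < n" using l less.prems p1 by auto
      consider "p = 2" | "p = 3" | "5 \<le> p"
      proof -
        have "p \<noteq> 4" using p by (auto simp: prime_nat_iff dest!: spec[of _ 2])
        then show ?thesis using that p1 by linarith
      qed
      then show ?thesis
      proof cases
        case 1
        have "card (circ n) = card (circ l)" unfolding l 1 circ_even
          by (intro card_circ_mult_image) (simp add: gauss_eq_iff)
        then show ?thesis using smaller[OF ln] by simp
      next
        case 2
        then show ?thesis using d gnorm_neq_3 by auto
      next
        case 3
        then have Z: "Z < p" using less.prems p by auto
        show ?thesis
        proof (cases k)
          case 0
          then have "n < p" using less.prems Z by simp
          then show ?thesis using p less.prems by (auto dest: dvd_imp_le)
        next
          case (Suc k')
          have "card (circ n) \<le> card (circ l) + card (circ l)"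
            unfolding l using card_mono[OF _ circ_split_subset[OF p(1) d, of l]]
              card_Un_le[of "(*) d ` circ l" "(*) (gcnj d) ` circ l"]
            by (simp add: card_circ_mult_image d0)
          moreover have "card (circ l) \<le> 4 * 2 ^ k'"
          proof (rule less.IH[OF ln(2)])
            show "0 < l" using ln less.prems by (auto intro: dvd_pos_nat)
            show "Z < q" if "prime q" "q dvd l" "5 \<le> q" for q
              using that ln by (intro less.prems) (auto intro: dvd_trans)
            have "Z * l < Z * Z ^ Suc k'"
            proof -
              have "Z * l \<le> p * l" using Z by simp
              also have "\<dots> < Z * Z ^ Suc k'" using less.prems(3) l Suc by simp
              finally show ?thesis .
            qed
            then show "l < Z ^ Suc k'" by simp
          qed
          ultimately show ?thesis by (simp add: Suc)
        qed
      qed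
    next
      case False
      then have *: "of_nat p dvd z" if "z \<in> circ n" for z
        using prime_dvd_gnorm_cases[OF p(1), of z] that p(2) by (auto simp: circ_def)
      show ?thesis
      proof (cases "circ n = {}")
        case False
        then obtain l where l: "n = p\<^sup>2 * l" "circ n = (*) (of_nat p) ` circ l"
          using circ_inert[OF p(1) *] by metis
        have "card (circ n) = card (circ l)" unfolding l(2)
          using p1 by (intro card_circ_mult_image) (simp add: gauss_eq_iff)
        moreover have "l < n"
        proof -
          have "1 < p\<^sup>2" using p1 by (rule one_less_power) simp
          moreover have "0 < l" using l less.prems by (cases l) auto
          ultimately show ?thesis using l by simp
        qed
        ultimately show ?thesis using smaller[of l] l by simp
      qed simp
    qed
  qed
qed

text \<open>For coprime m and u every element z of norm m u is the product of an element w of norm m, the greatest common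
divisor of z and m, and one of norm u, and this factorisation is unique up to the four units.\<close>

lemma sum_circ_mult:
  fixes G :: "gauss \<Rightarrow> real"
  assumes "coprime m u" "0 < m" "0 < u"
  shows "(\<Sum>w\<in>circ m. \<Sum>v\<in>circ u. G (w * v)) = 4 * (\<Sum>z\<in>circ (m * u). G z)"
proof -
  define S where "S = circ m \<times> circ u"
  let ?f = "\<lambda>(w, v). w * v"
  have img: "?f ` S = circ (m * u)"
  proof (intro equalityI subsetI)
    fix z assume z: "z \<in> circ (m * u)"
    obtain g x y where g: "g = z * x + of_nat m * y" "g dvd z" "g dvd of_nat m" by (rule gauss_bezout[of z "of_nat m"])
    \<comment> \<open>the norm of the greatest common divisor g of z and m is m: it divides m u and m^2, and g times its conjugate lies in the ideal generated by m\<close>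
    have "gnorm g dvd int m * int u" "gnorm g dvd int m * int m"
      using gnorm_dvd[OF g(2)] gnorm_dvd[OF g(3)] z by (auto simp: circ_def power2_eq_square)
    then have "gnorm g dvd gcd (int m * int u) (int m * int m)" by (rule gcd_greatest)
    moreover have "gcd (int m * int u) (int m * int m) = int m"
      using assms(1) by (simp add: gcd_mult_distrib_int[symmetric] coprime_commute)
    ultimately have 1: "gnorm g dvd int m" by simp
    have "of_nat m dvd g * gcnj g"
    proof -
      have "g * gcnj g = (z * gcnj z) * (x * gcnj x)
          + of_nat m * (z * x * gcnj y + y * gcnj z * gcnj x + of_nat m * y * gcnj y)"
        by (simp add: g(1) algebra_simps)
      moreover have "z * gcnj z = of_nat m * of_nat u" using z by (simp add: mult_gcnj circ_def)
      ultimately show ?thesis by (simp add: mult.assoc)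
    qed
    then have "int m dvd gnorm g" by (simp add: mult_gcnj gauss_of_nat_dvd_iff)
    then have gm: "gnorm g = int m" using 1 zdvd_antisym_nonneg[of "gnorm g" "int m"] by simp
    obtain v where v: "z = g * v" using g(2) by auto
    then have "int m * gnorm v = int m * int u" using z gm by (simp add: circ_def gnorm_mult)
    then have "gnorm v = int u" using assms by simp
    then show "z \<in> ?f ` S" using v gm by (intro image_eqI[of _ _ "(g, v)"]) (auto simp: S_def circ_def)
  qed (auto simp: S_def circ_def gnorm_mult)
  have fib: "card {x \<in> S. ?f x = z} = 4" if "z \<in> circ (m * u)" for z
  proof -
    from that have "z \<in> ?f ` S" by (simp only: img)
    then obtain w v where wv: "w \<in> circ m" "v \<in> circ u" "z = w * v" by (auto simp: S_def)
    have w0: "w \<noteq> 0" using wv assms circ_nonzero by blast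
    have z0: "z \<noteq> 0" using that assms circ_nonzero[of "m * u"] by auto
    have "{x \<in> S. ?f x = z} = (\<lambda>e. (w * e, v * gcnj e)) ` circ 1"
    proof (intro equalityI subsetI)
      fix x assume "x \<in> {x \<in> S. ?f x = z}"
      then obtain w' v' where x: "x = (w', v')" "w' \<in> circ m" "v' \<in> circ u" "w' * v' = z"
        by (auto simp: S_def)
      obtain \<alpha> \<beta> where ab: "\<alpha> * int m + \<beta> * int u = 1"
        using assms(1) bezout_int[of "int m" "int u"] by auto
      \<comment> \<open>w divides w' because it is coprime to v'\<close>
      have "w' = w' * of_int (\<alpha> * int m + \<beta> * int u)" by (simp only: ab) simp
      also have "\<dots> = w' * (of_int \<alpha> * (w * gcnj w) + of_int \<beta> * (v' * gcnj v'))"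
        using wv x by (simp add: mult_gcnj circ_def)
      also have "\<dots> = w * (of_int \<alpha> * w' * gcnj w) + (w' * v') * (of_int \<beta> * gcnj v')"
        by (simp add: algebra_simps)
      also have "\<dots> = w * (of_int \<alpha> * w' * gcnj w + v * (of_int \<beta> * gcnj v'))"
        unfolding x(4) wv(3) by (simp add: algebra_simps)
      finally obtain e where e: "w' = w * e" by blast
      have "int m * gnorm e = int m" using e x(2) wv(1) by (simp add: circ_def gnorm_mult)
      then have e1: "gnorm e = 1" using assms by simp
      then have ee: "e * gcnj e = 1" by (simp add: mult_gcnj)
      have "w * (e * v') = w * v" using x(4) wv(3) e by (simp add: mult.assoc)
      then have "e * v' = v" using w0 by simp
      then have "v' = v * gcnj e" using ee by (metis mult.assoc mult.commute mult.right_neutral)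
      then show "x \<in> (\<lambda>e. (w * e, v * gcnj e)) ` circ 1" using x e e1 by (auto simp: circ_def)
    next
      fix x assume "x \<in> (\<lambda>e. (w * e, v * gcnj e)) ` circ 1"
      then obtain e where e: "x = (w * e, v * gcnj e)" "gnorm e = 1" by (auto simp: circ_def)
      have "w * e * (v * gcnj e) = w * v * (e * gcnj e)" by (simp add: mult_ac)
      also have "\<dots> = z" using e(2) by (simp add: mult_gcnj wv(3))
      finally show "x \<in> {x \<in> S. ?f x = z}" using e wv by (auto simp: S_def circ_def gnorm_mult)
    qed
    moreover have "inj_on (\<lambda>e. (w * e, v * gcnj e)) (circ 1)" using w0 by (auto simp: inj_on_def)
    ultimately show ?thesis using card_circ_1 by (simp add: card_image)
  qed
  have "(\<Sum>w\<in>circ m. \<Sum>v\<in>circ u. G (w * v)) = (\<Sum>x\<in>S. G (?f x))"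
    by (simp add: S_def sum.cartesian_product case_prod_beta)
  also have "\<dots> = (\<Sum>z\<in>?f ` S. \<Sum>x | x \<in> S \<and> ?f x = z. G (?f x))"
    by (rule sum.image_gen) (simp add: S_def)
  also have "\<dots> = (\<Sum>z\<in>circ (m * u). 4 * G z)"
  proof (rule sum.cong[OF img])
    fix z assume z: "z \<in> circ (m * u)"
    have "(\<Sum>x | x \<in> S \<and> ?f x = z. G (?f x)) = (\<Sum>x | x \<in> S \<and> ?f x = z. G z)" by (rule sum.cong) auto
    also have "\<dots> = 4 * G z" using fib[OF z] by simp
    finally show "(\<Sum>x | x \<in> S \<and> ?f x = z. G (?f x)) = 4 * G z" .
  qed
  finally show ?thesis by (simp add: sum_distrib_left)
qed

section \<open>Primitive elements\<close>

definition primitive :: "gauss \<Rightarrow> bool" where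
  "primitive w \<longleftrightarrow> coprime (gRe w) (gIm w)"

lemma primitive_iff: "primitive w \<longleftrightarrow> (\<forall>p. prime p \<longrightarrow> \<not> of_nat p dvd w)"
proof
  assume w: "primitive w"
  show "\<forall>p. prime p \<longrightarrow> \<not> of_nat p dvd w"
  proof (intro allI impI notI)
    fix p :: nat assume p: "prime p" "of_nat p dvd w"
    then have "is_unit (int p)" using w coprime_common_divisor[of "gRe w" "gIm w" "int p"]
      by (simp add: primitive_def gauss_of_nat_dvd_iff)
    then show False using p by (auto simp: prime_nat_iff)
  qed
next
  assume *: "\<forall>p. prime p \<longrightarrow> \<not> of_nat p dvd w"
  show "primitive w" unfolding primitive_def
  proof (rule ccontr)
    assume "\<not> coprime (gRe w) (gIm w)"
    then have "nat (gcd (gRe w) (gIm w)) \<noteq> 1" by (auto simp: coprime_iff_gcd_eq_1)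
    then obtain p where p: "prime p" "p dvd nat (gcd (gRe w) (gIm w))" using prime_factor_nat by blast
    then have "int p dvd int (nat (gcd (gRe w) (gIm w)))" by (simp only: of_nat_dvd_iff)
    then have "int p dvd gcd (gRe w) (gIm w)" by simp
    then show False using * p(1) by (auto simp: gauss_of_nat_dvd_iff)
  qed
qed

text \<open>An odd split prime is not ramified: if d divided its conjugate, then p would divide the real part of d, and
the imaginary part squared would be p.\<close>

lemma not_dvd_gcnj:
  assumes "prime p" "gnorm d = int p" "odd p"
  shows "\<not> d dvd gcnj d"
proof
  assume "d dvd gcnj d"
  then have "d dvd d + gcnj d" by simp
  moreover have "d + gcnj d = of_int (2 * gRe d)" by (simp add: gauss_eq_iff)
  ultimately have "int p dvd (2 * gRe d)\<^sup>2" using gnorm_dvd[of d] assms(2) by (metis gnorm_simps(7))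
  then have "int p dvd 2 * gRe d" by (rule prime_dvd_power[of "int p", rotated]) (use assms in simp)
  moreover have "coprime (int p) 2" using assms(3) by (simp add: coprime_commute)
  ultimately have "int p dvd gRe d" by (simp add: coprime_dvd_mult_right_iff)
  then obtain k where k: "gRe d = int p * k" by (elim dvdE)
  have p1: "1 < int p" using assms(1) prime_gt_1_nat by fastforce
  have n: "(gRe d)\<^sup>2 + (gIm d)\<^sup>2 = int p" using assms(2) by (simp add: gnorm_def)
  have "k = 0"
  proof (rule ccontr)
    assume "k \<noteq> 0"
    then have "1 \<le> k\<^sup>2" using zero_less_power2[of k] by linarith
    then have "int p * int p * 1 \<le> int p * int p * k\<^sup>2" by (intro mult_left_mono) auto
    also have "\<dots> = (gRe d)\<^sup>2" by (simp add: k power2_eq_square)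
    also have "\<dots> \<le> int p" using n zero_le_power2[of "gIm d"] by linarith
    finally have "int p * int p \<le> int p * 1" by simp
    then show False using p1 by (simp only: mult_le_cancel_left_pos)
  qed
  then have "int p = (gIm d)\<^sup>2" using n k by simp
  then have "p = (nat \<bar>gIm d\<bar>)\<^sup>2" by (metis nat_int nat_power_eq abs_ge_zero power2_abs)
  then have "prime ((nat \<bar>gIm d\<bar>)\<^sup>2)" using assms(1) by simp
  then show False by (simp add: prime_power_iff)
qed

text \<open>If both products had a rational prime divisor, it would be p, and then w would be divisible by d and by its
conjugate, which are coprime.\<close>

lemma primitive_mult:
  assumes p: "prime p" "odd p" "gnorm d = int p" and w: "primitive w"
  shows "primitive (d * w) \<or> primitive (gcnj d * w)"
proof (rule ccontr)
  assume neg: "\<not> ?thesis"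
  have key: "of_nat p dvd e * w" if e: "gnorm e = int p" and np: "\<not> primitive (e * w)" for e
  proof -
    obtain q where q: "prime q" "of_nat q dvd e * w" using np by (auto simp: primitive_iff)
    from q(2) have "of_nat q dvd gcnj e * (e * w)" by (rule dvd_mult)
    moreover have "gcnj e * (e * w) = (e * gcnj e) * w" by (simp only: mult_ac)
    moreover have "\<dots> = of_nat p * w" using mult_gcnj_nat[OF e] by simp
    ultimately have "of_nat q dvd of_nat p * w" by simp
    then have "int q dvd int p * gRe w" "int q dvd int p * gIm w" by (simp_all add: gauss_of_nat_dvd_iff)
    then have "int q dvd int p \<or> of_nat q dvd w"
      using q(1) by (auto simp: prime_dvd_mult_iff gauss_of_nat_dvd_iff)
    then have "q dvd p" using w q(1) by (auto simp: primitive_iff)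
    then have "q = p" using p(1) q(1) primes_dvd_imp_eq by blast
    then show ?thesis using q by simp
  qed
  have d0: "d \<noteq> 0" "gcnj d \<noteq> 0" using p prime_gt_0_nat[of p] by auto
  have pe: "of_nat p = d * gcnj d" using p(3) by (simp add: mult_gcnj)
  have gp: "gprime d" "gprime (gcnj d)" using p by (auto intro: gprime_if_gnorm_prime)
  have "gcnj d dvd w" using key[OF p(3)] neg d0 unfolding pe by (simp only: dvd_mult_cancel_left) simp
  moreover have "d dvd w"
  proof -
    have "d * gcnj d dvd gcnj d * w" using key[of "gcnj d"] p(3) neg unfolding pe by simp
    then have "gcnj d * d dvd gcnj d * w" by (simp only: mult.commute[of d])
    then show ?thesis using d0 by (simp only: dvd_mult_cancel_left) simp
  qed
  then obtain x where x: "w = d * x" by (elim dvdE)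
  have "\<not> gcnj d dvd d" using not_dvd_gcnj[of p "gcnj d"] p by simp
  ultimately have "gcnj d dvd x" using gp(2) unfolding gprime_def x by blast
  then have "of_nat p dvd w" unfolding x pe by (rule mult_dvd_mono[OF dvd_refl])
  then show False using w p(1) by (auto simp: primitive_iff)
qed

lemma ex_primitive:
  assumes "odd m" "\<And>p. prime p \<Longrightarrow> p dvd m \<Longrightarrow> \<exists>d. gnorm d = int p"
  shows "\<exists>w. gnorm w = int m \<and> primitive w"
  using assms
proof (induction m rule: less_induct)
  case (less m)
  show ?case
  proof (cases "m = 1")
    case True
    then show ?thesis by (intro exI[of _ 1]) (simp add: primitive_def)
  next
    case False
    then obtain p where p: "prime p" "p dvd m" using prime_factor_nat by blast
    then obtain l where l: "m = p * l" by (elim dvdE)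
    have "0 < l" using l less.prems(1) by (cases l) auto
    then have "l < m" using l mult_strict_right_mono[of 1 p l] prime_gt_1_nat[OF p(1)] by simp
    moreover have "odd l" "odd p" using less.prems(1) l by auto
    ultimately obtain w where w: "gnorm w = int l" "primitive w"
      using less.IH[of l] less.prems(2) l by (meson dvd_mult)
    obtain d where d: "gnorm d = int p" using less.prems(2) p by blast
    have "gnorm (d * w) = int m" "gnorm (gcnj d * w) = int m" using w d l by (simp_all add: gnorm_mult)
    then show ?thesis using primitive_mult[OF p(1) \<open>odd p\<close> d w(2)] by blast
  qed
qed

text \<open>The prime 2 and the inert primes divide every element of norm m in the same way and can be split off as a
common factor c. In terms of directions, the circle of m is a rotation of the circle of m1.\<close>

lemma circ_eq_mult_primitive_circ:
  assumes "0 < m" "circ m \<noteq> {}"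
  shows "\<exists>m1 w c. odd m1 \<and> gnorm w = int m1 \<and> primitive w \<and> c \<noteq> 0 \<and> circ m = (*) c ` circ m1"
  using assms
proof (induction m rule: less_induct)
  case (less m)
  have step: ?case if "circ m = (*) e ` circ l" "l < m" "0 < l" "e \<noteq> 0" for e l
  proof -
    have "circ l \<noteq> {}" using that less.prems by auto
    from less.IH[OF that(2,3) this] obtain m1 w c where *: "odd m1" "gnorm w = int m1" "primitive w" "c \<noteq> 0" "circ l = (*) c ` circ m1"
      by blast
    then have "circ m = (*) (e * c) ` circ m1" unfolding that(1) *(5) by (auto simp: image_image mult.assoc)
    then show ?thesis using * that(4) by (intro exI[of _ m1] exI[of _ w] exI[of _ "e * c"]) auto
  qed
  show ?case
  proof (cases "even m")
    case True
    then obtain l where "m = 2 * l" by (elim evenE)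
    then show ?thesis using circ_even[of l] less.prems by (intro step[of "1 + gI" l]) (auto simp: gauss_eq_iff)
  next
    case odd: False
    show ?thesis
    proof (cases "\<exists>p. prime p \<and> p dvd m \<and> \<not> (\<exists>d. gnorm d = int p)")
      case True
      then obtain p where p: "prime p" "p dvd m" "\<And>d. gnorm d \<noteq> int p" by blast
      have dv: "of_nat p dvd z" if "z \<in> circ m" for z
        using prime_dvd_gnorm_cases[OF p(1), of z] that p(2,3) by (auto simp: circ_def)
      obtain l where l: "m = p\<^sup>2 * l" "circ m = (*) (of_nat p) ` circ l"
        by (rule circ_inert[OF p(1) dv less.prems(2)])
      have p1: "1 < p" using p prime_gt_1_nat by blast
      then have "1 < p\<^sup>2" by (rule one_less_power) simp
      moreover have "0 < l" using l less.prems by (cases l) auto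
      ultimately show ?thesis using l p1 by (intro step[of "of_nat p" l]) (auto simp: gauss_eq_iff)
    next
      case False
      then obtain w where "gnorm w = int m" "primitive w" using ex_primitive[OF odd] by blast
      then show ?thesis using odd by (intro exI[of _ m] exI[of _ w] exI[of _ 1]) auto
    qed
  qed
qed

lemma primitive_gnorm_prime_ge_5:
  assumes "primitive w" "gnorm w = int m" "odd m" "prime p" "p dvd m"
  shows "5 \<le> p"
proof -
  have "p \<noteq> 2" using assms by auto
  moreover have "p \<noteq> 4" using assms(4) by (auto simp: prime_nat_iff dest!: spec[of _ 2])
  moreover have "p \<noteq> 3"
  proof
    assume "p = 3"
    then have "of_nat 3 dvd w \<or> (\<exists>d. gnorm d = int 3 \<and> d dvd w)"
      using prime_dvd_gnorm_cases[of p w] assms by auto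
    moreover have "\<not> of_nat 3 dvd w" using assms(1,4) \<open>p = 3\<close> unfolding primitive_iff by blast
    ultimately show False using gnorm_neq_3 by auto
  qed
  ultimately show ?thesis using prime_gt_1_nat[OF assms(4)] by linarith
qed

lemma circ_prime_power_form:
  assumes "prime p" "gnorm d = int p" "z \<in> circ (p ^ e)"
  shows "\<exists>u j. gnorm u = 1 \<and> j \<le> e \<and> z = u * d ^ j * gcnj d ^ (e - j)"
  using assms(3)
proof (induction e arbitrary: z)
  case 0
  then show ?case by (intro exI[of _ z] exI[of _ 0]) (simp add: circ_def)
next
  case (Suc e)
  then have "z \<in> (*) d ` circ (p ^ e) \<union> (*) (gcnj d) ` circ (p ^ e)"
    using circ_split_subset[OF assms(1,2), of "p ^ e"] by auto
  then obtain w where w: "w \<in> circ (p ^ e)" "z = d * w \<or> z = gcnj d * w" by auto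
  obtain u j where u: "gnorm u = 1" "j \<le> e" "w = u * d ^ j * gcnj d ^ (e - j)" using Suc.IH[OF w(1)] by auto
  show ?case using w(2)
  proof
    assume "z = d * w"
    then show ?thesis using u by (intro exI[of _ u] exI[of _ "Suc j"]) (auto simp: mult_ac)
  next
    assume "z = gcnj d * w"
    then show ?thesis using u by (intro exI[of _ u] exI[of _ j]) (auto simp: mult_ac Suc_diff_le)
  qed
qed

lemma gprime_dvd_power: "gprime d \<Longrightarrow> d dvd a ^ k \<Longrightarrow> d dvd a"
proof (induction k)
  case 0
  then have "gnorm d dvd 1" using gnorm_dvd[of d 1] by simp
  then have "gnorm d = 1" using zdvd1_eq[of "gnorm d"] by simp
  then show ?case using 0 by (simp add: gprime_def)
qed (auto simp: gprime_def)

text \<open>The products of j factors d and e - j factors conj d are different for different j.\<close>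

lemma card_circ_prime_power_ge:
  assumes "prime p" "odd p" "gnorm d = int p"
  shows "e < card (circ (p ^ e))"
proof -
  let ?f = "\<lambda>j. d ^ j * gcnj d ^ (e - j)"
  have d0: "d \<noteq> 0" using assms prime_gt_0_nat[of p] by auto
  have neq: "?f j \<noteq> ?f j'" if "j < j'" "j' \<le> e" for j j'
  proof
    assume eq: "?f j = ?f j'"
    define k where "k = j' - j"
    define A where "A = e - j'"
    have k: "0 < k" "j' = j + k" "e - j = A + k" using that by (auto simp: k_def A_def)
    have "?f j = d ^ j * gcnj d ^ (A + k)" by (simp only: k(3))
    moreover have "?f j' = d ^ (j + k) * gcnj d ^ A" unfolding A_def using k(2) by simp
    ultimately have "d ^ j * gcnj d ^ (A + k) = d ^ (j + k) * gcnj d ^ A" using eq by simp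
    then have "(d ^ j * gcnj d ^ A) * gcnj d ^ k = (d ^ j * gcnj d ^ A) * d ^ k"
      by (simp only: power_add mult_ac)
    then have "gcnj d ^ k = d ^ k" using d0 by simp
    moreover have "d dvd d ^ k" using k(1) by (simp add: dvd_power)
    ultimately have "d dvd gcnj d ^ k" by simp
    then have "d dvd gcnj d" by (rule gprime_dvd_power[OF gprime_if_gnorm_prime[OF assms(3,1)]])
    then show False using not_dvd_gcnj[OF assms(1,3,2)] by simp
  qed
  have "inj_on ?f {..e}"
  proof (rule inj_onI)
    fix j j' assume "j \<in> {..e}" "j' \<in> {..e}" "?f j = ?f j'"
    then show "j = j'" using neq[of j j'] neq[of j' j] by (cases j j' rule: linorder_cases) auto
  qed
  moreover have "?f ` {..e} \<subseteq> circ (p ^ e)"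
  proof
    fix z assume "z \<in> ?f ` {..e}"
    then obtain j where j: "j \<le> e" "z = ?f j" by auto
    then have "gnorm z = int p ^ (j + (e - j))"
      using assms(3) by (simp only: gnorm_mult gnorm_power gnorm_simps power_add)
    then show "z \<in> circ (p ^ e)" using j by (simp add: circ_def)
  qed
  ultimately have "card {..e} \<le> card (circ (p ^ e))" by (intro card_inj_on_le) auto
  then show ?thesis by simp
qed

section \<open>Directions\<close>

definition emb :: "gauss \<Rightarrow> complex" where "emb z = Complex (of_int (gRe z)) (of_int (gIm z))"
definition dir :: "gauss \<Rightarrow> complex" where "dir z = sgn (emb z)"

lemma emb_simps [simp]: "emb (z * w) = emb z * emb w" "emb (gcnj z) = cnj (emb z)" "emb 1 = 1" "emb 0 = 0"
  "emb gI = \<i>" "emb (- z) = - emb z" "emb (z + w) = emb z + emb w" "emb (z - w) = emb z - emb w"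
  "emb (of_nat n) = of_nat n"
  by (simp_all add: emb_def complex_eq_iff)

lemma cmod_emb: "(cmod (emb z))\<^sup>2 = of_int (gnorm z)"
  by (simp add: emb_def cmod_power2 gnorm_def)
lemma emb_eq_0_iff [simp]: "emb z = 0 \<longleftrightarrow> z = 0"
  by (auto simp: emb_def complex_eq_iff gauss_eq_iff)

lemma dir_simps [simp]: "dir (z * w) = dir z * dir w" "dir (gcnj z) = cnj (dir z)" "dir 1 = 1" "dir gI = \<i>"
  "dir (- z) = - dir z" "dir 0 = 0"
  by (simp_all add: dir_def sgn_mult sgn_minus) (simp_all add: sgn_div_norm)
lemma dir_power: "dir (z ^ n) = dir z ^ n"
  by (induction n) auto
lemma norm_dir: "z \<noteq> 0 \<Longrightarrow> cmod (dir z) = 1"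
  by (simp add: dir_def norm_sgn)

section \<open>Angular characters and their L-series\<close>

text \<open>The angular character z |-> (z/|z|)^(4k) has the value 1 on units, so it depends only on the ideal of z.\<close>

definition hecke :: "nat \<Rightarrow> gauss \<Rightarrow> complex" where "hecke k z = dir z ^ (4 * k)"
text \<open>This is 0 for z = 0, so that series may run over all Gaussian integers.\<close>

definition norm_powr :: "real \<Rightarrow> gauss \<Rightarrow> real" where "norm_powr s z = of_int (gnorm z) powr (- s)"
definition hecke_term :: "nat \<Rightarrow> real \<Rightarrow> gauss \<Rightarrow> complex" where
  "hecke_term k s z = hecke k z * of_real (norm_powr s z)"

lemma norm_powr_mult: "norm_powr s (z * w) = norm_powr s z * norm_powr s w"
  by (simp add: norm_powr_def gnorm_mult powr_mult)
lemma hecke_mult: "hecke k (z * w) = hecke k z * hecke k w"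
  by (simp add: hecke_def power_mult_distrib)
lemma hecke_term_mult: "hecke_term k s (z * w) = hecke_term k s z * hecke_term k s w"
  by (simp add: hecke_term_def norm_powr_mult hecke_mult)
lemma norm_hecke: "z \<noteq> 0 \<Longrightarrow> cmod (hecke k z) = 1"
  by (simp add: hecke_def norm_power norm_dir)
lemma norm_powr_nonneg [simp]: "0 \<le> norm_powr s z" by (simp add: norm_powr_def)
lemma norm_powr_0 [simp]: "norm_powr s 0 = 0" by (simp add: norm_powr_def)
lemma hecke_term_0 [simp]: "hecke_term k s 0 = 0" by (simp add: hecke_term_def)
lemma norm_hecke_term: "cmod (hecke_term k s z) = norm_powr s z"
  by (cases "z = 0") (simp_all add: hecke_term_def norm_mult norm_hecke)
lemma gnorm_ge_1: "z \<noteq> 0 \<Longrightarrow> 1 \<le> gnorm z" using gnorm_pos_iff[of z] by linarith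
lemma hecke_term_unit: "gnorm u = 1 \<Longrightarrow> hecke_term k s u = 1"
proof -
  assume u: "gnorm u = 1"
  then have "dir u ^ 4 = 1" by (auto simp: gnorm_eq_1_iff)
  then show ?thesis using u by (simp add: hecke_term_def hecke_def norm_powr_def power_mult)
qed

lemma summable_on_int_powr:
  fixes s :: real
  assumes "1 < s"
  shows "(\<lambda>a :: int. (1 + \<bar>real_of_int a\<bar>) powr (- s)) summable_on UNIV"
proof -
  have "summable (\<lambda>n. real (Suc n) powr (- s))"
    using assms summable_real_powr_iff[of "- s"] by (subst summable_Suc_iff) simp
  then have nat: "(\<lambda>n. (1 + real n) powr (- s)) summable_on UNIV"
    by (intro norm_summable_imp_summable_on) (simp add: add.commute)
  have "(\<lambda>a :: int. (1 + \<bar>real_of_int a\<bar>) powr (- s)) summable_on range int"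
    using nat by (subst summable_on_reindex) (auto simp: o_def)
  moreover have "(\<lambda>a :: int. (1 + \<bar>real_of_int a\<bar>) powr (- s)) summable_on range (\<lambda>n. - int n)"
    using nat by (subst summable_on_reindex) (auto simp: o_def inj_on_def)
  ultimately have "(\<lambda>a :: int. (1 + \<bar>real_of_int a\<bar>) powr (- s)) summable_on (range int \<union> range (\<lambda>n. - int n))"
    by (rule summable_on_union)
  moreover have "range int \<union> range (\<lambda>n. - int n) = UNIV"
  proof -
    have "a \<in> range int \<union> range (\<lambda>n. - int n)" for a by (cases a rule: int_cases2) auto
    then show ?thesis by blast
  qed
  ultimately show ?thesis by simp
qed

lemma norm_powr_le_prod:
  assumes "0 \<le> s"
  shows "norm_powr s z \<le> 3 powr s * ((1 + \<bar>real_of_int (gRe z)\<bar>) powr (- s) * (1 + \<bar>real_of_int (gIm z)\<bar>) powr (- s))"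
proof (cases "z = 0")
  case False
  define a b where "a = \<bar>gRe z\<bar>" and "b = \<bar>gIm z\<bar>"
  have n: "gnorm z = a\<^sup>2 + b\<^sup>2" by (simp add: a_def b_def gnorm_def)
  have sq: "c \<le> c\<^sup>2" if "0 \<le> c" for c :: int using self_le_power[of c 2] that by (cases "c = 0") auto
  have "a \<le> a\<^sup>2" "b \<le> b\<^sup>2" by (intro sq; simp add: a_def b_def)+
  moreover have "2 * (a * b) \<le> a\<^sup>2 + b\<^sup>2" using zero_le_power2[of "a - b"] by (simp add: power2_diff)
  moreover have "1 \<le> a\<^sup>2 + b\<^sup>2" using gnorm_ge_1[OF False] n by simp
  ultimately have "(1 + a) * (1 + b) \<le> 3 * gnorm z" by (simp add: n algebra_simps)
  then have "real_of_int ((1 + a) * (1 + b)) \<le> real_of_int (3 * gnorm z)" by (simp only: of_int_le_iff)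
  then have le: "(1 + real_of_int a) * (1 + real_of_int b) \<le> 3 * real_of_int (gnorm z)" by simp
  have ab: "0 \<le> real_of_int a" "0 \<le> real_of_int b" by (simp_all add: a_def b_def)
  have "(3 * real_of_int (gnorm z)) powr (- s) \<le> ((1 + real_of_int a) * (1 + real_of_int b)) powr (- s)"
    using le ab assms by (intro powr_mono2') auto
  then have "3 powr s * (3 powr (- s) * norm_powr s z) \<le> 3 powr s * ((1 + real_of_int a) powr (- s) * (1 + real_of_int b) powr (- s))"
    using ab by (intro mult_left_mono) (simp_all add: powr_mult norm_powr_def)
  moreover have "3 powr s * (3 powr (- s) * norm_powr s z) = norm_powr s z" by (simp add: powr_minus)
  ultimately show ?thesis by (simp add: a_def b_def)
qed simp

text \<open>Away from 0 the norm is at least a third of (1 + |x|)(1 + |y|), so the double series is dominated by a product of two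
convergent ones.\<close>

lemma summable_norm_powr:
  assumes "1 < s"
  shows "norm_powr s summable_on UNIV"
proof (rule nonneg_bdd_above_summable_on)
  define c where "c a = (1 + \<bar>real_of_int a\<bar>) powr (- s)" for a
  have c: "c summable_on UNIV" unfolding c_def by (rule summable_on_int_powr[OF assms])
  show "bdd_above (sum (norm_powr s) ` {F. F \<subseteq> UNIV \<and> finite F})"
  proof (rule bdd_aboveI2)
    fix F :: "gauss set" assume "F \<in> {F. F \<subseteq> UNIV \<and> finite F}"
    then have F: "finite F" by simp
    let ?A = "gRe ` F" and ?B = "gIm ` F"
    have "sum (norm_powr s) F \<le> (\<Sum>z\<in>F. 3 powr s * (c (gRe z) * c (gIm z)))"
      unfolding c_def using assms by (intro sum_mono norm_powr_le_prod) auto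
    also have "\<dots> = 3 powr s * (\<Sum>z\<in>F. c (gRe z) * c (gIm z))" by (simp add: sum_distrib_left)
    also have "(\<Sum>z\<in>F. c (gRe z) * c (gIm z)) = (\<Sum>(a, b)\<in>(\<lambda>z. (gRe z, gIm z)) ` F. c a * c b)"
      by (subst sum.reindex) (auto simp: inj_on_def gauss_eq_iff)
    also have "\<dots> \<le> (\<Sum>(a, b)\<in>?A \<times> ?B. c a * c b)"
      using F by (intro sum_mono2) (auto simp: c_def)
    also have "\<dots> = sum c ?A * sum c ?B" by (simp add: sum_product sum.cartesian_product)
    also have "\<dots> \<le> infsum c UNIV * infsum c UNIV"
      using F c by (intro mult_mono finite_sum_le_infsum infsum_nonneg sum_nonneg) (auto simp: c_def)
    finally show "sum (norm_powr s) F \<le> 3 powr s * (infsum c UNIV * infsum c UNIV)" by simp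
  qed
qed auto

lemma abs_summable_hecke_term: "1 < s \<Longrightarrow> (\<lambda>z. norm (hecke_term k s z)) summable_on A"
  using summable_on_subset_banach[OF summable_norm_powr, of s A] by (simp add: norm_hecke_term)
lemma summable_hecke_term: "1 < s \<Longrightarrow> hecke_term k s summable_on A"
  by (rule abs_summable_summable[OF abs_summable_hecke_term])

text \<open>An element of norm 5 on which no nontrivial angular character is 1; the integers 0, ..., 4 represent its
residue classes.\<close>

definition two_plus_i :: gauss where "two_plus_i = Gauss 2 1"
lemma two_plus_i_sel [simp]: "gRe two_plus_i = 2" "gIm two_plus_i = 1" by (simp_all add: two_plus_i_def)
lemma gnorm_two_plus_i: "gnorm two_plus_i = 5" by (simp add: gnorm_def)

lemma bij_two_plus_i: "bij_betw (\<lambda>(q, r). two_plus_i * q + of_nat r) (UNIV \<times> {..<5}) UNIV"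
proof -
  define f where "f = (\<lambda>(q, r :: nat). two_plus_i * q + of_nat r)"
  define D where "D z = (gRe z - 2 * gIm z) div 5" for z
  define g where "g z = (Gauss (gIm z + 2 * D z) (- D z), nat ((gRe z - 2 * gIm z) mod 5))" for z
  have gf: "g (f (q, r)) = (q, r)" if r: "r < 5" for q and r :: nat
  proof -
    have e: "gRe (f (q, r)) - 2 * gIm (f (q, r)) = int r + 5 * (- gIm q)" by (simp add: f_def)
    have "(int r + 5 * (- gIm q)) div 5 = - gIm q" "(int r + 5 * (- gIm q)) mod 5 = int r"
      using r by (simp_all only: div_mult_self2 mod_mult_self2) simp_all
    then show ?thesis
      unfolding g_def D_def e by (simp add: gauss_eq_iff f_def)
  qed
  have fg: "f (g z) = z" for z
  proof -
    have "5 * D z + (gRe z - 2 * gIm z) mod 5 = gRe z - 2 * gIm z" "0 \<le> (gRe z - 2 * gIm z) mod 5" by (simp_all add: D_def)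
    then show ?thesis by (simp add: f_def g_def gauss_eq_iff)
  qed
  have "bij_betw f (UNIV \<times> {..<5}) UNIV"
    by (rule bij_betw_byWitness[where f' = g]) (use gf fg in \<open>auto simp: g_def nat_less_iff\<close>)
  then show ?thesis by (simp only: f_def)
qed

text \<open>The sum over all nonzero elements, which is four times the sum over ideals.\<close>

definition hecke_L :: "nat \<Rightarrow> real \<Rightarrow> complex" where "hecke_L k s = (\<Sum>\<^sub>\<infinity>z. hecke_term k s z)"
text \<open>The terms of a residue class modulo 2 + i compared with the multiples of 2 + i. These differences are so
small that their sum still converges at s = 1.\<close>

definition coset_diff :: "nat \<Rightarrow> real \<Rightarrow> gauss \<Rightarrow> complex" where
  "coset_diff k s q = (\<Sum>r<5. hecke_term k s (two_plus_i * q + of_nat r) - hecke_term k s (two_plus_i * q))"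
definition coset_diff_sum :: "nat \<Rightarrow> real \<Rightarrow> complex" where "coset_diff_sum k s = (\<Sum>\<^sub>\<infinity>q. coset_diff k s q)"

text \<open>Splitting the series into the five residue classes modulo 2 + i: the sum over each class differs from the
sum over the multiples of 2 + i by a convergent series, and the latter is the whole series times the value of
the character at 2 + i and 5^(-s).\<close>

lemma hecke_L_eq_coset_diff_sum:
  assumes "1 < s"
  shows "coset_diff k s summable_on UNIV" "hecke_L k s * (1 - 5 * hecke_term k s two_plus_i) = coset_diff_sum k s"
proof -
  have sm: "(\<lambda>(q, r). hecke_term k s (two_plus_i * q + of_nat r)) summable_on (UNIV \<times> {..<5})"
    using summable_on_reindex_bij_betw[OF bij_two_plus_i, of "hecke_term k s"] summable_hecke_term[OF assms, of k UNIV]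
    by (simp add: case_prod_unfold)
  have 1: "hecke_L k s = (\<Sum>\<^sub>\<infinity>q. \<Sum>r<5. hecke_term k s (two_plus_i * q + of_nat r))"
  proof -
    have "hecke_L k s = infsum (\<lambda>(q, r). hecke_term k s (two_plus_i * q + of_nat r)) (UNIV \<times> {..<5})"
      unfolding hecke_L_def using infsum_reindex_bij_betw[OF bij_two_plus_i, of "hecke_term k s"] by (simp add: case_prod_unfold)
    also have "\<dots> = (\<Sum>\<^sub>\<infinity>q. \<Sum>\<^sub>\<infinity>r\<in>{..<5}. hecke_term k s (two_plus_i * q + of_nat r))"
      using infsum_Sigma_banach[where f = "\<lambda>(q, r). hecke_term k s (two_plus_i * q + of_nat r)" and A = UNIV and B = "\<lambda>_. {..<5}"] sm by simp
    finally show ?thesis by simp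
  qed
  have s1: "(\<lambda>q. \<Sum>r<5. hecke_term k s (two_plus_i * q + of_nat r)) summable_on UNIV"
    using summable_on_Sigma_banach[where f = "\<lambda>q r. hecke_term k s (two_plus_i * q + of_nat r)" and A = UNIV and B = "\<lambda>_. {..<5}"] sm by simp
  have s2: "(\<lambda>q. - (5 * hecke_term k s two_plus_i) * hecke_term k s q) summable_on UNIV"
    by (intro summable_on_cmult_right summable_hecke_term assms)
  have d: "coset_diff k s q = (\<Sum>r<5. hecke_term k s (two_plus_i * q + of_nat r)) + - (5 * hecke_term k s two_plus_i) * hecke_term k s q" for q
    by (simp add: coset_diff_def sum_subtractf hecke_term_mult)
  show "coset_diff k s summable_on UNIV" using summable_on_add[OF s1 s2] by (simp only: d[symmetric])
  have "coset_diff_sum k s = hecke_L k s + - (5 * hecke_term k s two_plus_i) * hecke_L k s"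
    unfolding coset_diff_sum_def d infsum_add[OF s1 s2] 1[symmetric] by (simp only: hecke_L_def infsum_cmult_right')
  then show "hecke_L k s * (1 - 5 * hecke_term k s two_plus_i) = coset_diff_sum k s" by (simp add: algebra_simps)
qed

lemma ln_le_fourth_root: "1 \<le> (x::real) \<Longrightarrow> ln x \<le> 4 * x powr (1 / 4)"
proof -
  assume x: "1 \<le> x"
  have "ln (x powr (1 / 4)) \<le> x powr (1 / 4) - 1" using x by (intro ln_le_minus_one) auto
  moreover have "ln (x powr (1 / 4)) = ln x / 4" using x by (simp add: ln_powr)
  ultimately show ?thesis by simp
qed

lemma powr_diff_exponent:
  fixes x s t :: real
  assumes "1 \<le> x" "1 \<le> s" "1 \<le> t"
  shows "\<bar>x powr (- s) - x powr (- t)\<bar> \<le> 4 * x powr (- 3 / 4) * \<bar>s - t\<bar>"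
proof -
  have "norm (x powr (- s) - x powr (- t)) \<le> (4 * x powr (- 3 / 4)) * norm (s - t)"
  proof (rule field_differentiable_bound[where S = "{1..}" and f' = "\<lambda>u. - ln x * x powr (- u)"])
    fix u :: real assume u: "u \<in> {1..}"
    show "((\<lambda>u. x powr (- u)) has_field_derivative (- ln x * x powr (- u))) (at u within {1..})"
    proof -
      have "((\<lambda>u. exp (- u * ln x)) has_field_derivative (- ln x * exp (- u * ln x))) (at u within {1..})"
        by (auto intro!: derivative_eq_intros)
      then show ?thesis using assms(1) by (simp add: powr_def)
    qed
    have "ln x * x powr (- u) \<le> (4 * x powr (1 / 4)) * x powr (- 1)"
      using ln_le_fourth_root[OF assms(1)] assms u by (intro mult_mono powr_mono) auto
    also have "\<dots> = 4 * x powr (1 / 4 + - 1)" by (simp only: powr_add mult.assoc)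
    finally show "norm (- ln x * x powr (- u)) \<le> 4 * x powr (- 3 / 4)" using assms(1) by (simp add: abs_mult)
  qed (use assms in auto)
  then show ?thesis by simp
qed

text \<open>The mean value theorem in both variables of x^(-s). The logarithm in the mixed derivative is absorbed by a
fourth root.\<close>

lemma powr_second_diff:
  fixes x x' y s t :: real
  assumes "1 \<le> y" "y \<le> x" "y \<le> x'" "s \<in> {1..2}" "t \<in> {1..2}"
  shows "\<bar>(x powr (- s) - x powr (- t)) - (x' powr (- s) - x' powr (- t))\<bar>
      \<le> 9 * y powr (- 7 / 4) * \<bar>s - t\<bar> * \<bar>x - x'\<bar>"
proof -
  have "norm ((x powr (- s) - x powr (- t)) - (x' powr (- s) - x' powr (- t)))
      \<le> (9 * y powr (- 7 / 4) * \<bar>s - t\<bar>) * norm (x - x')"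
  proof (rule field_differentiable_bound[where S = "{y..}" and f' = "\<lambda>v. - s * v powr (- s - 1) + t * v powr (- t - 1)"])
    fix v :: real assume v: "v \<in> {y..}"
    then have v1: "1 \<le> v" using assms by auto
    show "((\<lambda>v. v powr (- s) - v powr (- t)) has_field_derivative (- s * v powr (- s - 1) + t * v powr (- t - 1)))
        (at v within {y..})"
      using v1 by (auto intro!: derivative_eq_intros)
    have "norm (s * v powr (- s - 1) - t * v powr (- t - 1)) \<le> (9 * y powr (- 7 / 4)) * norm (s - t)"
    proof (rule field_differentiable_bound[where S = "{1..2}"
          and f' = "\<lambda>u. v powr (- u - 1) * (1 - u * ln v)"])
      fix u :: real assume u: "u \<in> {1..2}"
      show "((\<lambda>u. u * v powr (- u - 1)) has_field_derivative (v powr (- u - 1) * (1 - u * ln v))) (at u within {1..2})"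
      proof -
        have "((\<lambda>u. u * exp ((- u - 1) * ln v)) has_field_derivative (exp ((- u - 1) * ln v) * (1 - u * ln v))) (at u within {1..2})"
          by (auto intro!: derivative_eq_intros simp: algebra_simps)
        then show ?thesis using v1 by (simp add: powr_def)
      qed
      have lnv: "0 \<le> ln v" "ln v \<le> 4 * v powr (1 / 4)" using v1 ln_le_fourth_root by auto
      have "\<bar>1 - u * ln v\<bar> \<le> 1 + 2 * ln v"
      proof -
        have "u * ln v \<le> 2 * ln v" "0 \<le> u * ln v" using u lnv by (auto intro!: mult_right_mono mult_nonneg_nonneg)
        then show ?thesis by linarith
      qed
      also have "\<dots> \<le> 9 * v powr (1 / 4)" using lnv ge_one_powr_ge_zero[of v "1 / 4"] v1 by linarith
      finally have "v powr (- u - 1) * \<bar>1 - u * ln v\<bar> \<le> v powr (- 2) * (9 * v powr (1 / 4))"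
        using u v1 by (intro mult_mono powr_mono) auto
      also have "\<dots> = 9 * v powr (- 2 + 1 / 4)" by (simp only: powr_add mult_ac)
      also have "\<dots> \<le> 9 * y powr (- 7 / 4)" using v assms v1 by (intro mult_left_mono) (auto intro!: powr_mono2')
      finally show "norm (v powr (- u - 1) * (1 - u * ln v)) \<le> 9 * y powr (- 7 / 4)" by (simp add: abs_mult)
    qed (use assms in auto)
    then show "norm (- s * v powr (- s - 1) + t * v powr (- t - 1)) \<le> 9 * y powr (- 7 / 4) * \<bar>s - t\<bar>"
      by (simp add: abs_minus_commute add.commute)
  qed (use assms in auto)
  then show ?thesis by simp
qed

lemma sgn_diff_le:
  fixes a b :: complex
  assumes "b \<noteq> 0"
  shows "cmod (sgn a - sgn b) \<le> 2 * cmod (a - b) / cmod b"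
proof -
  have "sgn a - sgn b = (a - b) / of_real (cmod b) + (sgn a - a / of_real (cmod b))"
    by (simp add: sgn_eq diff_divide_distrib)
  moreover have "cmod (sgn a - a / of_real (cmod b)) \<le> cmod (a - b) / cmod b"
  proof (cases "a = 0")
    case False
    have "sgn a - a / of_real (cmod b) = sgn a * of_real ((cmod b - cmod a) / cmod b)"
      using False assms by (simp add: sgn_eq field_simps)
    then have "cmod (sgn a - a / of_real (cmod b)) = \<bar>cmod b - cmod a\<bar> / cmod b"
      using False by (simp add: norm_mult norm_sgn norm_divide del: of_real_divide of_real_diff)
    also have "\<dots> \<le> cmod (a - b) / cmod b"
      using norm_triangle_ineq3[of a b] by (intro divide_right_mono) (auto simp: abs_minus_commute)
    finally show ?thesis .
  qed simp
  moreover have "cmod ((a - b) / of_real (cmod b) + (sgn a - a / of_real (cmod b)))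
      \<le> cmod ((a - b) / of_real (cmod b)) + cmod (sgn a - a / of_real (cmod b))"
    by (rule norm_triangle_ineq)
  moreover have "cmod ((a - b) / of_real (cmod b)) = cmod (a - b) / cmod b" by (simp add: norm_divide)
  ultimately show ?thesis by (simp only:)
qed

text \<open>The difference of two neighbouring terms is Lipschitz in s with a constant of order |z|^(-5/2), which is
summable over the plane. One part comes from the change of the direction, which is of order 1/|z|, and one
from the change of the absolute value.\<close>

lemma hecke_term_diff_lipschitz:
  assumes z: "z \<noteq> 0" "z + of_nat r \<noteq> 0" and r: "r < 5" and s: "s \<in> {1..2}" "t \<in> {1..2}"
  shows "cmod ((hecke_term k s (z + of_nat r) - hecke_term k s z) - (hecke_term k t (z + of_nat r) - hecke_term k t z))
    \<le> (128 * real k * 25 powr (3 / 4) + 216 * 25 powr (7 / 4)) * norm_powr (5 / 4) z * \<bar>s - t\<bar>"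
proof -
  define z' where "z' = z + of_nat r"
  define x x' where "x = real_of_int (gnorm z)" and "x' = real_of_int (gnorm z')"
  have x1: "1 \<le> x" "1 \<le> x'" using gnorm_ge_1[of z] gnorm_ge_1[of z'] z by (simp_all add: x_def x'_def z'_def)
  have mod: "(cmod (emb z))\<^sup>2 = x" "(cmod (emb z'))\<^sup>2 = x'" by (simp_all add: cmod_emb x_def x'_def)
  have mods: "cmod (emb z) = x powr (1 / 2)" "cmod (emb z') = x' powr (1 / 2)"
    unfolding mod[symmetric] by (simp_all add: powr_half_sqrt)
  have ge1: "1 \<le> cmod (emb z)" "1 \<le> cmod (emb z')"
    using x1 unfolding mods by (simp_all add: ge_one_powr_ge_zero)
  have dz: "cmod (emb z' - emb z) \<le> 4" using r by (simp add: z'_def)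
  \<comment> \<open>both are at least 1 and differ by at most 4\<close>
  have le5: "cmod (emb z) \<le> 5 * cmod (emb z')"
    using norm_triangle_sub[of "emb z" "emb z'"] dz ge1 by (simp add: norm_minus_commute)
  then have "(cmod (emb z))\<^sup>2 \<le> (5 * cmod (emb z'))\<^sup>2" by (intro power_mono) auto
  then have x25: "x / 25 \<le> x'" by (simp add: mod power_mult_distrib)
  define g where "g u = u powr (- s) - u powr (- t)" for u :: real
  have e: "(hecke_term k s z' - hecke_term k s z) - (hecke_term k t z' - hecke_term k t z)
     = (hecke k z' - hecke k z) * of_real (g x') + hecke k z * of_real (g x' - g x)"
    by (simp add: hecke_term_def norm_powr_def g_def x_def x'_def algebra_simps)
  have h: "cmod (hecke k z' - hecke k z) \<le> 32 * real k * x powr (- 1 / 2)"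
  proof -
    have "cmod (hecke k z' - hecke k z) \<le> real (4 * k) * cmod (dir z' - dir z)"
      unfolding hecke_def using z norm_dir by (intro norm_power_diff) (auto simp: z'_def)
    also have "cmod (dir z' - dir z) \<le> 2 * cmod (emb z' - emb z) / cmod (emb z)"
      unfolding dir_def using z by (intro sgn_diff_le) simp
    also have "\<dots> \<le> 2 * 4 / cmod (emb z)" using dz ge1 by (intro divide_right_mono) auto
    also have "2 * 4 / cmod (emb z) = 8 * x powr (- (1 / 2))" unfolding mods using x1 by (simp add: powr_minus field_simps)
    finally show ?thesis by (simp add: mult_left_mono)
  qed
  have g1: "\<bar>g x'\<bar> \<le> 4 * (25 powr (3 / 4) * x powr (- 3 / 4)) * \<bar>s - t\<bar>"
  proof -
    have "\<bar>g x'\<bar> \<le> 4 * x' powr (- 3 / 4) * \<bar>s - t\<bar>" unfolding g_def using s x1 by (intro powr_diff_exponent) auto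
    also have "x' powr (- 3 / 4) \<le> (x / 25) powr (- 3 / 4)" using x25 x1 by (intro powr_mono2') auto
    also have "(x / 25) powr (- 3 / 4) = 25 powr (3 / 4) * x powr (- 3 / 4)" using x1 by (simp add: powr_divide powr_minus field_simps)
    finally show ?thesis by (simp add: mult_right_mono)
  qed
  have xx: "\<bar>x' - x\<bar> \<le> 24 * x powr (1 / 2)"
  proof -
    have "x' - x = (cmod (emb z') - cmod (emb z)) * (cmod (emb z') + cmod (emb z))"
      by (simp add: mod[symmetric] power2_eq_square algebra_simps)
    then have "\<bar>x' - x\<bar> = \<bar>cmod (emb z') - cmod (emb z)\<bar> * (cmod (emb z') + cmod (emb z))" by (simp add: abs_mult)
    also have "\<dots> \<le> 4 * (6 * cmod (emb z))"
    proof (intro mult_mono)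
      show "\<bar>cmod (emb z') - cmod (emb z)\<bar> \<le> 4" using norm_triangle_ineq3[of "emb z'" "emb z"] dz by linarith
      show "cmod (emb z') + cmod (emb z) \<le> 6 * cmod (emb z)"
        using norm_triangle_sub[of "emb z'" "emb z"] dz ge1 by linarith
    qed auto
    finally show ?thesis by (simp add: mods)
  qed
  have g2: "\<bar>g x' - g x\<bar> \<le> 216 * (25 powr (7 / 4) * x powr (- 5 / 4)) * \<bar>s - t\<bar>"
  proof -
    define y where "y = max 1 (x / 25)"
    have "\<bar>g x' - g x\<bar> \<le> 9 * y powr (- 7 / 4) * \<bar>s - t\<bar> * \<bar>x' - x\<bar>"
      unfolding g_def using s x1 x25 by (intro powr_second_diff) (auto simp: y_def)
    also have "\<dots> \<le> 9 * (x / 25) powr (- 7 / 4) * \<bar>s - t\<bar> * (24 * x powr (1 / 2))"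
    proof -
      have "y powr (- 7 / 4) \<le> (x / 25) powr (- 7 / 4)" using x1 by (intro powr_mono2') (auto simp: y_def)
      then have "9 * y powr (- 7 / 4) * \<bar>s - t\<bar> \<le> 9 * (x / 25) powr (- 7 / 4) * \<bar>s - t\<bar>"
        by (intro mult_right_mono) auto
      then show ?thesis using xx by (rule mult_mono) auto
    qed
    also have "(x / 25) powr (- 7 / 4) = 25 powr (7 / 4) * x powr (- 7 / 4)" using x1 by (simp add: powr_divide powr_minus field_simps)
    also have "9 * (25 powr (7 / 4) * x powr (- 7 / 4)) * \<bar>s - t\<bar> * (24 * x powr (1 / 2))
        = 216 * (25 powr (7 / 4) * x powr (- 7 / 4 + 1 / 2)) * \<bar>s - t\<bar>" unfolding powr_add by simp
    finally show ?thesis by simp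
  qed
  have "cmod ((hecke k z' - hecke k z) * of_real (g x') + hecke k z * of_real (g x' - g x))
     \<le> cmod (hecke k z' - hecke k z) * \<bar>g x'\<bar> + \<bar>g x' - g x\<bar>"
    using norm_triangle_ineq[of "(hecke k z' - hecke k z) * of_real (g x')" "hecke k z * of_real (g x' - g x)"] norm_hecke[OF z(1)]
    by (simp add: norm_mult del: of_real_diff)
  also have "\<dots> \<le> (32 * real k * x powr (- 1 / 2)) * (4 * (25 powr (3 / 4) * x powr (- 3 / 4)) * \<bar>s - t\<bar>)
      + 216 * (25 powr (7 / 4) * x powr (- 5 / 4)) * \<bar>s - t\<bar>"
    using h g1 g2 by (intro add_mono mult_mono) auto
  also have "(32 * real k * x powr (- 1 / 2)) * (4 * (25 powr (3 / 4) * x powr (- 3 / 4)) * \<bar>s - t\<bar>)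
      = 128 * real k * 25 powr (3 / 4) * x powr (- 1 / 2 + - 3 / 4) * \<bar>s - t\<bar>" unfolding powr_add by simp
  finally show ?thesis unfolding z'_def[symmetric] e by (simp add: norm_powr_def x_def algebra_simps)
qed

lemma powr_nonpos_le_1: "1 \<le> (x::real) \<Longrightarrow> a \<le> 0 \<Longrightarrow> x powr a \<le> 1"
  using powr_mono[of a 0 x] by simp

text \<open>A Lipschitz constant, with respect to s, of the q-th coset difference; the term for q = 0 is exceptional.\<close>

definition lip_bound :: "nat \<Rightarrow> gauss \<Rightarrow> real" where
  "lip_bound k q = 20 * of_bool (q = 0) + 5 * (128 * real k * 25 powr (3 / 4) + 216 * 25 powr (7 / 4)) * norm_powr (5 / 4) q"

lemma lip_bound_nonneg: "0 \<le> lip_bound k q" by (simp add: lip_bound_def)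

lemma summable_lip_bound: "lip_bound k summable_on UNIV"
proof -
  have "(\<lambda>q :: gauss. 20 * of_bool (q = 0) :: real) summable_on UNIV"
    using summable_on_cong_neutral[of UNIV "{0}" "\<lambda>q :: gauss. 20 * of_bool (q = 0) :: real" "\<lambda>q. 20 * of_bool (q = 0)"]
    by (auto intro: summable_on_finite)
  then show ?thesis unfolding lip_bound_def[abs_def]
    by (rule summable_on_add) (intro summable_on_cmult_right summable_norm_powr, simp)
qed

lemma coset_diff_lipschitz:
  assumes s: "s \<in> {1..2}" "t \<in> {1..2}"
  shows "cmod (coset_diff k s q - coset_diff k t q) \<le> lip_bound k q * \<bar>s - t\<bar>"
proof (cases "q = 0")
  case True
  have "cmod (hecke_term k s z - hecke_term k t z) \<le> 4 * \<bar>s - t\<bar>" for z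
  proof (cases "z = 0")
    case False
    define x where "x = real_of_int (gnorm z)"
    have x: "1 \<le> x" using gnorm_ge_1[OF False] by (simp add: x_def)
    have "hecke_term k s z - hecke_term k t z = hecke k z * of_real (x powr (- s) - x powr (- t))"
      by (simp add: hecke_term_def norm_powr_def x_def algebra_simps)
    then have "cmod (hecke_term k s z - hecke_term k t z) = \<bar>x powr (- s) - x powr (- t)\<bar>"
      by (simp only: norm_mult norm_hecke[OF False] norm_of_real) simp
    also have "\<dots> \<le> 4 * x powr (- 3 / 4) * \<bar>s - t\<bar>" using s x by (intro powr_diff_exponent) auto
    also have "\<dots> \<le> 4 * 1 * \<bar>s - t\<bar>" using x by (intro mult_right_mono mult_left_mono) (auto intro!: powr_nonpos_le_1)
    finally show ?thesis by simp
  qed simp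
  then have "cmod (\<Sum>r<5. hecke_term k s (of_nat r) - hecke_term k t (of_nat r)) \<le> (\<Sum>r<(5::nat). 4 * \<bar>s - t\<bar>)"
    by (intro order.trans[OF norm_sum] sum_mono)
  then show ?thesis using True by (simp add: coset_diff_def lip_bound_def sum_subtractf)
next
  case False
  define c where "c = 128 * real k * 25 powr (3 / 4) + 216 * 25 powr (7 / 4)"
  have c0: "0 \<le> c" by (simp add: c_def)
  have kq: "two_plus_i * q \<noteq> 0" using False gnorm_two_plus_i by (auto simp: gauss_eq_iff)
  have ne: "two_plus_i * q + of_nat r \<noteq> 0" if "r < 5" for r
  proof
    assume *: "two_plus_i * q + of_nat r = 0"
    then have "two_plus_i * q = - of_nat r" by (simp add: eq_neg_iff_add_eq_0)
    then have "gnorm (two_plus_i * q) = gnorm (- of_nat r :: gauss)" by (simp only:)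
    then have "5 * gnorm q = (int r)\<^sup>2" by (simp only: gnorm_mult gnorm_two_plus_i gnorm_simps)
    then have "5 dvd (int r)\<^sup>2" by (metis dvd_triv_left)
    then have "r = 0" using that by (auto simp: less_Suc_eq numeral_eq_Suc)
    then show False using * kq by simp
  qed
  have gp: "norm_powr (5 / 4) (two_plus_i * q) \<le> norm_powr (5 / 4) q"
  proof -
    have "norm_powr (5 / 4) two_plus_i \<le> 1" by (simp add: norm_powr_def gnorm_two_plus_i powr_nonpos_le_1)
    then show ?thesis using mult_right_mono[of "norm_powr (5 / 4) two_plus_i" 1 "norm_powr (5 / 4) q"] by (simp add: norm_powr_mult)
  qed
  have "coset_diff k s q - coset_diff k t q = (\<Sum>r<5. (hecke_term k s (two_plus_i * q + of_nat r) - hecke_term k s (two_plus_i * q))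
      - (hecke_term k t (two_plus_i * q + of_nat r) - hecke_term k t (two_plus_i * q)))"
    by (simp only: coset_diff_def sum_subtractf)
  also have "cmod \<dots> \<le> (\<Sum>r<(5::nat). c * norm_powr (5 / 4) (two_plus_i * q) * \<bar>s - t\<bar>)"
    unfolding c_def using kq ne s by (intro order.trans[OF norm_sum] sum_mono hecke_term_diff_lipschitz) auto
  also have "\<dots> = 5 * c * norm_powr (5 / 4) (two_plus_i * q) * \<bar>s - t\<bar>" by simp
  also have "\<dots> \<le> 5 * c * norm_powr (5 / 4) q * \<bar>s - t\<bar>" using gp c0 by (intro mult_right_mono mult_left_mono) auto
  also have "\<dots> = lip_bound k q * \<bar>s - t\<bar>" using False by (simp add: lip_bound_def c_def)
  finally show ?thesis .
qed

lemma summable_coset_diff: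
  assumes "s \<in> {1..2}"
  shows "(\<lambda>q. norm (coset_diff k s q)) summable_on UNIV"
proof -
  have "(\<lambda>q. norm (coset_diff k 2 q)) summable_on UNIV"
    using hecke_L_eq_coset_diff_sum(1)[of 2 k] by (simp add: summable_on_iff_abs_summable_on_complex)
  then have "(\<lambda>q. norm (coset_diff k 2 q) + lip_bound k q) summable_on UNIV" by (intro summable_on_add summable_lip_bound)
  then show ?thesis
  proof (rule summable_on_comparison_test)
    fix q
    have "lip_bound k q * \<bar>s - 2\<bar> \<le> lip_bound k q * 1" using assms lip_bound_nonneg by (intro mult_left_mono) auto
    then show "norm (coset_diff k s q) \<le> norm (coset_diff k 2 q) + lip_bound k q"
      using coset_diff_lipschitz[OF assms, of 2 k q] norm_triangle_sub[of "coset_diff k s q" "coset_diff k 2 q"] by simp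
  qed simp_all
qed

lemma coset_diff_sum_lipschitz:
  assumes "s \<in> {1..2}" "t \<in> {1..2}"
  shows "cmod (coset_diff_sum k s - coset_diff_sum k t) \<le> infsum (lip_bound k) UNIV * \<bar>s - t\<bar>"
proof -
  have sm: "coset_diff k u summable_on UNIV" if "u \<in> {1..2}" for u
    using summable_coset_diff[OF that] by (rule abs_summable_summable)
  have "cmod (coset_diff_sum k s - coset_diff_sum k t) \<le> (\<Sum>\<^sub>\<infinity>q. lip_bound k q * \<bar>s - t\<bar>)"
  proof (rule norm_infsum_le)
    show "((\<lambda>q. coset_diff k s q - coset_diff k t q) has_sum (coset_diff_sum k s - coset_diff_sum k t)) UNIV"
    proof -
      have "((\<lambda>q. coset_diff k s q + - coset_diff k t q) has_sum (coset_diff_sum k s + - coset_diff_sum k t)) UNIV"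
        unfolding coset_diff_sum_def using has_sum_infsum[OF sm[OF assms(1)]] has_sum_infsum[OF sm[OF assms(2)]]
        by (intro has_sum_add) (simp_all add: has_sum_uminus)
      then show ?thesis by simp
    qed
    show "((\<lambda>q. lip_bound k q * \<bar>s - t\<bar>) has_sum (\<Sum>\<^sub>\<infinity>q. lip_bound k q * \<bar>s - t\<bar>)) UNIV"
      by (intro has_sum_infsum summable_on_cmult_left summable_lip_bound)
  qed (use assms coset_diff_lipschitz in auto)
  then show ?thesis by (simp add: infsum_cmult_left')
qed

lemma five_hecke_term_two_plus_i: "5 * hecke_term k s two_plus_i = hecke k two_plus_i * of_real (5 powr (1 - s))"
proof -
  have "5 powr (1 - s) = 5 * 5 powr (- s)" by (simp add: powr_diff powr_minus field_simps)
  then show ?thesis by (simp add: hecke_term_def norm_powr_def gnorm_two_plus_i)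
qed

lemma coset_diff_sum_bounded: "\<exists>B>0. \<forall>s\<in>{1..2}. cmod (coset_diff_sum k s) \<le> B"
proof (intro exI[of _ "cmod (coset_diff_sum k 2) + infsum (lip_bound k) UNIV + 1"] conjI ballI)
  have L: "0 \<le> infsum (lip_bound k) UNIV" by (intro infsum_nonneg lip_bound_nonneg)
  then show "0 < cmod (coset_diff_sum k 2) + infsum (lip_bound k) UNIV + 1" by (simp add: add_nonneg_pos)
  fix s :: real assume s: "s \<in> {1..2}"
  have "infsum (lip_bound k) UNIV * \<bar>s - 2\<bar> \<le> infsum (lip_bound k) UNIV * 1" using L s by (intro mult_left_mono) auto
  then show "cmod (coset_diff_sum k s) \<le> cmod (coset_diff_sum k 2) + infsum (lip_bound k) UNIV + 1"
    using coset_diff_sum_lipschitz[OF s, of 2 k] norm_triangle_sub[of "coset_diff_sum k s" "coset_diff_sum k 2"] by simp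
qed

text \<open>For the trivial character the factor 1 - 5^(1-s) has a simple zero at s = 1.\<close>

lemma hecke_L_0_upper: "\<exists>C>0. \<forall>s. 1 < s \<longrightarrow> s \<le> 2 \<longrightarrow> cmod (hecke_L 0 s) \<le> C / (s - 1)"
proof -
  obtain B where B: "0 < B" "\<And>s. s \<in> {1..2} \<Longrightarrow> cmod (coset_diff_sum 0 s) \<le> B" using coset_diff_sum_bounded by blast
  show ?thesis
  proof (intro exI[of _ "2 * B"] conjI allI impI)
    fix s :: real assume s: "1 < s" "s \<le> 2"
    have "5 powr (1 - s) = exp (- ((s - 1) * ln 5))" by (simp add: powr_def algebra_simps)
    also have "\<dots> \<le> exp (- (s - 1))"
    proof -
      have "1 \<le> ln (5::real)" using exp_le by (subst ln_ge_iff) auto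
      then have "(s - 1) * 1 \<le> (s - 1) * ln 5" using s by (intro mult_left_mono) auto
      then show ?thesis by (simp only: exp_le_cancel_iff neg_le_iff_le mult_1_right)
    qed
    also have "\<dots> = 1 / exp (s - 1)" by (simp only: exp_minus inverse_eq_divide)
    also have "\<dots> \<le> 1 / s" using exp_ge_add_one_self[of "s - 1"] s by (intro divide_left_mono) auto
    also have "\<dots> \<le> 1 - (s - 1) / 2"
    proof -
      have "0 \<le> (s - 1) * (2 - s)" using s by simp
      then show ?thesis using s by (simp add: field_simps)
    qed
    finally have low: "(s - 1) / 2 \<le> 1 - 5 powr (1 - s)" by linarith
    have "5 * hecke_term 0 s two_plus_i = of_real (5 powr (1 - s))" using five_hecke_term_two_plus_i[of 0 s] by (simp add: hecke_def)
    then have "hecke_L 0 s * of_real (1 - 5 powr (1 - s)) = coset_diff_sum 0 s" using hecke_L_eq_coset_diff_sum(2)[OF s(1), of 0] by simp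
    then have "cmod (hecke_L 0 s) * \<bar>1 - 5 powr (1 - s)\<bar> = cmod (coset_diff_sum 0 s)" by (metis norm_mult norm_of_real)
    then have "cmod (hecke_L 0 s) * \<bar>1 - 5 powr (1 - s)\<bar> \<le> B" using B s by simp
    moreover have "cmod (hecke_L 0 s) * ((s - 1) / 2) \<le> cmod (hecke_L 0 s) * \<bar>1 - 5 powr (1 - s)\<bar>"
      by (rule mult_left_mono[OF order.trans[OF low abs_ge_self]]) simp
    ultimately have "cmod (hecke_L 0 s) * ((s - 1) / 2) \<le> B" by linarith
    then show "cmod (hecke_L 0 s) \<le> 2 * B / (s - 1)" using s by (simp add: field_simps)
  qed (use B in simp)
qed

lemma hecke_two_plus_i_neq_1:
  assumes "0 < k"
  shows "hecke k two_plus_i \<noteq> 1"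
proof
  assume h: "hecke k two_plus_i = 1"
  have res: "5 dvd gRe (two_plus_i ^ Suc n) - 2 * gIm (two_plus_i ^ Suc n) \<and> \<not> 5 dvd gIm (two_plus_i ^ Suc n)" for n
  proof (induction n)
    case (Suc n)
    define a b where "a = gRe (two_plus_i ^ Suc n)" and "b = gIm (two_plus_i ^ Suc n)"
    have "5 dvd a - 2 * b" "\<not> 5 dvd b" using Suc by (simp_all add: a_def b_def)
    moreover have "gRe (two_plus_i ^ Suc (Suc n)) = 2 * a - b" "gIm (two_plus_i ^ Suc (Suc n)) = a + 2 * b"
      unfolding power_Suc[of two_plus_i "Suc n"] a_def b_def by simp_all
    ultimately show ?case by presburger
  qed simp
  define w where "w = emb two_plus_i"
  have "w \<noteq> 0" unfolding w_def using gnorm_two_plus_i by (auto simp: gauss_eq_iff)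
  then have "w = sgn w * of_real (cmod w)" by (simp add: sgn_eq)
  then have "w ^ (4 * k) = sgn w ^ (4 * k) * of_real (cmod w) ^ (4 * k)" by (metis power_mult_distrib)
  also have "sgn w ^ (4 * k) = 1" using h by (simp add: hecke_def dir_def w_def)
  finally have "w ^ (4 * k) = of_real (cmod w ^ (4 * k))" by simp
  then have "Im (w ^ (4 * k)) = 0" by (simp only: Im_complex_of_real)
  moreover have "w ^ n = emb (two_plus_i ^ n)" for n by (induction n) (auto simp: w_def)
  ultimately have "gIm (two_plus_i ^ (4 * k)) = 0" by (simp add: emb_def)
  moreover obtain n where "4 * k = Suc n" using assms by (cases "4 * k") auto
  ultimately show False using res[of n] by simp
qed

lemma euler_factor_lower:
  assumes "0 < k" "1 \<le> s"
  shows "cmod (1 - hecke k two_plus_i) / 2 \<le> cmod (1 - 5 * hecke_term k s two_plus_i)"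
proof -
  define t where "t = 5 powr (1 - s)"
  have t: "0 < t" "t \<le> 1" using assms powr_nonpos_le_1[of 5 "1 - s"] by (auto simp: t_def)
  have h: "cmod (hecke k two_plus_i) = 1" by (intro norm_hecke) (simp add: gauss_eq_iff)
  have e: "5 * hecke_term k s two_plus_i = hecke k two_plus_i * of_real t" by (simp add: five_hecke_term_two_plus_i t_def)
  have "1 - hecke k two_plus_i = (1 - hecke k two_plus_i * of_real t) - hecke k two_plus_i * of_real (1 - t)" by (simp add: algebra_simps)
  then have "cmod (1 - hecke k two_plus_i) \<le> cmod (1 - hecke k two_plus_i * of_real t) + cmod (hecke k two_plus_i * of_real (1 - t))"
    by (metis norm_triangle_ineq4)
  also have "cmod (hecke k two_plus_i * of_real (1 - t)) = 1 - t" using t by (simp add: norm_mult h del: of_real_diff)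
  also have "1 - t \<le> cmod (1 - hecke k two_plus_i * of_real t)"
    using norm_triangle_ineq2[of 1 "hecke k two_plus_i * of_real t"] t by (simp add: norm_mult h)
  finally show ?thesis by (simp add: e)
qed

lemma euler_factor_upper:
  assumes "1 \<le> s"
  shows "cmod (1 - 5 * hecke_term k s two_plus_i) \<le> 2"
proof -
  have "cmod (5 * hecke_term k s two_plus_i) \<le> 1"
    using assms norm_hecke[of two_plus_i k] powr_nonpos_le_1[of 5 "1 - s"] by (simp add: five_hecke_term_two_plus_i norm_mult gauss_eq_iff)
  then show ?thesis using norm_triangle_ineq4[of 1 "5 * hecke_term k s two_plus_i"] by simp
qed

lemma hecke_L_upper:
  assumes "0 < k"
  shows "\<exists>C>0. \<forall>s. 1 < s \<longrightarrow> s \<le> 2 \<longrightarrow> cmod (hecke_L k s) \<le> C"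
proof -
  obtain B where B: "0 < B" "\<And>s. s \<in> {1..2} \<Longrightarrow> cmod (coset_diff_sum k s) \<le> B" using coset_diff_sum_bounded by blast
  define d where "d = cmod (1 - hecke k two_plus_i) / 2"
  have d: "0 < d" using hecke_two_plus_i_neq_1[OF assms] by (simp add: d_def)
  show ?thesis
  proof (intro exI[of _ "B / d"] conjI allI impI)
    fix s :: real assume s: "1 < s" "s \<le> 2"
    have "cmod (hecke_L k s) * d \<le> cmod (hecke_L k s) * cmod (1 - 5 * hecke_term k s two_plus_i)"
      using euler_factor_lower[OF assms, of s] s by (intro mult_left_mono) (auto simp: d_def)
    also have "\<dots> = cmod (coset_diff_sum k s)" using hecke_L_eq_coset_diff_sum(2)[OF s(1), of k] by (metis norm_mult)
    also have "\<dots> \<le> B" using B s by simp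
    finally show "cmod (hecke_L k s) \<le> B / d" using d by (simp add: field_simps)
  qed (use B d in simp)
qed

section \<open>Euler products\<close>

text \<open>One representative from each class of associated primes.\<close>

definition quadrant_primes :: "gauss set" where "quadrant_primes = {p. gprime p \<and> 0 < gRe p \<and> 0 \<le> gIm p}"

lemma ex_associate_quadrant:
  assumes "z \<noteq> 0"
  obtains u where "gnorm u = 1" "0 < gRe (u * z)" "0 \<le> gIm (u * z)"
proof -
  consider "0 < gRe z \<and> 0 \<le> gIm z" | "gRe z \<le> 0 \<and> 0 < gIm z" | "gRe z < 0 \<and> gIm z \<le> 0" | "0 \<le> gRe z \<and> gIm z < 0"
    using assms by (fastforce simp: gauss_eq_iff)
  then show ?thesis
  proof cases
    case 1 then show ?thesis by (intro that[of 1]) auto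
  next
    case 2 then show ?thesis by (intro that[of "- gI"]) auto
  next
    case 3 then show ?thesis by (intro that[of "- 1"]) auto
  next
    case 4 then show ?thesis by (intro that[of gI]) auto
  qed
qed

lemma quadrant_primes_dvd_imp_eq:
  assumes "p \<in> quadrant_primes" "q \<in> quadrant_primes" "p dvd q"
  shows "p = q"
proof -
  obtain h where h: "q = p * h" using assms(3) by (elim dvdE)
  have nz: "p \<noteq> 0" "q \<noteq> 0" using assms by (auto simp: quadrant_primes_def gprime_def)
  have "q dvd p * h" using h by simp
  then have "q dvd p \<or> q dvd h" using assms(2) by (simp add: quadrant_primes_def gprime_def)
  moreover have "\<not> q dvd h"
  proof
    assume "q dvd h"
    then obtain l where l: "h = q * l" by (elim dvdE)
    have "q * 1 = p * h" using h by simp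
    also have "\<dots> = q * (p * l)" by (simp only: l mult_ac)
    finally have "q * 1 = q * (p * l)" .
    then have "1 = p * l" by (rule mult_left_cancel[OF nz(2), THEN iffD1])
    then have "p * l = 1" by simp
    then have "gnorm p * gnorm l = 1" by (metis gnorm_mult gnorm_simps(2))
    then have "gnorm p = 1" using pos_zmult_eq_1_iff[of "gnorm p" "gnorm l"] nz by simp
    then show False using assms(1) by (simp add: quadrant_primes_def gprime_def)
  qed
  ultimately have "gnorm q dvd gnorm p" using gnorm_dvd by blast
  moreover have "gnorm p dvd gnorm q" using gnorm_dvd[OF assms(3)] .
  ultimately have "gnorm p = gnorm q" using zdvd_antisym_nonneg by simp
  then have "gnorm h = 1" using nz by (simp add: h gnorm_mult)
  then show ?thesis using assms h by (auto simp: gnorm_eq_1_iff quadrant_primes_def)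
qed

lemma ex_quadrant_primes_dvd:
  assumes "1 < gnorm z"
  obtains p where "p \<in> quadrant_primes" "p dvd z"
proof -
  obtain d where d: "gprime d" "d dvd z" by (rule ex_gprime_dvd[OF assms])
  then have "d \<noteq> 0" by (simp add: gprime_def)
  then obtain u where u: "gnorm u = 1" "0 < gRe (u * d)" "0 \<le> gIm (u * d)" by (rule ex_associate_quadrant)
  have uu: "u * gcnj u = 1" using u by (simp add: mult_gcnj)
  have dvd_iff: "u * d dvd x \<longleftrightarrow> d dvd x" for x
  proof
    assume "d dvd x"
    then obtain y where "x = d * y" by (elim dvdE)
    then have "x = (u * d) * (gcnj u * y)" using uu by (simp add: mult_ac)
    then show "u * d dvd x" by (rule dvdI)
  qed (rule dvd_mult_right)
  have "gprime (u * d)" using d(1) u(1) unfolding gprime_def dvd_iff by (auto simp: gnorm_mult)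
  then have "u * d \<in> quadrant_primes" using u by (simp add: quadrant_primes_def)
  then show ?thesis using that d(2) dvd_iff by blast
qed

text \<open>The series over the elements that are coprime to Q. Removing the primes one by one turns the L-series into
the constant 4, the contribution of the units; this is the Euler product.\<close>

definition sifted_L :: "nat \<Rightarrow> real \<Rightarrow> gauss set \<Rightarrow> complex" where
  "sifted_L k s Q = (\<Sum>\<^sub>\<infinity>z\<in>{z. \<forall>p\<in>Q. \<not> p dvd z}. hecke_term k s z)"

lemma sifted_L_insert:
  assumes "1 < s" "p \<in> quadrant_primes" "Q \<subseteq> quadrant_primes" "p \<notin> Q"
  shows "sifted_L k s (insert p Q) = (1 - hecke_term k s p) * sifted_L k s Q"
proof -
  let ?B = "{z. \<forall>q\<in>Q. \<not> q dvd z}" and ?A = "{z. \<forall>q\<in>insert p Q. \<not> q dvd z}"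
  have p0: "p \<noteq> 0" using assms(2) by (auto simp: quadrant_primes_def)
  have split: "?B = ?A \<union> (*) p ` ?B"
  proof (intro equalityI subsetI)
    fix z assume z: "z \<in> ?B"
    show "z \<in> ?A \<union> (*) p ` ?B"
    proof (cases "p dvd z")
      case True
      then obtain w where w: "z = p * w" by (elim dvdE)
      then have "w \<in> ?B" using z by (auto dest: dvd_mult)
      then show ?thesis using w by blast
    qed (use z in auto)
  next
    fix z assume "z \<in> ?A \<union> (*) p ` ?B"
    then show "z \<in> ?B"
    proof
      assume "z \<in> (*) p ` ?B"
      then obtain w where w: "z = p * w" "\<forall>q\<in>Q. \<not> q dvd w" by auto
      have "\<not> q dvd z" if q: "q \<in> Q" for q
      proof
        assume "q dvd z"
        then have "q dvd p \<or> q dvd w" using q assms(3) unfolding w(1) by (auto simp: quadrant_primes_def gprime_def)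
        then have "q = p" using w(2) q assms quadrant_primes_dvd_imp_eq[of q p] by auto
        then show False using q assms(4) by simp
      qed
      then show ?thesis by simp
    qed simp
  qed
  have disj: "?A \<inter> (*) p ` ?B = {}" by auto
  have "sifted_L k s Q = infsum (hecke_term k s) (?A \<union> (*) p ` ?B)" unfolding sifted_L_def using split by simp
  also have "\<dots> = infsum (hecke_term k s) ?A + infsum (hecke_term k s) ((*) p ` ?B)"
    using disj by (intro infsum_Un_disjoint summable_hecke_term assms(1))
  also have "infsum (hecke_term k s) ((*) p ` ?B) = infsum (\<lambda>z. hecke_term k s p * hecke_term k s z) ?B"
    using p0 by (subst infsum_reindex) (auto simp: inj_on_def o_def hecke_term_mult)
  also have "\<dots> = hecke_term k s p * sifted_L k s Q" by (simp only: infsum_cmult_right' sifted_L_def)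
  finally have "sifted_L k s Q = sifted_L k s (insert p Q) + hecke_term k s p * sifted_L k s Q" by (simp only: sifted_L_def)
  from this[symmetric] show ?thesis by (simp only: left_diff_distrib mult_1_left eq_diff_eq)
qed

lemma sifted_L_prod:
  assumes "1 < s" "finite Q" "Q \<subseteq> quadrant_primes"
  shows "sifted_L k s Q = hecke_L k s * (\<Prod>p\<in>Q. 1 - hecke_term k s p)"
  using assms(2,3)
proof (induction Q rule: finite_induct)
  case empty
  then show ?case by (simp add: sifted_L_def hecke_L_def)
next
  case (insert p Q)
  then show ?case using sifted_L_insert[OF assms(1), of p Q k] by simp
qed

definition quadrant_primes_upto :: "nat \<Rightarrow> gauss set" where "quadrant_primes_upto X = {p \<in> quadrant_primes. gnorm p \<le> int X}"

lemma finite_quadrant_primes_upto [simp]: "finite (quadrant_primes_upto X)"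
proof (rule finite_subset)
  show "quadrant_primes_upto X \<subseteq> (\<Union>n\<le>X. circ n)"
  proof
    fix p assume "p \<in> quadrant_primes_upto X"
    then have "p \<in> circ (nat (gnorm p))" "nat (gnorm p) \<le> X" by (auto simp: quadrant_primes_upto_def circ_def)
    then show "p \<in> (\<Union>n\<le>X. circ n)" by blast
  qed
qed simp

lemma quadrant_primes_upto_subset: "quadrant_primes_upto X \<subseteq> quadrant_primes" by (auto simp: quadrant_primes_upto_def)

text \<open>An element that is neither 0 nor a unit and has no prime divisor of norm at most X has itself norm greater
than X, so it lies in the tail of an absolutely convergent series.\<close>

lemma sifted_L_limit:
  assumes "1 < s"
  shows "(\<lambda>X. sifted_L k s (quadrant_primes_upto X)) \<longlonglongrightarrow> 4"
proof (rule LIMSEQ_I)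
  fix e :: real assume "0 < e"
  then have e: "0 < e / 2" by simp
  obtain F where F: "finite F" "F \<subseteq> UNIV" "dist (sum (norm_powr s) F) (infsum (norm_powr s) UNIV) \<le> e / 2"
    using infsum_finite_approximation[OF summable_norm_powr[OF assms] e] by blast
  obtain X0 where X0: "\<And>z. z \<in> F \<Longrightarrow> nat (gnorm z) \<le> X0"
    using finite_nat_set_iff_bounded_le[of "(\<lambda>z. nat (gnorm z)) ` F"] F(1) by auto
  have "norm (sifted_L k s (quadrant_primes_upto X) - 4) < e" if X: "X0 \<le> X" for X
  proof -
    let ?S = "{z. \<forall>p\<in>quadrant_primes_upto X. \<not> p dvd z}"
    have U: "circ 1 \<subseteq> ?S"
    proof
      fix u assume u: "u \<in> circ 1"
      have "\<not> p dvd u" if p: "p \<in> quadrant_primes_upto X" for p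
      proof
        assume "p dvd u"
        then have "gnorm p dvd 1" using gnorm_dvd[of p u] u by (simp add: circ_def)
        then show False using p by (auto simp: quadrant_primes_upto_def quadrant_primes_def gprime_def zdvd1_eq)
      qed
      then show "u \<in> ?S" by simp
    qed
    have big: "z = 0 \<or> int X < gnorm z" if z: "z \<in> ?S - circ 1" for z
    proof (rule ccontr)
      assume "\<not> (z = 0 \<or> int X < gnorm z)"
      then have z0: "z \<noteq> 0" "gnorm z \<le> int X" by auto
      then have "1 < gnorm z" using z gnorm_ge_1[of z] by (auto simp: circ_def)
      then obtain p where p: "p \<in> quadrant_primes" "p dvd z" by (rule ex_quadrant_primes_dvd)
      then have "gnorm p \<le> gnorm z" using gnorm_dvd z0 by (intro zdvd_imp_le) auto
      then have "p \<in> quadrant_primes_upto X" using p z0 by (simp add: quadrant_primes_upto_def)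
      then show False using z p by auto
    qed
    have "sifted_L k s (quadrant_primes_upto X) = infsum (hecke_term k s) (circ 1 \<union> (?S - circ 1))" unfolding sifted_L_def using U by (simp add: Un_absorb1)
    also have "\<dots> = infsum (hecke_term k s) (circ 1) + infsum (hecke_term k s) (?S - circ 1)"
      by (intro infsum_Un_disjoint summable_hecke_term assms) auto
    also have "infsum (hecke_term k s) (circ 1) = (\<Sum>u\<in>circ 1. hecke_term k s u)" by (rule infsum_finite) simp
    also have "\<dots> = (\<Sum>u\<in>circ 1. 1)" by (intro sum.cong refl hecke_term_unit) (simp add: circ_def)
    also have "\<dots> = 4" using card_circ_1 by simp
    finally have "norm (sifted_L k s (quadrant_primes_upto X) - 4) = norm (infsum (hecke_term k s) (?S - circ 1))" by simp
    also have "\<dots> \<le> infsum (\<lambda>z. norm (hecke_term k s z)) (?S - circ 1)"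
      by (intro norm_infsum_bound abs_summable_hecke_term assms)
    also have "\<dots> = infsum (norm_powr s) (?S - circ 1)" by (simp add: norm_hecke_term)
    also have "\<dots> \<le> infsum (norm_powr s) (UNIV - F)"
    proof (rule infsum_mono_neutral)
      fix z assume "z \<in> (?S - circ 1) - (UNIV - F)"
      then have "z = 0" using big[of z] X0[of z] X by auto
      then show "norm_powr s z \<le> 0" by simp
    qed (auto intro: summable_on_subset_banach[OF summable_norm_powr[OF assms]])
    also have "\<dots> = infsum (norm_powr s) UNIV - sum (norm_powr s) F"
      using F(1) by (subst infsum_Diff) (auto intro: summable_norm_powr[OF assms])
    also have "\<dots> \<le> e / 2" using F(3) unfolding dist_real_def by linarith
    also have "\<dots> < e" using \<open>0 < e\<close> by simp
    finally show ?thesis .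
  qed
  then show "\<exists>no. \<forall>X\<ge>no. norm (sifted_L k s (quadrant_primes_upto X) - 4) < e" by blast
qed

lemma cmod_one_minus_sq: "(cmod (1 - b))\<^sup>2 = 1 - 2 * Re b + (cmod b)\<^sup>2"
  unfolding cmod_power2 by (simp add: power2_eq_square algebra_simps)

text \<open>The upper bound is 1 + x \<le> exp x for the squared modulus; the lower one follows by applying the upper
bound to 1 + a and using (1 - a)(1 + a) = 1 - a^2.\<close>

lemma norm_one_minus_bounds:
  fixes a :: complex
  assumes "cmod a \<le> 1 / 2"
  shows "exp (- Re a - 5 / 2 * (cmod a)\<^sup>2) \<le> cmod (1 - a)" "cmod (1 - a) \<le> exp (- Re a + 5 / 2 * (cmod a)\<^sup>2)"
proof -
  have up: "cmod (1 - b) \<le> exp (- Re b + (cmod b)\<^sup>2 / 2)" for b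
  proof -
    have "(cmod (1 - b))\<^sup>2 = 1 + (- 2 * Re b + (cmod b)\<^sup>2)"
      by (simp add: cmod_one_minus_sq)
    also have "\<dots> \<le> exp (- 2 * Re b + (cmod b)\<^sup>2)" by (rule exp_ge_add_one_self)
    also have "\<dots> = (exp (- Re b + (cmod b)\<^sup>2 / 2))\<^sup>2" by (simp add: exp_double[symmetric] algebra_simps)
    finally show ?thesis by (rule power2_le_imp_le) simp
  qed
  have "cmod (1 - a) \<le> exp (- Re a + (cmod a)\<^sup>2 / 2)" by (rule up)
  also have "\<dots> \<le> exp (- Re a + 5 / 2 * (cmod a)\<^sup>2)" by simp
  finally show "cmod (1 - a) \<le> exp (- Re a + 5 / 2 * (cmod a)\<^sup>2)" .
  have sq: "(cmod a)\<^sup>2 \<le> 1 / 2"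
  proof -
    have "(cmod a)\<^sup>2 \<le> (1 / 2)\<^sup>2" using assms by (intro power_mono) auto
    then show ?thesis by (simp add: power2_eq_square)
  qed
  have "exp (- 2 * (cmod a)\<^sup>2) \<le> 1 - (cmod a)\<^sup>2" using sq by (intro exp_le_one_minus) auto
  also have "\<dots> \<le> cmod (1 - a\<^sup>2)" using norm_triangle_ineq2[of 1 "a\<^sup>2"] by (simp add: norm_power)
  also have "1 - a\<^sup>2 = (1 - a) * (1 - (- a))" by (simp add: power2_eq_square algebra_simps)
  also have "cmod \<dots> \<le> cmod (1 - a) * exp (Re a + (cmod a)\<^sup>2 / 2)"
    using up[of "- a"] unfolding norm_mult by (intro mult_left_mono) auto
  finally have f1: "exp (- 2 * (cmod a)\<^sup>2) * exp (- (Re a + (cmod a)\<^sup>2 / 2))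
      \<le> (cmod (1 - a) * exp (Re a + (cmod a)\<^sup>2 / 2)) * exp (- (Re a + (cmod a)\<^sup>2 / 2))"
    by (intro mult_right_mono) auto
  have f2: "exp (- 2 * (cmod a)\<^sup>2) * exp (- (Re a + (cmod a)\<^sup>2 / 2)) = exp (- Re a - 5 / 2 * (cmod a)\<^sup>2)"
    unfolding exp_add[symmetric] by (rule arg_cong[of _ _ exp]) simp
  have f3: "(cmod (1 - a) * exp (Re a + (cmod a)\<^sup>2 / 2)) * exp (- (Re a + (cmod a)\<^sup>2 / 2)) = cmod (1 - a)"
    by (simp add: mult.assoc exp_add[symmetric])
  show "exp (- Re a - 5 / 2 * (cmod a)\<^sup>2) \<le> cmod (1 - a)" using f1 unfolding f2 f3 .
qed

definition prime_sum :: "nat \<Rightarrow> real \<Rightarrow> nat \<Rightarrow> real" where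
  "prime_sum k s X = (\<Sum>p\<in>quadrant_primes_upto X. Re (hecke_term k s p))"

definition norm_powr_2_total :: real where "norm_powr_2_total = infsum (norm_powr 2) UNIV"

lemma sum_norm_powr_sq_le:
  assumes "1 \<le> s" "finite Q"
  shows "(\<Sum>p\<in>Q. (norm_powr s p)\<^sup>2) \<le> norm_powr_2_total"
proof -
  have "(\<Sum>p\<in>Q. (norm_powr s p)\<^sup>2) \<le> (\<Sum>p\<in>Q. norm_powr 2 p)"
  proof (rule sum_mono)
    fix p
    show "(norm_powr s p)\<^sup>2 \<le> norm_powr 2 p"
    proof (cases "p = 0")
      case False
      then have "1 \<le> real_of_int (gnorm p)" using gnorm_ge_1[of p] by simp
      then have "real_of_int (gnorm p) powr (- (2 * s)) \<le> norm_powr 2 p"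
        unfolding norm_powr_def using assms by (intro powr_mono) auto
      moreover have "(norm_powr s p)\<^sup>2 = real_of_int (gnorm p) powr (- (2 * s))"
        by (simp add: norm_powr_def power2_eq_square flip: powr_add)
      ultimately show ?thesis by simp
    qed simp
  qed
  also have "\<dots> \<le> norm_powr_2_total" unfolding norm_powr_2_total_def
    using assms by (intro finite_sum_le_infsum summable_norm_powr) auto
  finally show ?thesis .
qed

lemma norm_powr_quadrant_primes_le:
  assumes "p \<in> quadrant_primes" "1 < s"
  shows "norm_powr s p \<le> 1 / 2"
proof -
  have "p \<noteq> 0" "gnorm p \<noteq> 1" using assms by (auto simp: quadrant_primes_def gprime_def)
  then have "2 \<le> gnorm p" using gnorm_ge_1[of p] by linarith
  then have "2 \<le> real_of_int (gnorm p)" by linarith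
  then have "norm_powr s p \<le> 2 powr (- s)" unfolding norm_powr_def using assms by (intro powr_mono2') auto
  also have "\<dots> \<le> 2 powr (- 1)" using assms by (intro powr_mono) auto
  finally show ?thesis by (simp add: powr_minus)
qed

definition euler_const :: real where "euler_const = exp (5 / 2 * norm_powr_2_total)"
lemma euler_const_pos: "0 < euler_const" by (simp add: euler_const_def)

text \<open>The logarithm of the absolute value of the L-series is, up to a bounded error, the sum over primes. Working
with finite partial sums and sufficiently large X avoids the convergence of the latter.\<close>

lemma hecke_L_vs_prime_sum:
  assumes "1 < s"
  shows "\<forall>\<^sub>F X in sequentially. cmod (hecke_L k s) \<le> 8 * euler_const * exp (prime_sum k s X)
      \<and> 2 / euler_const * exp (prime_sum k s X) \<le> cmod (hecke_L k s)"
proof -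
  have "(\<lambda>X. cmod (sifted_L k s (quadrant_primes_upto X))) \<longlonglongrightarrow> cmod 4" by (intro tendsto_norm sifted_L_limit assms)
  then have lim: "(\<lambda>X. cmod (sifted_L k s (quadrant_primes_upto X))) \<longlonglongrightarrow> 4" by simp
  have "\<forall>\<^sub>F X in sequentially. 2 < cmod (sifted_L k s (quadrant_primes_upto X))" using lim by (rule order_tendstoD) simp
  moreover have "\<forall>\<^sub>F X in sequentially. cmod (sifted_L k s (quadrant_primes_upto X)) < 8" using lim by (rule order_tendstoD) simp
  ultimately show ?thesis
  proof eventually_elim
    case (elim X)
    define P where "P = (\<Prod>p\<in>quadrant_primes_upto X. cmod (1 - hecke_term k s p))"
    have T: "cmod (sifted_L k s (quadrant_primes_upto X)) = cmod (hecke_L k s) * P"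
      using sifted_L_prod[OF assms finite_quadrant_primes_upto quadrant_primes_upto_subset, of k X] by (simp add: norm_mult P_def prod_norm)
    have a: "cmod (hecke_term k s p) \<le> 1 / 2" if "p \<in> quadrant_primes_upto X" for p
      using norm_powr_quadrant_primes_le[of p s] that assms quadrant_primes_upto_subset by (auto simp: norm_hecke_term)
    have sq: "(\<Sum>p\<in>quadrant_primes_upto X. (cmod (hecke_term k s p))\<^sup>2) \<le> norm_powr_2_total"
      unfolding norm_hecke_term using assms by (intro sum_norm_powr_sq_le) auto
    have "P \<le> (\<Prod>p\<in>quadrant_primes_upto X. exp (- Re (hecke_term k s p) + 5 / 2 * (cmod (hecke_term k s p))\<^sup>2))"
      unfolding P_def by (intro prod_mono conjI norm_one_minus_bounds a) auto
    also have "\<dots> = exp (- prime_sum k s X + 5 / 2 * (\<Sum>p\<in>quadrant_primes_upto X. (cmod (hecke_term k s p))\<^sup>2))"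
      by (simp add: exp_sum[symmetric] prime_sum_def sum.distrib sum_negf sum_distrib_left sum_subtractf)
    also have "\<dots> \<le> exp (- prime_sum k s X + 5 / 2 * norm_powr_2_total)" using sq by simp
    finally have P1: "P \<le> exp (- prime_sum k s X + 5 / 2 * norm_powr_2_total)" .
    have "exp (- prime_sum k s X - 5 / 2 * norm_powr_2_total) \<le> exp (- prime_sum k s X - 5 / 2 * (\<Sum>p\<in>quadrant_primes_upto X. (cmod (hecke_term k s p))\<^sup>2))"
      using sq by simp
    also have "\<dots> = (\<Prod>p\<in>quadrant_primes_upto X. exp (- Re (hecke_term k s p) - 5 / 2 * (cmod (hecke_term k s p))\<^sup>2))"
      by (simp add: exp_sum[symmetric] prime_sum_def sum_subtractf sum_negf sum_distrib_left)
    also have "\<dots> \<le> P"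
      unfolding P_def by (intro prod_mono conjI norm_one_minus_bounds a) auto
    finally have P2: "exp (- prime_sum k s X - 5 / 2 * norm_powr_2_total) \<le> P" .
    have "cmod (hecke_L k s) * exp (- prime_sum k s X - 5 / 2 * norm_powr_2_total) \<le> 8"
      using mult_left_mono[OF P2, of "cmod (hecke_L k s)"] elim T by simp
    then have f1: "cmod (hecke_L k s) * exp (- prime_sum k s X - 5 / 2 * norm_powr_2_total) * exp (prime_sum k s X + 5 / 2 * norm_powr_2_total) \<le> 8 * exp (prime_sum k s X + 5 / 2 * norm_powr_2_total)"
      by (intro mult_right_mono) auto
    have f2: "cmod (hecke_L k s) * exp (- prime_sum k s X - 5 / 2 * norm_powr_2_total) * exp (prime_sum k s X + 5 / 2 * norm_powr_2_total) = cmod (hecke_L k s)"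
      by (simp add: mult.assoc exp_add[symmetric])
    have "2 \<le> cmod (hecke_L k s) * exp (- prime_sum k s X + 5 / 2 * norm_powr_2_total)"
      using mult_left_mono[OF P1, of "cmod (hecke_L k s)"] elim T by simp
    then have f3: "2 * exp (prime_sum k s X - 5 / 2 * norm_powr_2_total) \<le> cmod (hecke_L k s) * exp (- prime_sum k s X + 5 / 2 * norm_powr_2_total) * exp (prime_sum k s X - 5 / 2 * norm_powr_2_total)"
      by (intro mult_right_mono) auto
    have f4: "cmod (hecke_L k s) * exp (- prime_sum k s X + 5 / 2 * norm_powr_2_total) * exp (prime_sum k s X - 5 / 2 * norm_powr_2_total) = cmod (hecke_L k s)"
      by (simp add: mult.assoc exp_add[symmetric])
    have "exp (prime_sum k s X + 5 / 2 * norm_powr_2_total) = euler_const * exp (prime_sum k s X)" by (simp only: euler_const_def exp_add mult.commute)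
    moreover have "exp (prime_sum k s X - 5 / 2 * norm_powr_2_total) = exp (prime_sum k s X) / euler_const" by (simp only: euler_const_def exp_diff)
    ultimately show ?case using f1 f3 unfolding f2 f4 by (simp add: mult.assoc)
  qed
qed

lemma Re_hecke_term: "Re (hecke_term k s z) = norm_powr s z * Re (hecke 1 z ^ k)"
  by (simp add: hecke_term_def hecke_def power_mult)

lemma three_four_one: "0 \<le> 3 * prime_sum 0 s X + 4 * prime_sum k s X + prime_sum (2 * k) s X"
proof -
  have "3 * prime_sum 0 s X + 4 * prime_sum k s X + prime_sum (2 * k) s X
     = (\<Sum>p\<in>quadrant_primes_upto X. 3 * Re (hecke_term 0 s p) + 4 * Re (hecke_term k s p) + Re (hecke_term (2 * k) s p))"
    by (simp add: prime_sum_def sum.distrib sum_distrib_left)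
  also have "\<dots> \<ge> 0"
  proof (rule sum_nonneg)
    fix p assume "p \<in> quadrant_primes_upto X"
    then have "p \<noteq> 0" by (auto simp: quadrant_primes_upto_def quadrant_primes_def)
    define w where "w = hecke 1 p ^ k"
    have "cmod w = 1" using norm_hecke[OF \<open>p \<noteq> 0\<close>] by (simp add: w_def norm_power)
    then have "(Re w)\<^sup>2 + (Im w)\<^sup>2 = 1" by (simp add: cmod_power2[symmetric])
    then have "Re (w ^ 2) = 2 * (Re w)\<^sup>2 - 1" by (simp add: power2_eq_square)
    moreover have "0 \<le> 2 * (1 + Re w)\<^sup>2" by simp
    ultimately have "0 \<le> 3 + 4 * Re w + Re (w ^ 2)" by (simp add: power2_eq_square algebra_simps)
    then have "0 \<le> norm_powr s p * (3 + 4 * Re w + Re (w ^ 2))" by (intro mult_nonneg_nonneg) auto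
    moreover have "hecke 1 p ^ (2 * k) = w ^ 2" by (simp only: w_def power_mult[symmetric] mult.commute)
    then have "Re (hecke_term (2 * k) s p) = norm_powr s p * Re (w ^ 2)" by (simp only: Re_hecke_term)
    moreover have "Re (hecke_term k s p) = norm_powr s p * Re w" "Re (hecke_term 0 s p) = norm_powr s p * 1"
      by (simp_all only: Re_hecke_term w_def power_0 one_complex.sel)
    ultimately show "0 \<le> 3 * Re (hecke_term 0 s p) + 4 * Re (hecke_term k s p) + Re (hecke_term (2 * k) s p)"
      by (simp only:) (simp add: algebra_simps)
  qed
  finally show ?thesis .
qed

text \<open>By the 3-4-1 inequality the sum over primes for the k-th character is at least -3/4 times the one for the
trivial character, up to a bounded quantity.\<close>

lemma hecke_L_lower_three_quarters:
  assumes "0 < k"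
  shows "\<exists>c>0. \<forall>s. 1 < s \<longrightarrow> s \<le> 2 \<longrightarrow> c * (s - 1) powr (3 / 4) \<le> cmod (hecke_L k s)"
proof -
  obtain A where A: "0 < A" "\<And>s. 1 < s \<Longrightarrow> s \<le> 2 \<Longrightarrow> cmod (hecke_L 0 s) \<le> A / (s - 1)" using hecke_L_0_upper by blast
  obtain B where B: "0 < B" "\<And>s. 1 < s \<Longrightarrow> s \<le> 2 \<Longrightarrow> cmod (hecke_L (2 * k) s) \<le> B"
    using hecke_L_upper[of "2 * k"] assms by auto
  define E where "E = euler_const"
  have E: "0 < E" using euler_const_pos by (simp add: E_def)
  define c where "c = 2 / E * ((E * A / 2) powr (- 3 / 4) * (E * B / 2) powr (- 1 / 4))"
  have "c * (s - 1) powr (3 / 4) \<le> cmod (hecke_L k s)" if s: "1 < s" "s \<le> 2" for s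
  proof -
    have "\<forall>\<^sub>F X in sequentially. c * (s - 1) powr (3 / 4) \<le> cmod (hecke_L k s)"
      using hecke_L_vs_prime_sum[OF s(1), of 0] hecke_L_vs_prime_sum[OF s(1), of k] hecke_L_vs_prime_sum[OF s(1), of "2 * k"]
    proof eventually_elim
      case (elim X)
      have "2 / E * exp (prime_sum 0 s X) \<le> A / (s - 1)" using elim(1) A(2)[OF s] unfolding E_def by linarith
      then have "exp (prime_sum 0 s X) \<le> E * A / 2 / (s - 1)" using E s by (simp add: field_simps)
      then have 0: "prime_sum 0 s X \<le> ln (E * A / 2 / (s - 1))" using E A s by (subst ln_ge_iff) auto
      have "2 / E * exp (prime_sum (2 * k) s X) \<le> B" using elim(3) B(2)[OF s] unfolding E_def by linarith
      then have "exp (prime_sum (2 * k) s X) \<le> E * B / 2" using E by (simp add: field_simps)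
      then have 2: "prime_sum (2 * k) s X \<le> ln (E * B / 2)" using E B by (subst ln_ge_iff) auto
      have "ln (E * A / 2 / (s - 1)) = ln (E * A / 2) - ln (s - 1)" using E A s by (subst ln_div) auto
      then have "- 3 / 4 * ln (E * A / 2) + 3 / 4 * ln (s - 1) - 1 / 4 * ln (E * B / 2) \<le> prime_sum k s X"
        using three_four_one[of s X k] 0 2 by linarith
      then have "exp (- 3 / 4 * ln (E * A / 2) + 3 / 4 * ln (s - 1) + - 1 / 4 * ln (E * B / 2)) \<le> exp (prime_sum k s X)" by simp
      also have "exp (- 3 / 4 * ln (E * A / 2) + 3 / 4 * ln (s - 1) + - 1 / 4 * ln (E * B / 2))
          = (E * A / 2) powr (- 3 / 4) * (s - 1) powr (3 / 4) * (E * B / 2) powr (- 1 / 4)"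
      proof -
        have "E * A / 2 \<noteq> 0" "s - 1 \<noteq> 0" "E * B / 2 \<noteq> 0" using E A B s by auto
        then show ?thesis by (simp only: powr_def exp_add if_False)
      qed
      finally have "2 / E * ((E * A / 2) powr (- 3 / 4) * (s - 1) powr (3 / 4) * (E * B / 2) powr (- 1 / 4)) \<le> 2 / E * exp (prime_sum k s X)"
        using E by (intro mult_left_mono) auto
      also have "\<dots> \<le> cmod (hecke_L k s)" using elim(2) by (simp add: E_def)
      finally show ?case by (simp add: c_def mult_ac)
    qed
    then show ?thesis by simp
  qed
  moreover have "0 < c" unfolding c_def using E A B by auto
  ultimately show ?thesis by blast
qed

text \<open>If this vanished, then by the Lipschitz bound the L-series would be of order s - 1 near s = 1, which
contradicts the lower bound of order (s - 1)^(3/4).\<close>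

lemma coset_diff_sum_1_nonzero:
  assumes "0 < k"
  shows "coset_diff_sum k 1 \<noteq> 0"
proof
  assume z: "coset_diff_sum k 1 = 0"
  obtain c where c: "0 < c" "\<And>s. 1 < s \<Longrightarrow> s \<le> 2 \<Longrightarrow> c * (s - 1) powr (3 / 4) \<le> cmod (hecke_L k s)"
    using hecke_L_lower_three_quarters[OF assms] by blast
  define d where "d = cmod (1 - hecke k two_plus_i) / 2"
  have d: "0 < d" using hecke_two_plus_i_neq_1[OF assms] by (simp add: d_def)
  define B where "B = infsum (lip_bound k) UNIV"
  have ineq: "c * d * x powr (3 / 4) \<le> B * x" if x: "0 < x" "x \<le> 1" for x
  proof -
    have s: "1 < 1 + x" "1 + x \<le> 2" using x by auto
    have "c * x powr (3 / 4) * d \<le> cmod (hecke_L k (1 + x)) * cmod (1 - 5 * hecke_term k (1 + x) two_plus_i)"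
      using c(2)[OF s] euler_factor_lower[OF assms, of "1 + x"] x d by (intro mult_mono) (auto simp: d_def)
    also have "\<dots> = cmod (coset_diff_sum k (1 + x))" using hecke_L_eq_coset_diff_sum(2)[OF s(1), of k] by (metis norm_mult)
    also have "\<dots> \<le> B * x" using coset_diff_sum_lipschitz[of "1 + x" 1 k] x z by (simp add: B_def)
    finally show ?thesis by (simp add: mult_ac)
  qed
  have "((\<lambda>x. B * x powr (1 / 4)) \<longlongrightarrow> 0) (at_right 0)" by real_asymp
  moreover have "0 < c * d" using c d by simp
  ultimately have "\<forall>\<^sub>F x in at_right 0. B * x powr (1 / 4) < c * d" by (rule order_tendstoD)
  moreover have "\<forall>\<^sub>F x in at_right (0::real). 0 < x \<and> x < 1"
    using eventually_at_right_real[of 0 1] by (auto elim: eventually_mono)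
  ultimately have "\<forall>\<^sub>F x in at_right (0::real). False"
  proof eventually_elim
    case (elim x)
    have "B * x = B * x powr (1 / 4 + 3 / 4)" using elim by simp
    also have "\<dots> = (B * x powr (1 / 4)) * x powr (3 / 4)" unfolding powr_add by simp
    also have "\<dots> < c * d * x powr (3 / 4)" using elim by (intro mult_strict_right_mono) auto
    finally show False using ineq[of x] elim by simp
  qed
  then show False by simp
qed

lemma prime_sum_bounded:
  assumes "0 < k"
  shows "\<exists>C. \<forall>\<^sub>F s in at_right 1. \<forall>\<^sub>F X in sequentially. \<bar>prime_sum k s X\<bar> \<le> C"
proof -
  obtain B where B: "0 < B" "\<And>s. 1 < s \<Longrightarrow> s \<le> 2 \<Longrightarrow> cmod (hecke_L k s) \<le> B"
    using hecke_L_upper[OF assms] by auto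
  define e where "e = cmod (coset_diff_sum k 1)"
  have e: "0 < e" using coset_diff_sum_1_nonzero[OF assms] by (simp add: e_def)
  define E where "E = euler_const"
  have E: "0 < E" using euler_const_pos by (simp add: E_def)
  have "((\<lambda>s. infsum (lip_bound k) UNIV * \<bar>s - 1\<bar>) \<longlongrightarrow> infsum (lip_bound k) UNIV * \<bar>1 - 1\<bar>) (at_right 1)"
    by (intro tendsto_intros)
  then have "\<forall>\<^sub>F s in at_right 1. infsum (lip_bound k) UNIV * \<bar>s - 1\<bar> < e / 2"
    by (rule order_tendstoD) (use e in simp)
  moreover have "\<forall>\<^sub>F s in at_right (1::real). 1 < s \<and> s < 2"
    using eventually_at_right_real[of 1 2] by (auto elim: eventually_mono)
  ultimately have "\<forall>\<^sub>F s in at_right 1. \<forall>\<^sub>F X in sequentially. \<bar>prime_sum k s X\<bar> \<le> \<bar>ln (E * B / 2)\<bar> + \<bar>ln (e / 4 / (8 * E))\<bar>"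
  proof eventually_elim
    case (elim s)
    then have s: "1 < s" "s \<le> 2" by auto
    have "e - e / 2 \<le> cmod (coset_diff_sum k s)"
      using coset_diff_sum_lipschitz[of 1 s k] s elim norm_triangle_ineq2[of "coset_diff_sum k 1" "coset_diff_sum k s"] by (simp add: e_def abs_minus_commute)
    also have "\<dots> = cmod (hecke_L k s) * cmod (1 - 5 * hecke_term k s two_plus_i)" using hecke_L_eq_coset_diff_sum(2)[OF s(1), of k] by (metis norm_mult)
    also have "\<dots> \<le> cmod (hecke_L k s) * 2" using euler_factor_upper[of s k] s by (intro mult_left_mono) auto
    finally have low: "e / 4 \<le> cmod (hecke_L k s)" by simp
    show ?case using hecke_L_vs_prime_sum[OF s(1), of k]
    proof eventually_elim
      case (elim X)
      have "2 / E * exp (prime_sum k s X) \<le> B" using elim B(2)[OF s] unfolding E_def by linarith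
      then have "exp (prime_sum k s X) \<le> E * B / 2" using E by (simp add: field_simps)
      then have 1: "prime_sum k s X \<le> ln (E * B / 2)" using E B by (subst ln_ge_iff) auto
      have "e / 4 \<le> 8 * E * exp (prime_sum k s X)" using elim low unfolding E_def by linarith
      then have "e / 4 / (8 * E) \<le> exp (prime_sum k s X)" using E by (simp add: field_simps)
      then have "ln (e / 4 / (8 * E)) \<le> ln (exp (prime_sum k s X))" using e E by (subst ln_le_cancel_iff) auto
      then have 2: "ln (e / 4 / (8 * E)) \<le> prime_sum k s X" by simp
      show ?case using 1 2 by linarith
    qed
  qed
  then show ?thesis by blast
qed

lemma hecke_L_0_ge_sum:
  assumes "1 < s"
  shows "(\<Sum>n=1..N. real n * (2 * (real n)\<^sup>2) powr (- s)) \<le> cmod (hecke_L 0 s)"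
proof -
  define f where "f = (\<lambda>(n, b). Gauss (int n) (int b))"
  define S where "S = (SIGMA n:{1..N}. {1..n})"
  have inj: "inj_on f S" by (auto simp: inj_on_def f_def)
  have "(\<Sum>n=1..N. real n * (2 * (real n)\<^sup>2) powr (- s)) = (\<Sum>n=1..N. \<Sum>b=1..n. (2 * (real n)\<^sup>2) powr (- s))" by simp
  also have "\<dots> = (\<Sum>(n, b)\<in>S. (2 * (real n)\<^sup>2) powr (- s))" unfolding S_def by (rule sum.Sigma) auto
  also have "\<dots> \<le> (\<Sum>x\<in>S. norm_powr s (f x))"
  proof (rule sum_mono, clarify)
    fix n b assume "(n, b) \<in> S"
    then have nb: "1 \<le> b" "b \<le> n" by (auto simp: S_def)
    then have "(real b)\<^sup>2 \<le> (real n)\<^sup>2" by (intro power_mono) auto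
    then have "(real n)\<^sup>2 + (real b)\<^sup>2 \<le> 2 * (real n)\<^sup>2" by simp
    moreover have "0 < (real n)\<^sup>2 + (real b)\<^sup>2" using nb by (intro add_pos_nonneg) auto
    ultimately show "(2 * (real n)\<^sup>2) powr (- s) \<le> norm_powr s (f (n, b))"
      using assms by (auto simp: norm_powr_def gnorm_def f_def intro!: powr_mono2')
  qed
  also have "\<dots> = sum (norm_powr s) (f ` S)" by (subst sum.reindex[OF inj]) simp
  also have "\<dots> \<le> infsum (norm_powr s) UNIV"
    by (intro finite_sum_le_infsum summable_norm_powr assms) (auto simp: S_def)
  also have "\<dots> = cmod (hecke_L 0 s)"
  proof -
    have e: "hecke_term 0 s = (\<lambda>z. complex_of_real (norm_powr s z))" by (simp add: fun_eq_iff hecke_term_def hecke_def)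
    have "((\<lambda>z. complex_of_real (norm_powr s z)) has_sum complex_of_real (infsum (norm_powr s) UNIV)) UNIV"
      by (rule has_sum_of_real[OF has_sum_infsum[OF summable_norm_powr[OF assms]]])
    then have "hecke_L 0 s = of_real (infsum (norm_powr s) UNIV)" unfolding hecke_L_def e by (rule infsumI)
    then show ?thesis by (simp add: infsum_nonneg)
  qed
  finally show ?thesis .
qed

text \<open>The elements n + bi with b \<le> n already contribute half the harmonic series at s = 1.\<close>

lemma prime_sum_0_unbounded: "\<forall>\<^sub>F s in at_right 1. \<forall>\<^sub>F X in sequentially. C \<le> prime_sum 0 s X"
proof -
  define E where "E = euler_const"
  have E: "0 < E" using euler_const_pos by (simp add: E_def)
  define D where "D = 8 * E * exp C"
  have "\<forall>\<^sub>F N in sequentially. 2 * D + 2 \<le> harm N"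
    using harm_at_top by (simp add: filterlim_at_top)
  then obtain N :: nat where N: "2 * D + 2 \<le> harm N" by (auto simp: eventually_sequentially)
  have "(\<Sum>n=1..N. real n * (2 * (real n)\<^sup>2) powr (- 1)) = (\<Sum>n=1..N. inverse (real n) / 2)"
    by (intro sum.cong refl) (auto simp: powr_minus power2_eq_square field_simps)
  also have "\<dots> = harm N / 2" by (simp add: harm_def sum_divide_distrib)
  finally have at1: "D < (\<Sum>n=1..N. real n * (2 * (real n)\<^sup>2) powr (- 1))" using N by simp
  have "((\<lambda>s. \<Sum>n=1..N. real n * (2 * (real n)\<^sup>2) powr (- s)) \<longlongrightarrow> (\<Sum>n=1..N. real n * (2 * (real n)\<^sup>2) powr (- 1))) (at_right 1)"
    by (intro tendsto_intros) auto
  then have "\<forall>\<^sub>F s in at_right 1. D < (\<Sum>n=1..N. real n * (2 * (real n)\<^sup>2) powr (- s))"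
    using at1 by (rule order_tendstoD)
  moreover have "\<forall>\<^sub>F s in at_right (1::real). 1 < s" by (rule eventually_at_right_less)
  ultimately show ?thesis
  proof eventually_elim
    case (elim s)
    then have D: "D < cmod (hecke_L 0 s)" using hecke_L_0_ge_sum[of s N] by linarith
    show ?case using hecke_L_vs_prime_sum[OF elim(2), of 0]
    proof eventually_elim
      case (elim X)
      then have "8 * E * exp C < 8 * E * exp (prime_sum 0 s X)" using D unfolding D_def E_def by linarith
      then have "exp C < exp (prime_sum 0 s X)" using E by simp
      then show ?case by simp
    qed
  qed
qed

section \<open>Gaussian primes in narrow sectors\<close>

text \<open>The nonnegative trigonometric polynomial (2 + 2 cos x)^N, concentrated near 0, with its Fourier expansion.\<close>

lemma two_plus_two_Re_power:
  assumes "cmod w = 1"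
  shows "(2 + 2 * Re w) ^ N = (\<Sum>j\<le>2 * N. real (2 * N choose j) * Re (w ^ (if N \<le> j then j - N else N - j)))"
proof -
  have ww: "w * cnj w = 1" using assms by (simp add: complex_norm_square[symmetric])
  have "(1 + w) * (1 + cnj w) = of_real (2 + 2 * Re w)"
    using ww by (simp add: algebra_simps complex_eq_iff)
  then have "of_real ((2 + 2 * Re w) ^ N) = ((1 + w) * (1 + cnj w)) ^ N" by simp
  also have "1 + cnj w = cnj w * (w + 1)" using ww by (simp add: algebra_simps)
  also have "((1 + w) * (cnj w * (w + 1))) ^ N = cnj w ^ N * (w + 1) ^ (2 * N)"
  proof -
    have "(1 + w) * (cnj w * (w + 1)) = cnj w * (w + 1)\<^sup>2" by (simp add: power2_eq_square algebra_simps)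
    then show ?thesis by (simp only: power_mult_distrib power_mult)
  qed
  also have "\<dots> = (\<Sum>j\<le>2 * N. of_nat (2 * N choose j) * (cnj w ^ N * w ^ j))"
    by (simp add: binomial_ring sum_distrib_left mult_ac)
  finally have "(2 + 2 * Re w) ^ N = Re (\<Sum>j\<le>2 * N. of_nat (2 * N choose j) * (cnj w ^ N * w ^ j))"
    by (metis Re_complex_of_real)
  also have "\<dots> = (\<Sum>j\<le>2 * N. real (2 * N choose j) * Re (cnj w ^ N * w ^ j))"
    by (simp only: Re_sum) (intro sum.cong refl, simp)
  also have "\<dots> = (\<Sum>j\<le>2 * N. real (2 * N choose j) * Re (w ^ (if N \<le> j then j - N else N - j)))"
  proof (intro sum.cong refl arg_cong2[of _ _ _ _ "(*)"])
    fix j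
    show "Re (cnj w ^ N * w ^ j) = Re (w ^ (if N \<le> j then j - N else N - j))"
    proof (cases "N \<le> j")
      case True
      then have "w ^ j = w ^ N * w ^ (j - N)" by (simp flip: power_add)
      then have "cnj w ^ N * w ^ j = (w * cnj w) ^ N * w ^ (j - N)" by (simp add: power_mult_distrib mult_ac)
      then show ?thesis using True ww by simp
    next
      case False
      then have "cnj w ^ N = cnj w ^ j * cnj w ^ (N - j)" by (simp flip: power_add)
      then have "cnj w ^ N * w ^ j = (w * cnj w) ^ j * cnj (w ^ (N - j))" by (simp add: power_mult_distrib mult_ac)
      then show ?thesis using False ww by (simp del: complex_cnj_power)
    qed
  qed
  finally show ?thesis .
qed

text \<open>Inert primes lie on the axis and must not be mistaken for the primes to be found; their norms are squares, so
their contribution is bounded.\<close>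

lemma sum_axis_bounded:
  assumes "1 \<le> s" "finite Q" "\<And>p. p \<in> Q \<Longrightarrow> gIm p = 0 \<and> 0 < gRe p"
  shows "(\<Sum>p\<in>Q. norm_powr s p) \<le> infsum (\<lambda>a :: int. (1 + \<bar>real_of_int a\<bar>) powr (- 2)) UNIV"
proof -
  have inj: "inj_on (\<lambda>p. gRe p - 1) Q" using assms(3) by (auto simp: inj_on_def gauss_eq_iff)
  have "(\<Sum>p\<in>Q. norm_powr s p) \<le> (\<Sum>p\<in>Q. (1 + \<bar>real_of_int (gRe p - 1)\<bar>) powr (- 2))"
  proof (rule sum_mono)
    fix p assume "p \<in> Q"
    then have p: "gIm p = 0" "1 \<le> real_of_int (gRe p)" using assms(3)[of p] by auto
    have "norm_powr s p = ((real_of_int (gRe p))\<^sup>2) powr (- s)" by (simp add: norm_powr_def gnorm_def p)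
    also have "\<dots> \<le> ((real_of_int (gRe p))\<^sup>2) powr (- 1)" using assms(1) p by (intro powr_mono) auto
    also have "\<dots> = real_of_int (gRe p) powr (- 2)" using p by (simp add: powr_minus powr_realpow)
    finally show "norm_powr s p \<le> (1 + \<bar>real_of_int (gRe p - 1)\<bar>) powr (- 2)" using p by simp
  qed
  also have "\<dots> = (\<Sum>a\<in>(\<lambda>p. gRe p - 1) ` Q. (1 + \<bar>real_of_int a\<bar>) powr (- 2))"
    by (subst sum.reindex[OF inj]) simp
  also have "\<dots> \<le> infsum (\<lambda>a :: int. (1 + \<bar>real_of_int a\<bar>) powr (- 2)) UNIV"
    using assms(2) by (intro finite_sum_le_infsum summable_on_int_powr) auto
  finally show ?thesis .
qed

text \<open>Suppose that all primes off the axis satisfy Re w \<le> 1 - 2e, where w is the value of the first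
character, and sum (2 + 2 Re w)^N over the primes. By the Fourier expansion this is the central binomial
coefficient times the sum for the trivial character, up to a bounded quantity; by assumption it is at most
4^N (1 - e)^N times that sum, up to a bounded quantity. For large N the second factor is smaller, and the sum
for the trivial character is unbounded as s tends to 1.\<close>

lemma ex_quadrant_primes_near_axis:
  assumes "0 < e" "e < 1"
  shows "\<exists>p\<in>quadrant_primes. gIm p \<noteq> 0 \<and> 1 - 2 * e < Re (hecke 1 p)"
proof (rule ccontr)
  assume neg: "\<not> ?thesis"
  have "(\<lambda>N. 2 * real N * (1 - e) ^ N) \<longlonglongrightarrow> 0" using assms by real_asymp
  then have "\<forall>\<^sub>F N in sequentially. 2 * real N * (1 - e) ^ N < 1" by (rule order_tendstoD) simp
  then obtain N where N: "0 < N" "2 * real N * (1 - e) ^ N < 1"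
    by (metis (mono_tags, lifting) eventually_sequentially le_add1 le_add2 less_numeral_extra(1) order_less_le_trans)
  define b where "b = real (2 * N choose N) - 4 ^ N * (1 - e) ^ N"
  have b: "0 < b"
  proof -
    have "4 ^ N * (1 - e) ^ N < 4 ^ N / (2 * real N)" using N by (simp add: field_simps)
    also have "\<dots> \<le> real (2 * N choose N)" using N by (intro central_binomial_lower_bound)
    finally show ?thesis by (simp add: b_def)
  qed
  define A where "A = infsum (\<lambda>a :: int. (1 + \<bar>real_of_int a\<bar>) powr (- 2)) UNIV"
  define idx where "idx j = (if N \<le> j then j - N else N - j)" for j
  have "\<exists>C. \<forall>j. j \<noteq> N \<longrightarrow> (\<forall>\<^sub>F s in at_right 1. \<forall>\<^sub>F X in sequentially. \<bar>prime_sum (idx j) s X\<bar> \<le> C j)"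
  proof (rule choice, intro allI)
    fix j
    show "\<exists>c. j \<noteq> N \<longrightarrow> (\<forall>\<^sub>F s in at_right 1. \<forall>\<^sub>F X in sequentially. \<bar>prime_sum (idx j) s X\<bar> \<le> c)"
      using prime_sum_bounded[of "idx j"] by (cases "j = N") (auto simp: idx_def)
  qed
  then obtain C where C: "\<And>j. j \<noteq> N \<Longrightarrow> \<forall>\<^sub>F s in at_right 1. \<forall>\<^sub>F X in sequentially. \<bar>prime_sum (idx j) s X\<bar> \<le> C j" by blast
  define K where "K = (\<Sum>j\<in>{..2 * N} - {N}. real (2 * N choose j) * C j)"
  define M where "M = (4 ^ N * A + K) / b + 1"
  have "\<forall>\<^sub>F s in at_right 1. \<forall>j\<in>{..2 * N} - {N}. \<forall>\<^sub>F X in sequentially. \<bar>prime_sum (idx j) s X\<bar> \<le> C j"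
    using C by (intro eventually_ball_finite) auto
  moreover have "\<forall>\<^sub>F s in at_right (1::real). 1 < s" by (rule eventually_at_right_less)
  ultimately have "\<forall>\<^sub>F s in at_right (1::real). False"
    using prime_sum_0_unbounded[of M]
  proof eventually_elim
    case (elim s)
    have "\<forall>\<^sub>F X in sequentially. \<forall>j\<in>{..2 * N} - {N}. \<bar>prime_sum (idx j) s X\<bar> \<le> C j"
      using elim(1) by (intro eventually_ball_finite) auto
    then have "\<forall>\<^sub>F X :: nat in sequentially. False" using elim(3)
    proof eventually_elim
      case (elim X)
      let ?w = "\<lambda>p. hecke 1 p"
      have nz: "p \<noteq> 0" if "p \<in> quadrant_primes_upto X" for p using that by (auto simp: quadrant_primes_upto_def quadrant_primes_def)
      have le: "norm_powr s p * (2 + 2 * Re (?w p)) ^ N \<le> norm_powr s p * (4 ^ N * (1 - e) ^ N) + 4 ^ N * (if gIm p = 0 then norm_powr s p else 0)"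
        if p: "p \<in> quadrant_primes_upto X" for p
      proof -
        have w: "cmod (?w p) = 1" using nz[OF p] by (rule norm_hecke)
        then have Re: "\<bar>Re (?w p)\<bar> \<le> 1" using abs_Re_le_cmod[of "?w p"] by simp
        show ?thesis
        proof (cases "gIm p = 0")
          case True
          have "(2 + 2 * Re (?w p)) ^ N \<le> 4 ^ N" using Re by (intro power_mono) auto
          then have "norm_powr s p * (2 + 2 * Re (?w p)) ^ N \<le> norm_powr s p * 4 ^ N" by (intro mult_left_mono) auto
          moreover have "0 \<le> norm_powr s p * (4 ^ N * (1 - e) ^ N)" using assms by simp
          ultimately show ?thesis using True by (simp add: mult.commute)
        next
          case False
          then have "Re (?w p) \<le> 1 - 2 * e" using neg p quadrant_primes_upto_subset by fastforce
          then have "(2 + 2 * Re (?w p)) ^ N \<le> (4 * (1 - e)) ^ N" using Re by (intro power_mono) auto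
          then have "norm_powr s p * (2 + 2 * Re (?w p)) ^ N \<le> norm_powr s p * (4 * (1 - e)) ^ N" by (intro mult_left_mono) auto
          then show ?thesis using False by (simp only: power_mult_distrib) simp
        qed
      qed
      have "(\<Sum>p\<in>quadrant_primes_upto X. norm_powr s p * (2 + 2 * Re (?w p)) ^ N)
         = (\<Sum>p\<in>quadrant_primes_upto X. \<Sum>j\<le>2 * N. real (2 * N choose j) * Re (hecke_term (idx j) s p))"
      proof (intro sum.cong refl)
        fix p assume p: "p \<in> quadrant_primes_upto X"
        have "(2 + 2 * Re (?w p)) ^ N = (\<Sum>j\<le>2 * N. real (2 * N choose j) * Re (?w p ^ idx j))"
          unfolding idx_def by (intro two_plus_two_Re_power norm_hecke nz[OF p])
        then show "norm_powr s p * (2 + 2 * Re (?w p)) ^ N = (\<Sum>j\<le>2 * N. real (2 * N choose j) * Re (hecke_term (idx j) s p))"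
          by (simp add: Re_hecke_term sum_distrib_left mult_ac)
      qed
      also have "\<dots> = (\<Sum>j\<le>2 * N. real (2 * N choose j) * prime_sum (idx j) s X)"
        unfolding prime_sum_def sum_distrib_left by (rule sum.swap)
      also have "\<dots> = real (2 * N choose N) * prime_sum 0 s X + (\<Sum>j\<in>{..2 * N} - {N}. real (2 * N choose j) * prime_sum (idx j) s X)"
        by (subst sum.remove[of _ N]) (auto simp: idx_def)
      also have "\<dots> \<ge> real (2 * N choose N) * prime_sum 0 s X - K"
      proof -
        have "- K = (\<Sum>j\<in>{..2 * N} - {N}. real (2 * N choose j) * (- C j))" by (simp add: K_def sum_negf)
        also have "\<dots> \<le> (\<Sum>j\<in>{..2 * N} - {N}. real (2 * N choose j) * prime_sum (idx j) s X)"
          using elim(1) by (intro sum_mono mult_left_mono) (auto simp: abs_le_iff minus_le_iff)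
        finally show ?thesis by simp
      qed
      finally have 1: "real (2 * N choose N) * prime_sum 0 s X - K \<le> (\<Sum>p\<in>quadrant_primes_upto X. norm_powr s p * (2 + 2 * Re (?w p)) ^ N)" .
      have "(\<Sum>p\<in>quadrant_primes_upto X. norm_powr s p * (2 + 2 * Re (?w p)) ^ N)
         \<le> (\<Sum>p\<in>quadrant_primes_upto X. norm_powr s p * (4 ^ N * (1 - e) ^ N) + 4 ^ N * (if gIm p = 0 then norm_powr s p else 0))"
        by (intro sum_mono le)
      also have "\<dots> = 4 ^ N * (1 - e) ^ N * prime_sum 0 s X + 4 ^ N * (\<Sum>p\<in>{p \<in> quadrant_primes_upto X. gIm p = 0}. norm_powr s p)"
        by (simp add: sum.distrib prime_sum_def Re_hecke_term sum_distrib_left sum_distrib_right sum.inter_filter mult_ac)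
      also have "(\<Sum>p\<in>{p \<in> quadrant_primes_upto X. gIm p = 0}. norm_powr s p) \<le> A"
        unfolding A_def using \<open>1 < s\<close>
          by (intro sum_axis_bounded finite_subset[OF _ finite_quadrant_primes_upto[of X]]) (auto simp: quadrant_primes_upto_def quadrant_primes_def)
      finally have "b * prime_sum 0 s X \<le> 4 ^ N * A + K" using 1 by (simp add: b_def algebra_simps)
      then have "prime_sum 0 s X \<le> (4 ^ N * A + K) / b" using b by (simp add: field_simps)
      then show False using elim(2) by (simp add: M_def)
    qed
    then show False by simp
  qed
  then show False by simp
qed

lemma gprime_off_axis_norm_prime:
  assumes "gprime d" "gRe d \<noteq> 0" "gIm d \<noteq> 0"
  obtains p where "prime p" "gnorm d = int p"
proof -
  have ex: "\<exists>q. prime q \<and> d dvd of_nat q" if "d dvd of_nat n" "0 < n" for n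
    using that
  proof (induction n rule: less_induct)
    case (less n)
    have "n \<noteq> 1"
    proof
      assume "n = 1"
      then have "gnorm d dvd 1" using gnorm_dvd[OF less.prems(1)] by simp
      then show False using assms(1) by (simp add: gprime_def zdvd1_eq)
    qed
    then obtain q where q: "prime q" "q dvd n" using prime_factor_nat by blast
    then obtain l where l: "n = q * l" by (elim dvdE)
    show ?case
    proof (cases "d dvd of_nat q")
      case False
      then have "d dvd of_nat l" using less.prems(1) assms(1) False unfolding gprime_def l of_nat_mult by blast
      moreover have "0 < l" using l less.prems by (cases l) auto
      moreover have "l < n" using l \<open>0 < l\<close> prime_gt_1_nat[OF q(1)] by simp
      ultimately show ?thesis using less.IH by blast
    qed (use q in blast)
  qed
  have d0: "d \<noteq> 0" using assms by auto
  have "d dvd of_nat (nat (gnorm d))"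
  proof -
    have "d * gcnj d = of_nat (nat (gnorm d))" by (intro mult_gcnj_nat) simp
    then show ?thesis by (metis dvd_triv_left)
  qed
  then obtain q where q: "prime q" "d dvd of_nat q" using ex[of "nat (gnorm d)"] d0 by auto
  then obtain h where h: "of_nat q = d * h" by (elim dvdE)
  have "gnorm d dvd (int q) ^ 2" using gnorm_dvd[OF q(2)] by simp
  then have "nat (gnorm d) dvd q ^ 2" by (simp add: nat_dvd_iff)
  then obtain i where i: "i \<le> 2" "nat (gnorm d) = q ^ i" using q(1) divides_primepow_nat by blast
  then have gi: "gnorm d = int q ^ i" using gnorm_nonneg[of d] by (metis int_nat_eq of_nat_power)
  have "i \<noteq> 0" using gi assms(1) unfolding gprime_def by (metis power_0)
  moreover have "i \<noteq> 2"
  proof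
    assume "i = 2"
    then have "(int q)\<^sup>2 * gnorm h = (int q)\<^sup>2" using gi arg_cong[OF h, of gnorm] by (simp add: gnorm_mult)
    then have "gnorm h = 1" using q(1) by auto
    then have "h * gcnj h = 1" by (simp add: mult_gcnj)
    then have "d = of_nat q * gcnj h" unfolding h by (simp add: mult.assoc)
    then show False using \<open>gnorm h = 1\<close> assms(2,3) by (auto simp: gnorm_eq_1_iff)
  qed
  ultimately have "i = 1" using i(1) by linarith
  then show ?thesis using that q(1) gi by simp
qed

text \<open>The fourth power of the direction is close to 1, so one of the four associates has a direction close to 1.\<close>

theorem gaussian_primes_near_axis:
  assumes "0 < e"
  shows "\<exists>d p. prime p \<and> odd p \<and> gnorm d = int p \<and> cmod (dir d - 1) < e"
proof -
  define e1 where "e1 = min (1 / 2) (e ^ 8 / 8)"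
  have e1: "0 < e1" "e1 < 1" using assms by (auto simp: e1_def)
  obtain d where d: "d \<in> quadrant_primes" "gIm d \<noteq> 0" "1 - 2 * e1 < Re (hecke 1 d)" using ex_quadrant_primes_near_axis[OF e1] by blast
  have d0: "d \<noteq> 0" and gd: "gprime d" using d by (auto simp: quadrant_primes_def)
  obtain p where p: "prime p" "gnorm d = int p"
    by (rule gprime_off_axis_norm_prime[OF gd]) (use d in \<open>auto simp: quadrant_primes_def\<close>)
  define w where "w = dir d"
  have w: "cmod (w ^ 4) = 1" using norm_dir[OF d0] by (simp add: w_def norm_power)
  have "(cmod (w ^ 4 - 1))\<^sup>2 = (cmod (w ^ 4))\<^sup>2 - 2 * Re (w ^ 4) + 1"
    using cmod_one_minus_sq[of "w ^ 4"] by (simp add: norm_minus_commute)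
  also have "\<dots> < 4 * e1" using d(3) w by (simp add: hecke_def w_def)
  also have "\<dots> \<le> e ^ 8" 
  proof -
    have "e1 \<le> e ^ 8 / 8" "0 \<le> e ^ 8" using assms by (auto simp: e1_def)
    then show ?thesis by linarith
  qed
  finally have "(cmod (w ^ 4 - 1))\<^sup>2 < (e ^ 4)\<^sup>2" by (simp flip: power_mult)
  then have small: "cmod (w ^ 4 - 1) < e ^ 4" by (rule power2_less_imp_less) (use assms in simp)
  have odd: "odd p"
  proof
    assume "even p"
    then have "p = 2" using p(1) by (auto simp: prime_nat_iff)
    then have "(gRe d)\<^sup>2 + (gIm d)\<^sup>2 = 2" using p(2) by (simp add: gnorm_def)
    then have "d = 1 + gI"
    proof -
      have r: "1 \<le> gRe d" "1 \<le> gIm d" using d by (auto simp: quadrant_primes_def)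
      have "gRe d * 1 \<le> gRe d * gRe d" "gIm d * 1 \<le> gIm d * gIm d" using r by (intro mult_left_mono; simp)+
      then have "gRe d + gIm d \<le> 2" using \<open>(gRe d)\<^sup>2 + (gIm d)\<^sup>2 = 2\<close> by (simp add: power2_eq_square)
      then show ?thesis using r by (simp add: gauss_eq_iff)
    qed
    then have "w ^ 2 = sgn (emb ((1 + gI) * (1 + gI)))" by (simp add: w_def dir_def sgn_mult power2_eq_square)
    also have "(1 + gI) * (1 + gI) = of_nat 2 * gI" by (simp add: gauss_eq_iff)
    also have "sgn (emb (of_nat 2 * gI)) = \<i>"
      by (simp only: emb_simps sgn_mult) (simp add: sgn_eq)
    finally have "w ^ 4 = - 1" using power_mult[of w 2 2] by simp
    then have "Re (hecke 1 d) = - 1" by (simp add: hecke_def w_def)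
    then show False using d(3) e1 by (simp add: e1_def)
  qed
  have "\<exists>u. gnorm u = 1 \<and> cmod (dir (u * d) - 1) < e"
  proof (rule ccontr)
    assume neg: "\<not> ?thesis"
    have ge: "e \<le> cmod (dir u * w - 1)" if "gnorm u = 1" for u
      using neg that by (auto simp: w_def not_less)
    have "e \<le> cmod (w - 1)" using ge[of 1] by simp
    moreover have "e \<le> cmod (w + 1)"
    proof -
      have "cmod (- w - 1) = cmod (w + 1)" by (metis minus_add_distrib norm_minus_cancel diff_conv_add_uminus)
      then show ?thesis using ge[of "- 1"] by simp
    qed
    moreover have "e \<le> cmod (w - \<i>)"
    proof -
      have "cmod (- \<i> * w - 1) = cmod (- \<i> * (w - \<i>))" by (simp add: algebra_simps)
      then show ?thesis using ge[of "- gI"] by (simp add: norm_mult)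
    qed
    moreover have "e \<le> cmod (w + \<i>)"
    proof -
      have "cmod (\<i> * w - 1) = cmod (\<i> * (w + \<i>))" by (simp add: algebra_simps)
      then show ?thesis using ge[of gI] by (simp add: norm_mult)
    qed
    ultimately have "e * e * (e * e) \<le> cmod (w - 1) * cmod (w + 1) * (cmod (w - \<i>) * cmod (w + \<i>))"
      using assms by (intro mult_mono) auto
    also have "\<dots> = cmod ((w - 1) * (w + 1) * ((w - \<i>) * (w + \<i>)))" by (simp only: norm_mult)
    also have "(w - 1) * (w + 1) * ((w - \<i>) * (w + \<i>)) = w ^ 4 - 1" by (simp add: algebra_simps power4_eq_xxxx)
    finally show False using small by (simp add: power4_eq_xxxx mult.assoc)
  qed
  then obtain u where u: "gnorm u = 1" "cmod (dir (u * d) - 1) < e" by blast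
  have "gnorm (u * d) = int p" using u p by (simp add: gnorm_mult)
  then show ?thesis using p(1) odd u(2) by blast
qed

section \<open>Almost prime neighbours\<close>

lemma card_quadratic_roots_le_2:
  fixes \<alpha> \<beta> \<gamma> :: int
  assumes p: "prime p" and nondeg: "\<not> (int p dvd \<alpha> \<and> int p dvd \<beta> \<and> int p dvd \<gamma>)"
  shows "card {t. t < p \<and> int p dvd \<alpha> * (int t)\<^sup>2 + \<beta> * int t + \<gamma>} \<le> 2" (is "card ?S \<le> 2")
proof (rule ccontr)
  assume "\<not> card ?S \<le> 2"
  then have "3 \<le> card ?S" by simp
  then obtain T where T: "T \<subseteq> ?S" "card T = 3" by (rule obtain_subset_with_card_n)
  then obtain a b c where abc: "T = {a, b, c}" "a \<noteq> b" "b \<noteq> c" "a \<noteq> c" by (auto simp: card_3_iff)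
  have ip: "prime (int p)" using p by simp
  have diff: "\<not> int p dvd int x - int y" if "x < p" "y < p" "x \<noteq> y" for x y
  proof
    assume "int p dvd int x - int y"
    then have "int x mod int p = int y mod int p" by (simp add: mod_eq_dvd_iff)
    then show False using that by simp
  qed
  have key: "int p dvd \<alpha> * (int x + int y) + \<beta>" if "x \<in> ?S" "y \<in> ?S" "x \<noteq> y" for x y
  proof -
    have "int p dvd (\<alpha> * (int x)\<^sup>2 + \<beta> * int x + \<gamma>) - (\<alpha> * (int y)\<^sup>2 + \<beta> * int y + \<gamma>)"
      using that by (intro dvd_diff) auto
    also have "\<dots> = (int x - int y) * (\<alpha> * (int x + int y) + \<beta>)" by (simp add: power2_eq_square algebra_simps)
    finally show ?thesis using diff[of x y] that prime_dvd_mult_iff[OF ip] by blast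
  qed
  have in_S: "a \<in> ?S" "b \<in> ?S" "c \<in> ?S" using T abc by auto
  have ab: "int p dvd \<alpha> * (int a + int b) + \<beta>" and ac: "int p dvd \<alpha> * (int a + int c) + \<beta>"
    using key in_S abc by blast+
  have "int p dvd (\<alpha> * (int a + int b) + \<beta>) - (\<alpha> * (int a + int c) + \<beta>)" using ab ac by (rule dvd_diff)
  also have "\<dots> = \<alpha> * (int b - int c)" by (simp add: algebra_simps)
  finally have 1: "int p dvd \<alpha>" using diff[of b c] in_S abc prime_dvd_mult_iff[OF ip] by blast
  then have 2: "int p dvd \<beta>" using ab by (simp add: dvd_add_right_iff)
  have "int p dvd \<alpha> * (int a)\<^sup>2 + \<beta> * int a + \<gamma>" using in_S by simp
  moreover have "int p dvd \<alpha> * (int a)\<^sup>2 + \<beta> * int a" using 1 2 by (intro dvd_add dvd_mult2)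
  ultimately have "int p dvd \<gamma>" by (simp only: dvd_add_right_iff)
  then show False using nondeg 1 2 by simp
qed

lemma gnorm_linear:
  "gnorm (x + of_nat t * y) = gnorm y * (int t)\<^sup>2 + 2 * gRe (x * gcnj y) * int t + gnorm x"
  by (simp add: gnorm_def power2_eq_square algebra_simps)

lemma gnorm_linear_shift:
  "gnorm (x + of_nat (r + p * k) * y) = gnorm (x + of_nat r * y)
     + int p * (gnorm y * int k * (2 * int r + int p * int k) + 2 * gRe (x * gcnj y) * int k)"
  unfolding gnorm_linear by (simp add: power2_eq_square algebra_simps)

text \<open>The norm of x + t y is a quadratic polynomial in t whose discriminant is -4 times the square of the
imaginary part of x conj y.\<close>

lemma card_linear_norm_roots_le_2:
  assumes "prime p" "p \<noteq> 2"
    and "int p dvd gnorm x \<Longrightarrow> int p dvd gnorm y \<Longrightarrow> \<not> int p dvd gIm (x * gcnj y)"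
  shows "card {t. t < p \<and> int p dvd gnorm (x + of_nat t * y)} \<le> 2"
  unfolding gnorm_linear
proof (rule card_quadratic_roots_le_2[OF assms(1)], rule notI, elim conjE)
  assume d: "int p dvd gnorm y" "int p dvd 2 * gRe (x * gcnj y)" "int p dvd gnorm x"
  define r i where "r = gRe (x * gcnj y)" and "i = gIm (x * gcnj y)"
  have "r\<^sup>2 + i\<^sup>2 = gnorm (x * gcnj y)" by (simp only: gnorm_def r_def i_def)
  also have "\<dots> = gnorm x * gnorm y" by (simp only: gnorm_mult gnorm_simps)
  finally have "gnorm x * gnorm y = r\<^sup>2 + i\<^sup>2" by simp
  then have "(2 * i)\<^sup>2 = 4 * (gnorm x * gnorm y) - (2 * r) * (2 * r)"
    by (simp add: power2_eq_square algebra_simps)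
  moreover have "int p dvd \<dots>" using d unfolding r_def by (intro dvd_diff) (auto intro: dvd_mult)
  ultimately have "int p dvd (2 * i)\<^sup>2" by (simp only:)
  then have "int p dvd 2 * i" by (rule prime_dvd_power[of "int p", rotated]) (use assms in simp)
  moreover have "coprime (int p) 2"
    using primes_coprime[OF assms(1) two_is_prime_nat assms(2)] by (simp flip: coprime_int_iff)
  ultimately have "int p dvd i" by (simp only: coprime_dvd_mult_right_iff)
  then show False using assms(3) d unfolding i_def by blast
qed

lemma gnorm_add: "gnorm (x + y) = gnorm x + 2 * gRe (x * gcnj y) + gnorm y"
  by (simp add: gnorm_def power2_eq_square algebra_simps)

lemma gnorm_add_le: "gnorm (x + y) \<le> 2 * (gnorm x + gnorm y)"
proof -
  have "0 \<le> gnorm (x - y)" by simp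
  also have "gnorm (x - y) = 2 * (gnorm x + gnorm y) - gnorm (x + y)"
    by (simp add: gnorm_def power2_eq_square algebra_simps)
  finally show ?thesis by simp
qed

text \<open>Let e = 1 + 2i. The norm of w v + e is that of w v, plus 5, plus twice the real part of w v conj(e), so it
exceeds the norm of w v by 1 exactly if the real part of c v is -2, where c = w conj(e). As c is primitive,
this linear equation has the solutions v0 + t i conj(c). Neither of the two resulting quadratic polynomials
in t vanishes identically modulo a prime p \<ge> 5, so at most 4 classes modulo p are to be avoided. Their
values are smaller than Z^(2C+1) while all their prime factors from 5 onwards exceed Z.\<close>

lemma almost_prime_neighbours_aux:
  "\<exists>K>0. \<forall>w m. gnorm w = int m \<and> primitive w \<and> odd m \<and> \<not> 5 dvd gRe w + 2 * gIm w \<longrightarrow>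
     (\<exists>u>0. coprime m u \<and> circ u \<noteq> {} \<and> circ (m * u + 1) \<noteq> {}
        \<and> card (circ u) \<le> K \<and> card (circ (m * u + 1)) \<le> K)"
proof -
  obtain C J0 where sieve: "\<forall>J\<ge>J0. \<forall>R :: nat \<Rightarrow> nat set.
     (\<forall>p. prime p \<longrightarrow> 5 \<le> p \<longrightarrow> R p \<subseteq> {..<p} \<and> card (R p) \<le> 4) \<longrightarrow>
     (\<exists>s < 2 ^ (C * 2 ^ J). \<forall>p. prime p \<longrightarrow> 5 \<le> p \<longrightarrow> p \<le> 2 ^ (2 ^ J) \<longrightarrow> s mod p \<notin> R p)"
    using sieve_of_dimension_4 by (elim exE)
  show ?thesis
  proof (rule exI[of _ "4 * 2 ^ (2 * C)"], intro conjI allI impI)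
    fix w m assume asm: "gnorm w = int m \<and> primitive w \<and> odd m \<and> \<not> 5 dvd gRe w + 2 * gIm w"
    then have w: "gnorm w = int m" "primitive w" "odd m" "\<not> 5 dvd gRe w + 2 * gIm w" by auto
    have m0: "0 < m" using w(3) by (cases m) auto
    define e where "e = Gauss 1 2"
    have e [simp]: "gRe e = 1" "gIm e = 2" "gnorm e = 5" by (simp_all add: e_def gnorm_def)
    define c where "c = w * gcnj e"
    have prim_c: "primitive c" unfolding primitive_iff
    proof (intro allI impI notI)
      fix q :: nat assume q: "prime q" "of_nat q dvd c"
      have "c * e = of_nat 5 * w" by (simp add: c_def gauss_eq_iff)
      then have "of_nat q dvd of_nat 5 * w" using q(2) by (metis dvd_mult2)
      then have "int q dvd 5 * gRe w" "int q dvd 5 * gIm w" by (simp_all add: gauss_of_nat_dvd_iff)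
      then have "int q dvd 5 \<or> of_nat q dvd w"
        using q(1) by (auto simp: prime_dvd_mult_iff gauss_of_nat_dvd_iff)
      then have "int q dvd int 5" using w(2) q(1) by (auto simp: primitive_iff)
      then have "q dvd 5" by (simp only: of_nat_dvd_iff)
      moreover have "prime (5 :: nat)" by simp
      ultimately have "q = 5" using q(1) primes_dvd_imp_eq by blast
      then have "int 5 dvd gRe c" using q(2) unfolding gauss_of_nat_dvd_iff by blast
      moreover have "gRe c = gRe w + 2 * gIm w" by (simp add: c_def)
      ultimately have "5 dvd gRe w + 2 * gIm w" by simp
      then show False using w(4) by simp
    qed
    have "\<exists>x y. x * gRe c + y * gIm c = gcd (gRe c) (gIm c)" using bezout_int by blast
    then obtain x y where xy: "x * gRe c + y * gIm c = 1" using prim_c by (auto simp: primitive_def)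
    define v0 where "v0 = Gauss (- 2 * x) (2 * y)"
    have "gRe (c * v0) = - 2 * (x * gRe c + y * gIm c)" by (simp add: v0_def algebra_simps)
    then have cv0: "gRe (c * v0) = - 2" using xy by simp
    define \<eta> where "\<eta> = gI * gcnj c"
    define v where "v t = v0 + of_nat t * \<eta>" for t :: nat
    have cv: "gRe (c * v t) = - 2" for t
    proof -
      have "c * v t = c * v0 + of_nat t * (gI * (c * gcnj c))" by (simp add: v_def \<eta>_def algebra_simps)
      then show ?thesis using cv0 by (simp add: mult_gcnj)
    qed
    define z where "z t = (w * v0 + e) + of_nat t * (w * \<eta>)" for t :: nat
    have z_eq: "z t = w * v t + e" for t by (simp add: z_def v_def algebra_simps)
    have gz: "gnorm (z t) = int m * gnorm (v t) + 1" for t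
    proof -
      have "w * v t * gcnj e = c * v t" by (simp add: c_def mult_ac)
      then show ?thesis unfolding z_eq gnorm_add using cv[of t] w(1) by (simp only: gnorm_mult e)
    qed
    have g\<eta>: "gnorm \<eta> = 5 * int m" using w(1) by (simp add: \<eta>_def c_def gnorm_mult)
    \<comment> \<open>the imaginary parts in the discriminants of the two polynomials are 2 and -3m\<close>
    have im_v: "gIm (v0 * gcnj \<eta>) = 2"
    proof -
      have "v0 * gcnj \<eta> = - gI * (c * v0)" by (simp add: \<eta>_def gauss_eq_iff algebra_simps)
      then show ?thesis using cv0 by simp
    qed
    have im_z: "gIm ((w * v0 + e) * gcnj (w * \<eta>)) = - 3 * int m"
    proof -
      have "(w * v0 + e) * gcnj (w * \<eta>) = (w * gcnj w) * (v0 * gcnj \<eta>) + (w * gcnj w) * (e * gcnj e) * gcnj gI"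
        by (simp add: \<eta>_def c_def algebra_simps)
      also have "\<dots> = of_int (int m) * (v0 * gcnj \<eta>) + of_int (int m) * of_int 5 * gcnj gI"
        by (simp only: mult_gcnj w(1) e)
      finally show ?thesis using im_v by simp
    qed
    define R where "R p = {t. t < p \<and> int p dvd gnorm (v t)} \<union> {t. t < p \<and> int p dvd gnorm (z t)}" for p
    have R: "R p \<subseteq> {..<p} \<and> card (R p) \<le> 4" if p: "prime p" "5 \<le> p" for p
    proof
      have cop: "\<not> int p dvd 2" "\<not> int p dvd 3" using p(2) by (auto dest!: zdvd_imp_le)
      have "card {t. t < p \<and> int p dvd gnorm (v t)} \<le> 2"
        unfolding v_def
      proof (rule card_linear_norm_roots_le_2[OF p(1)])
        show "\<not> int p dvd gIm (v0 * gcnj \<eta>)" using cop by (simp only: im_v) simp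
      qed (use p in simp)
      moreover have "card {t. t < p \<and> int p dvd gnorm (z t)} \<le> 2"
        unfolding z_def
      proof (rule card_linear_norm_roots_le_2[OF p(1)])
        assume d: "int p dvd gnorm (w * v0 + e)"
        show "\<not> int p dvd gIm ((w * v0 + e) * gcnj (w * \<eta>))"
        proof
          assume "int p dvd gIm ((w * v0 + e) * gcnj (w * \<eta>))"
          then have "int p dvd 3 * int m" by (simp only: im_z) simp
          then have "int p dvd int m" using p(1) cop(2) by (simp add: prime_dvd_mult_iff)
          moreover have "int p dvd int m * gnorm (v 0) + 1" using d gz[of 0] by (simp add: z_def)
          ultimately have "int p dvd 1" by (metis dvd_add_right_iff dvd_mult2)
          then show False using p by simp
        qed
      qed (use p in simp)
      ultimately show "card (R p) \<le> 4" unfolding R_def using card_Un_le[of "{t. t < p \<and> int p dvd gnorm (v t)}" "{t. t < p \<and> int p dvd gnorm (z t)}"] by linarith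
    qed (auto simp: R_def)
    \<comment> \<open>m u + 1 is at most H Z^(2C), and J is so large that H is smaller than Z\<close>
    define H where "H = m * (2 * (nat (gnorm v0) + 5 * m)) + 1"
    define J where "J = max J0 H"
    define Z :: nat where "Z = 2 ^ (2 ^ J)"
    have "H < Z"
    proof -
      have "H \<le> J" by (simp add: J_def)
      also have "J < 2 ^ J" by (rule less_exp)
      also have "(2::nat) ^ J < 2 ^ 2 ^ J" by (rule less_exp)
      finally show ?thesis by (simp add: Z_def)
    qed
    obtain s where s: "s < 2 ^ (C * 2 ^ J)" "\<And>p. prime p \<Longrightarrow> 5 \<le> p \<Longrightarrow> p \<le> Z \<Longrightarrow> s mod p \<notin> R p"
    proof -
      have "J0 \<le> J" by (simp add: J_def)
      moreover have "\<forall>p. prime p \<longrightarrow> 5 \<le> p \<longrightarrow> R p \<subseteq> {..<p} \<and> card (R p) \<le> 4" using R by blast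
      ultimately obtain s where "s < 2 ^ (C * 2 ^ J)"
          "\<forall>p. prime p \<longrightarrow> 5 \<le> p \<longrightarrow> p \<le> 2 ^ (2 ^ J) \<longrightarrow> s mod p \<notin> R p"
        using sieve[rule_format, of J R] by blast
      then show ?thesis using that[of s] unfolding Z_def by blast
    qed
    have sZ: "s < Z ^ C" using s(1) by (simp add: Z_def power_mult[symmetric] mult.commute)
    have lin_mod: "int p dvd gnorm (a + of_nat s * b) \<longleftrightarrow> int p dvd gnorm (a + of_nat (s mod p) * b)" for p a b
    proof -
      have e: "s mod p + p * (s div p) = s" by simp
      obtain k where "gnorm (a + of_nat s * b) = gnorm (a + of_nat (s mod p) * b) + int p * k"
        using gnorm_linear_shift[of a "s mod p" p "s div p" b] unfolding e by blast
      then show ?thesis by (simp only: dvd_add_left_iff[OF dvd_triv_left])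
    qed
    have noprime: "\<not> int p dvd gnorm (v s)" "\<not> int p dvd gnorm (z s)" if p: "prime p" "5 \<le> p" "p \<le> Z" for p
    proof -
      have "s mod p < p" using p by simp
      moreover have "s mod p \<notin> R p" using s(2) p by blast
      ultimately have "\<not> int p dvd gnorm (v (s mod p))" "\<not> int p dvd gnorm (z (s mod p))" by (auto simp: R_def)
      then show "\<not> int p dvd gnorm (v s)" "\<not> int p dvd gnorm (z s)"
        unfolding v_def z_def using lin_mod by blast+
    qed
    define u where "u = nat (gnorm (v s))"
    have gu: "gnorm (v s) = int u" by (simp add: u_def)
    have "v s \<noteq> 0" using cv[of s] by auto
    then have u0: "0 < u" using gnorm_pos_iff[of "v s"] by (simp add: u_def)
    have gN: "gnorm (z s) = int (m * u + 1)" using gz[of s] gu by simp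
    have bound: "m * u + 1 < Z ^ Suc (2 * C)"
    proof -
      have one: "1 \<le> Z ^ (2 * C)" by (simp add: Z_def)
      have "s\<^sup>2 \<le> (Z ^ C)\<^sup>2" using sZ by (intro power_mono) auto
      then have s2: "s\<^sup>2 \<le> Z ^ (2 * C)" by (simp add: power_mult[symmetric] mult.commute)
      have "int u \<le> 2 * (gnorm v0 + gnorm (of_nat s * \<eta>))" unfolding gu[symmetric] v_def by (rule gnorm_add_le)
      also have "\<dots> = int (2 * (nat (gnorm v0) + s\<^sup>2 * (5 * m)))" by (simp add: gnorm_mult g\<eta>)
      finally have "u \<le> 2 * (nat (gnorm v0) + s\<^sup>2 * (5 * m))" by (simp only: of_nat_le_iff)
      also have "\<dots> \<le> 2 * (nat (gnorm v0) * Z ^ (2 * C) + Z ^ (2 * C) * (5 * m))"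
        using s2 one by (intro mult_left_mono add_mono mult_right_mono) auto
      also have "\<dots> = 2 * (nat (gnorm v0) + 5 * m) * Z ^ (2 * C)" by (simp add: algebra_simps)
      finally have "m * u + 1 \<le> m * (2 * (nat (gnorm v0) + 5 * m) * Z ^ (2 * C)) + Z ^ (2 * C)"
        using one by (intro add_mono mult_left_mono) auto
      also have "\<dots> = H * Z ^ (2 * C)" by (simp add: H_def algebra_simps)
      also have "\<dots> < Z * Z ^ (2 * C)" using \<open>H < Z\<close> one by (intro mult_strict_right_mono) auto
      finally show ?thesis by simp
    qed
    have Z1: "1 \<le> Z" by (simp add: Z_def)
    have big: "Z < p" if "prime p" "p dvd u" "5 \<le> p" for p
    proof (rule ccontr)
      assume "\<not> Z < p"
      then have "\<not> int p dvd int u" using noprime(1)[of p] that gu by simp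
      then show False using that(2) of_nat_dvd_iff[of p u, where 'a = int] by blast
    qed
    have bigN: "Z < p" if "prime p" "p dvd m * u + 1" "5 \<le> p" for p
    proof (rule ccontr)
      assume "\<not> Z < p"
      then have "\<not> int p dvd int (m * u + 1)" using noprime(2)[of p] that gN by simp
      then show False using that(2) of_nat_dvd_iff[of p "m * u + 1", where 'a = int] by blast
    qed
    have "coprime m u"
    proof (rule ccontr)
      assume "\<not> coprime m u"
      then have "gcd m u \<noteq> 1" by (simp add: coprime_iff_gcd_eq_1)
      then obtain p where p: "prime p" "p dvd gcd m u" using prime_factor_nat by blast
      then have "5 \<le> p" using primitive_gnorm_prime_ge_5[OF w(2,1,3)] by simp
      then have "Z < p" using big p by simp
      moreover have "p \<le> m" using p m0 by (intro dvd_imp_le) auto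
      moreover have "m \<le> H"
      proof -
        have "m * 1 \<le> m * (2 * (nat (gnorm v0) + 5 * m))" using m0 by (intro mult_left_mono) auto
        then show ?thesis unfolding H_def by linarith
      qed
      ultimately show False using \<open>H < Z\<close> by simp
    qed
    moreover have "circ u \<noteq> {}" using gu by (auto simp: circ_def)
    moreover have "circ (m * u + 1) \<noteq> {}" using gN by (auto simp: circ_def)
    moreover have "card (circ u) \<le> 4 * 2 ^ (2 * C)"
    proof (rule card_circ_le[OF u0 Z1 big])
      have "u \<le> m * u" using m0 by simp
      then show "u < Z ^ Suc (2 * C)" using bound by linarith
    qed
    moreover have "card (circ (m * u + 1)) \<le> 4 * 2 ^ (2 * C)"
      by (rule card_circ_le[OF _ Z1 bigN bound]) simp
    ultimately show "\<exists>u>0. coprime m u \<and> circ u \<noteq> {} \<and> circ (m * u + 1) \<noteq> {}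
        \<and> card (circ u) \<le> 4 * 2 ^ (2 * C) \<and> card (circ (m * u + 1)) \<le> 4 * 2 ^ (2 * C)"
      using u0 by blast
  qed simp
qed

text \<open>The condition modulo 5 holds for w or for its conjugate.\<close>

theorem almost_prime_neighbours:
  "\<exists>K>0. \<forall>w m. gnorm w = int m \<longrightarrow> primitive w \<longrightarrow> odd m \<longrightarrow>
     (\<exists>u>0. coprime m u \<and> circ u \<noteq> {} \<and> circ (m * u + 1) \<noteq> {}
        \<and> card (circ u) \<le> K \<and> card (circ (m * u + 1)) \<le> K)"
proof -
  obtain K where K: "K > 0" "\<And>w m. gnorm w = int m \<and> primitive w \<and> odd m \<and> \<not> 5 dvd gRe w + 2 * gIm w \<Longrightarrow>
     (\<exists>u>0. coprime m u \<and> circ u \<noteq> {} \<and> circ (m * u + 1) \<noteq> {}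
        \<and> card (circ u) \<le> K \<and> card (circ (m * u + 1)) \<le> K)"
    using almost_prime_neighbours_aux by blast
  show ?thesis
  proof (rule exI[of _ K], intro conjI allI impI)
    fix w m assume w: "gnorm w = int m" "primitive w" "odd m"
    have "\<not> 5 dvd gRe w + 2 * gIm w \<or> \<not> 5 dvd gRe (gcnj w) + 2 * gIm (gcnj w)"
    proof (rule ccontr)
      assume "\<not> ?thesis"
      then have d: "5 dvd gRe w + 2 * gIm w" "5 dvd gRe w - 2 * gIm w" by auto
      then have "int 5 dvd gRe w" "int 5 dvd gIm w" by presburger+
      then have "of_nat 5 dvd w" using gauss_of_nat_dvd_iff[of 5 w] by blast
      moreover have "prime (5 :: nat)" by simp
      ultimately show False using w(2) unfolding primitive_iff by blast
    qed
    then show "\<exists>u>0. coprime m u \<and> circ u \<noteq> {} \<and> circ (m * u + 1) \<noteq> {}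
        \<and> card (circ u) \<le> K \<and> card (circ (m * u + 1)) \<le> K"
    proof
      assume "\<not> 5 dvd gRe w + 2 * gIm w"
      then show ?thesis using K(2)[of w m] w by blast
    next
      assume "\<not> 5 dvd gRe (gcnj w) + 2 * gIm (gcnj w)"
      moreover have "primitive (gcnj w)" using w(2) by (simp add: primitive_def)
      ultimately show ?thesis using K(2)[of "gcnj w" m] w by (simp only: gnorm_simps) blast
    qed
  qed (use K in simp)
qed

section \<open>Measures as averages over circles\<close>

lemma space_circle_borel [simp]: "space circle_borel = unit_circle"
  by (simp add: circle_borel_def space_restrict_space)

lemma borel_measurable_circle:
  fixes g :: "complex \<Rightarrow> real"
  shows "continuous_on unit_circle g \<Longrightarrow> g \<in> borel_measurable circle_borel"
  unfolding circle_borel_def by (rule borel_measurable_continuous_on_restrict)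

lemma measurable_uniform_count:
  "f ` A \<subseteq> space N \<Longrightarrow> f \<in> measurable (uniform_count_measure A) N"
  by (rule measurableI) (auto simp: space_uniform_count_measure sets_uniform_count_measure)

lemma integral_uniform_distr:
  fixes g :: "complex \<Rightarrow> real"
  assumes "finite A" "f ` A \<subseteq> unit_circle" "continuous_on unit_circle g"
  shows "integral\<^sup>L (distr (uniform_count_measure A) circle_borel f) g = (\<Sum>a\<in>A. g (f a)) / real (card A)"
proof -
  have "integral\<^sup>L (distr (uniform_count_measure A) circle_borel f) g = integral\<^sup>L (uniform_count_measure A) (\<lambda>a. g (f a))"
    using assms by (intro integral_distr measurable_uniform_count borel_measurable_circle) auto
  also have "\<dots> = (\<Sum>a\<in>A. g (f a)) / real (card A)" using assms(1) by (rule integral_uniform_count_measure)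
  finally show ?thesis .
qed

lemma integral_euc_measure:
  fixes g :: "complex \<Rightarrow> real"
  assumes "0 < n" "continuous_on unit_circle g"
  shows "integral\<^sup>L (euc_measure n) g = (\<Sum>z\<in>circ n. g (dir z)) / real (card (circ n))"
proof -
  have bij: "bij_betw (\<lambda>(x, y). Gauss x y) (lattice_circle n) (circ n)"
    by (rule bij_betw_byWitness[where f' = "\<lambda>z. (gRe z, gIm z)"])
      (auto simp: lattice_circle_def circ_def gnorm_def)
  have fin: "finite (lattice_circle n)" using bij_betw_finite[OF bij] by simp
  have dir: "cis (Arg (Complex (real_of_int x) (real_of_int y))) = dir (Gauss x y)" if "(x, y) \<in> lattice_circle n" for x y
  proof -
    have "Complex (real_of_int x) (real_of_int y) \<noteq> 0"
      using that assms(1) by (auto simp: lattice_circle_def complex_eq_iff)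
    then show ?thesis by (simp add: cis_Arg dir_def emb_def)
  qed
  have "integral\<^sup>L (euc_measure n) g
      = (\<Sum>a\<in>lattice_circle n. g ((\<lambda>(x, y). cis (Arg (Complex (real_of_int x) (real_of_int y)))) a)) / real (card (lattice_circle n))"
    unfolding euc_measure_def by (intro integral_uniform_distr fin assms(2)) auto
  also have "card (lattice_circle n) = card (circ n)" by (rule bij_betw_same_card[OF bij])
  also have "(\<Sum>a\<in>lattice_circle n. g ((\<lambda>(x, y). cis (Arg (Complex (real_of_int x) (real_of_int y)))) a))
      = (\<Sum>a\<in>lattice_circle n. g (dir ((\<lambda>(x, y). Gauss x y) a)))"
    by (intro sum.cong refl) (auto simp: dir)
  also have "\<dots> = (\<Sum>z\<in>circ n. g (dir z))" by (rule sum.reindex_bij_betw[OF bij])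
  finally show ?thesis .
qed

section \<open>Matrices of given norm\<close>

text \<open>The matrix with a + d + (b - c)i = 2z and a - d + (b + c)i = 2w. Its determinant is |z|^2 - |w|^2 and its
squared norm is 2 |z|^2 + 2 |w|^2.\<close>

definition mat_of :: "gauss \<times> gauss \<Rightarrow> int ^ 2 ^ 2" where
  "mat_of = (\<lambda>(z, w). vector [vector [gRe z + gRe w, gIm z + gIm w], vector [gIm w - gIm z, gRe z - gRe w]])"

lemma mat_of_sel [simp]:
  "mat_of (z, w) $ 1 $ 1 = gRe z + gRe w" "mat_of (z, w) $ 1 $ 2 = gIm z + gIm w"
  "mat_of (z, w) $ 2 $ 1 = gIm w - gIm z" "mat_of (z, w) $ 2 $ 2 = gRe z - gRe w"
  by (simp_all add: mat_of_def)

definition sl_sphere :: "nat \<Rightarrow> (int ^ 2 ^ 2) set" where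
  "sl_sphere n = {A. det A = 1 \<and> mat_norm_sq A = int n}"

lemma even_if_sum_squares_div_4:
  fixes x y k :: int
  assumes "x\<^sup>2 + y\<^sup>2 = 4 * k"
  shows "even x" "even y"
proof -
  have sq: "(c :: int)\<^sup>2 mod 4 = (if even c then 0 else 1)" for c
  proof (cases "even c")
    case True
    then obtain d where "c = 2 * d" by (elim evenE)
    then show ?thesis by (simp add: power_mult_distrib)
  next
    case False
    then obtain d where "c = 2 * d + 1" by (elim oddE)
    then have "c\<^sup>2 = 1 + 4 * (d * d + d)" by (simp add: power2_eq_square algebra_simps)
    then show ?thesis using False by (simp only: mod_mult_self2) simp
  qed
  have "(x\<^sup>2 mod 4 + y\<^sup>2 mod 4) mod 4 = 0" using assms by (simp add: mod_add_eq)
  then show "even x" "even y" unfolding sq by (auto split: if_splits)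
qed

text \<open>For a matrix of determinant 1 and squared norm 4M + 2 the sums of squares (a + d)^2 + (b - c)^2 and
(a - d)^2 + (b + c)^2 are 4M + 4 and 4M, so all four terms are even and z and w are Gaussian integers.\<close>

lemma bij_mat_of: "bij_betw mat_of (circ (M + 1) \<times> circ M) (sl_sphere (4 * M + 2))"
proof -
  define g where "g A = (Gauss ((A $ 1 $ 1 + A $ 2 $ 2) div 2) ((A $ 1 $ 2 - A $ 2 $ 1) div 2),
      Gauss ((A $ 1 $ 1 - A $ 2 $ 2) div 2) ((A $ 1 $ 2 + A $ 2 $ 1) div 2))" for A :: "int ^ 2 ^ 2"
  have gm: "g (mat_of x) = x" for x
    by (cases x) (simp add: g_def gauss_eq_iff)
  have inv: "mat_of (g A) = A \<and> g A \<in> circ (M + 1) \<times> circ M" if A: "A \<in> sl_sphere (4 * M + 2)" for A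
  proof -
    define a b c d where "a = A $ 1 $ 1" and "b = A $ 1 $ 2" and "c = A $ 2 $ 1" and "d = A $ 2 $ 2"
    have det: "a * d - b * c = 1" and nrm: "a\<^sup>2 + b\<^sup>2 + c\<^sup>2 + d\<^sup>2 = 4 * int M + 2"
      using A by (simp_all add: sl_sphere_def det_2 mat_norm_sq_def a_def b_def c_def d_def)
    have s1: "(a + d)\<^sup>2 + (b - c)\<^sup>2 = 4 * (int M + 1)" and s2: "(a - d)\<^sup>2 + (b + c)\<^sup>2 = 4 * int M"
      using det nrm by (simp_all add: power2_eq_square algebra_simps)
    note ev = even_if_sum_squares_div_4[OF s1] even_if_sum_squares_div_4[OF s2]
    then obtain p q r s where pqrs: "a + d = 2 * p" "b - c = 2 * q" "a - d = 2 * r" "b + c = 2 * s"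
      by (elim evenE)
    have gA: "g A = (Gauss p q, Gauss r s)"
      using pqrs by (simp add: g_def a_def[symmetric] b_def[symmetric] c_def[symmetric] d_def[symmetric])
    have abcd: "a = p + r" "b = q + s" "c = s - q" "d = p - r" using pqrs by linarith+
    have "mat_of (g A) = A"
      unfolding gA using abcd by (simp add: vec_eq_iff forall_2 a_def b_def c_def d_def)
    moreover have "p\<^sup>2 + q\<^sup>2 = int M + 1" "r\<^sup>2 + s\<^sup>2 = int M"
      using s1 s2 unfolding pqrs by (simp_all add: power_mult_distrib)
    ultimately show ?thesis by (simp add: gA circ_def gnorm_def)
  qed
  have fwd: "mat_of x \<in> sl_sphere (4 * M + 2)" if xin: "x \<in> circ (M + 1) \<times> circ M" for x
  proof -
    obtain z w where x: "x = (z, w)" "gnorm z = int M + 1" "gnorm w = int M"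
      using xin by (cases x) (auto simp: circ_def)
    have "det (mat_of x) = gnorm z - gnorm w"
      by (simp add: det_2 x(1) gnorm_def power2_eq_square algebra_simps)
    moreover have "mat_norm_sq (mat_of x) = 2 * (gnorm z + gnorm w)"
      by (simp add: mat_norm_sq_def x(1) gnorm_def power2_eq_square algebra_simps)
    ultimately show ?thesis using x by (simp add: sl_sphere_def)
  qed
  show ?thesis
    by (rule bij_betw_byWitness[where f' = g]; use gm inv fwd in blast)
qed

lemma sum_Gamma_sphere:
  fixes F :: "(int ^ 2 ^ 2) set \<Rightarrow> real"
  shows "(\<Sum>A\<in>sl_sphere n. F {A, - A}) = 2 * (\<Sum>\<gamma>\<in>Gamma_sphere n. F \<gamma>)" and "finite (sl_sphere n)"
proof -
  let ?h = "\<lambda>A :: int ^ 2 ^ 2. {A, - A}"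
  have neg: "- A \<in> sl_sphere n" if "A \<in> sl_sphere n" for A
    using that by (simp add: sl_sphere_def det_2 mat_norm_sq_def)
  have neq: "A \<noteq> - A" if "A \<in> sl_sphere n" for A
  proof
    assume "A = - A"
    then have "A $ i $ j = - (A $ i $ j)" for i j by (metis vector_uminus_component)
    then have "A $ i $ j = 0" for i j by (metis neg_equal_zero)
    then show False using that by (simp add: sl_sphere_def det_2)
  qed
  have img: "?h ` sl_sphere n = Gamma_sphere n"
    by (auto simp: Gamma_sphere_def carrier_PSL2Z sl_sphere_def psl_norm_sq_coset image_iff)
  have fib: "{A \<in> sl_sphere n. ?h A = ?h B} = {B, - B}" if "B \<in> sl_sphere n" for B
    using that neg by (auto simp: doubleton_eq_iff)
  show fin: "finite (sl_sphere n)"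
  proof (rule finite_subset)
    show "sl_sphere n \<subseteq> \<Union> (Gamma_sphere n)" unfolding img[symmetric] by auto
    show "finite (\<Union> (Gamma_sphere n))" by (intro finite_Union finite_Gamma_sphere) (auto simp: img[symmetric])
  qed
  have "(\<Sum>A\<in>sl_sphere n. F (?h A)) = (\<Sum>\<gamma>\<in>?h ` sl_sphere n. \<Sum>A | A \<in> sl_sphere n \<and> ?h A = \<gamma>. F (?h A))"
    by (rule sum.image_gen[OF fin])
  also have "\<dots> = (\<Sum>\<gamma>\<in>Gamma_sphere n. 2 * F \<gamma>)"
  proof (rule sum.cong[OF img])
    fix \<gamma> assume "\<gamma> \<in> Gamma_sphere n"
    then have "\<gamma> \<in> ?h ` sl_sphere n" by (simp only: img)
    then obtain B where B: "B \<in> sl_sphere n" "\<gamma> = ?h B" by blast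
    have "(\<Sum>A | A \<in> sl_sphere n \<and> ?h A = \<gamma>. F (?h A)) = (\<Sum>A | A \<in> sl_sphere n \<and> ?h A = \<gamma>. F \<gamma>)"
      by (rule sum.cong) auto
    also have "\<dots> = 2 * F \<gamma>" unfolding B(2) fib[OF B(1)] using neq[OF B(1)] by simp
    finally show "(\<Sum>A | A \<in> sl_sphere n \<and> ?h A = \<gamma>. F (?h A)) = 2 * F \<gamma>" .
  qed
  finally show "(\<Sum>A\<in>sl_sphere n. F {A, - A}) = 2 * (\<Sum>\<gamma>\<in>Gamma_sphere n. F \<gamma>)" by (simp add: sum_distrib_left)
qed

lemma card_Gamma_sphere: "2 * card (Gamma_sphere (4 * M + 2)) = card (circ (M + 1)) * card (circ M)"
proof -
  have "real (card (sl_sphere (4 * M + 2))) = 2 * real (card (Gamma_sphere (4 * M + 2)))"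
    using sum_Gamma_sphere(1)[of "\<lambda>_. 1" "4 * M + 2"] by simp
  then have "2 * card (Gamma_sphere (4 * M + 2)) = card (sl_sphere (4 * M + 2))" by linarith
  also have "\<dots> = card (circ (M + 1) \<times> circ M)" by (rule bij_betw_same_card[OF bij_mat_of, symmetric])
  finally show ?thesis by (simp add: card_cartesian_product)
qed

text \<open>With z and w as in \<open>mat_of\<close>, the disc map sends the image of i to i conj(w) / conj(z).\<close>

lemma cis_hyp_angle:
  assumes "0 < M" "z \<in> circ (M + 1)" "w \<in> circ M"
  shows "cis (hyp_angle {mat_of (z, w), - mat_of (z, w)}) = dir (gI * gcnj w) * dir z"
proof -
  define Z W where "Z = emb z" and "W = emb w"
  have nz: "z \<noteq> 0" "w \<noteq> 0" using assms circ_nonzero[of "M + 1" z] circ_nonzero[of M w] by auto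
  then have ZW: "Z \<noteq> 0" "W \<noteq> 0" by (simp_all add: Z_def W_def)
  define a b c d where "a = (of_int (gRe z + gRe w) :: complex)" and "b = (of_int (gIm z + gIm w) :: complex)"
    and "c = (of_int (gIm w - gIm z) :: complex)" and "d = (of_int (gRe z - gRe w) :: complex)"
  have num: "(a * \<i> + b) - \<i> * (c * \<i> + d) = 2 * (\<i> * cnj W)"
    by (simp add: complex_eq_iff a_def b_def c_def d_def W_def emb_def)
  have den: "(c * \<i> + d) - \<i> * (a * \<i> + b) = 2 * cnj Z"
    by (simp add: complex_eq_iff a_def b_def c_def d_def Z_def emb_def)
  have D: "c * \<i> + d \<noteq> 0"
  proof
    assume "c * \<i> + d = 0"
    then have "real_of_int (gIm w - gIm z) = 0" "real_of_int (gRe z - gRe w) = 0"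
      by (simp_all add: complex_eq_iff c_def d_def)
    then have "gnorm z = gnorm w" by (simp add: gnorm_def)
    then show False using assms by (simp add: circ_def)
  qed
  have "disc_map ((a * \<i> + b) / (c * \<i> + d)) = ((a * \<i> + b) - \<i> * (c * \<i> + d)) / ((c * \<i> + d) - \<i> * (a * \<i> + b))"
    using D by (simp add: disc_map_def divide_simps)
  also have "\<dots> = \<i> * cnj W / cnj Z" unfolding num den by simp
  also have "\<dots> = (\<i> * cnj W * Z) / (Z * cnj Z)" using ZW by (simp add: field_simps)
  also have "Z * cnj Z = of_real ((cmod Z)\<^sup>2)" by (simp only: complex_norm_square)
  finally have disc: "disc_map ((a * \<i> + b) / (c * \<i> + d)) = (\<i> * cnj W * Z) / of_real ((cmod Z)\<^sup>2)" .
  have "sgn ((\<i> * cnj W * Z) / of_real ((cmod Z)\<^sup>2)) = sgn (\<i> * cnj W * Z)"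
  proof -
    have "sgn (of_real ((cmod Z)\<^sup>2) :: complex) = 1" 
    proof -
      have "0 < (cmod Z)\<^sup>2" using ZW by simp
      then show ?thesis by (simp only: sgn_of_real sgn_pos of_real_1)
    qed
    then show ?thesis by (simp only: sgn_divide div_by_1)
  qed
  moreover have "disc_map ((a * \<i> + b) / (c * \<i> + d)) \<noteq> 0" unfolding disc using ZW by simp
  then have "cis (Arg (disc_map ((a * \<i> + b) / (c * \<i> + d)))) = sgn (disc_map ((a * \<i> + b) / (c * \<i> + d)))"
    by (rule cis_Arg)
  ultimately have "cis (Arg (disc_map ((a * \<i> + b) / (c * \<i> + d)))) = sgn (\<i> * cnj W * Z)"
    by (simp only: disc)
  moreover have "sgn (\<i> * cnj W * Z) = dir (gI * gcnj w) * dir z"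
  proof -
    have "dir (gI * gcnj w) * dir z = dir (gI * gcnj w * z)" by simp
    then show ?thesis by (simp only: dir_def emb_simps Z_def W_def)
  qed
  moreover have "hyp_angle {mat_of (z, w), - mat_of (z, w)} = Arg (disc_map ((a * \<i> + b) / (c * \<i> + d)))"
    by (simp add: hyp_angle_def psl_moebius_coset mat_moebius_def a_def b_def c_def d_def)
  ultimately show ?thesis by simp
qed

text \<open>The map w |-> i conj(w) permutes the circle, so the factor i and the conjugation disappear in the sum.\<close>

lemma integral_hyp_measure:
  fixes g :: "complex \<Rightarrow> real"
  assumes "0 < M" "continuous_on unit_circle g"
  shows "integral\<^sup>L (hyp_measure (4 * M + 2)) g
     = (\<Sum>z\<in>circ (M + 1). \<Sum>w\<in>circ M. g (dir w * dir z)) / (real (card (circ (M + 1))) * real (card (circ M)))"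
proof -
  let ?n = "4 * M + 2"
  define S where "S = (\<Sum>\<gamma>\<in>Gamma_sphere ?n. g (cis (hyp_angle \<gamma>)))"
  have "integral\<^sup>L (hyp_measure ?n) g = S / real (card (Gamma_sphere ?n))"
    unfolding hyp_measure_def S_def by (intro integral_uniform_distr finite_Gamma_sphere assms) auto
  also have "\<dots> = 2 * S / real (2 * card (Gamma_sphere ?n))" by simp
  also have "real (2 * card (Gamma_sphere ?n)) = real (card (circ (M + 1))) * real (card (circ M))"
    unfolding card_Gamma_sphere by simp
  also have "2 * S = (\<Sum>A\<in>sl_sphere ?n. g (cis (hyp_angle {A, - A})))"
    unfolding S_def by (rule sum_Gamma_sphere(1)[symmetric])
  also have "\<dots> = (\<Sum>x\<in>circ (M + 1) \<times> circ M. g (cis (hyp_angle {mat_of x, - mat_of x})))"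
    by (rule sum.reindex_bij_betw[OF bij_mat_of, symmetric])
  also have "\<dots> = (\<Sum>z\<in>circ (M + 1). \<Sum>w\<in>circ M. g (cis (hyp_angle {mat_of (z, w), - mat_of (z, w)})))"
    by (simp add: sum.cartesian_product case_prod_unfold)
  also have "\<dots> = (\<Sum>z\<in>circ (M + 1). \<Sum>w\<in>circ M. g (dir (gI * gcnj w) * dir z))"
    using assms(1) by (intro sum.cong refl arg_cong[of _ _ g] cis_hyp_angle)
  also have "\<dots> = (\<Sum>z\<in>circ (M + 1). \<Sum>w\<in>circ M. g (dir w * dir z))"
  proof (rule sum.cong[OF refl])
    fix z
    have "bij_betw (\<lambda>w. gI * gcnj w) (circ M) (circ M)"
      by (rule bij_betw_byWitness[where f' = "\<lambda>w. gI * gcnj w"]) (auto simp: gauss_eq_iff circ_def gnorm_mult)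
    then show "(\<Sum>w\<in>circ M. g (dir (gI * gcnj w) * dir z)) = (\<Sum>w\<in>circ M. g (dir w * dir z))"
      by (rule sum.reindex_bij_betw)
  qed
  finally show ?thesis .
qed

section \<open>Hyperbolic measures close to a given Euclidean one\<close>

lemma card_circ_ge_4:
  assumes "0 < n" "circ n \<noteq> {}"
  shows "4 \<le> card (circ n)"
proof -
  obtain z where z: "z \<in> circ n" using assms by auto
  then have "(*) z ` circ 1 \<subseteq> circ n" by (auto simp: circ_def gnorm_mult)
  then have "card ((*) z ` circ 1) \<le> card (circ n)" by (intro card_mono) auto
  then show ?thesis using card_circ_mult_image[OF circ_nonzero[OF assms(1) z], of 1] card_circ_1 by simp
qed

lemma dir_neq_1_if_prime:
  assumes "prime p" "gnorm d = int p"
  shows "dir d \<noteq> 1"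
proof
  assume "dir d = 1"
  then have "emb d = of_real (cmod (emb d))" by (metis dir_def sgn_eq mult_1 nonzero_divide_eq_eq sgn_0 zero_neq_one norm_eq_zero of_real_eq_0_iff)
  then have "Im (emb d) = 0" by (metis Im_complex_of_real)
  then have "gIm d = 0" by (simp add: emb_def)
  then have "int p = (gRe d)\<^sup>2" using assms(2) by (simp add: gnorm_def)
  then have "p = (nat \<bar>gRe d\<bar>)\<^sup>2" by (metis nat_int nat_power_eq abs_ge_zero power2_abs)
  then have "prime ((nat \<bar>gRe d\<bar>)\<^sup>2)" using assms(1) by simp
  then show False by (simp add: prime_power_iff)
qed

text \<open>The finitely many primes over divisors of s have directions different from 1, hence bounded away from 1.\<close>

lemma ex_gaussian_prime_avoiding:
  assumes "0 < e" "0 < s"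
  obtains d p where "prime p" "odd p" "gnorm d = int p" "cmod (dir d - 1) < e" "\<not> p dvd s"
proof -
  define Bad where "Bad = {d. gnorm d \<le> int s \<and> dir d \<noteq> 1}"
  have "finite Bad"
  proof (rule finite_subset)
    show "Bad \<subseteq> (\<Union>n\<le>s. circ n)"
    proof
      fix d assume "d \<in> Bad"
      then have "d \<in> circ (nat (gnorm d))" "nat (gnorm d) \<le> s" by (auto simp: Bad_def circ_def)
      then show "d \<in> (\<Union>n\<le>s. circ n)" by blast
    qed
  qed simp
  define e' where "e' = Min (insert e ((\<lambda>d. cmod (dir d - 1)) ` Bad))"
  have e': "0 < e'" unfolding e'_def using \<open>finite Bad\<close> assms(1) by (subst Min_gr_iff) (auto simp: Bad_def)
  obtain d p where d: "prime p" "odd p" "gnorm d = int p" "cmod (dir d - 1) < e'"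
    using gaussian_primes_near_axis[OF e'] by blast
  have "e' \<le> e" unfolding e'_def using \<open>finite Bad\<close> by (intro Min_le) auto
  moreover have "\<not> p dvd s"
  proof
    assume "p dvd s"
    then have "p \<le> s" using assms(2) by (rule dvd_imp_le)
    then have "d \<in> Bad" using d dir_neq_1_if_prime by (auto simp: Bad_def)
    then have "e' \<le> cmod (dir d - 1)" unfolding e'_def using \<open>finite Bad\<close> by (intro Min_le) auto
    then show False using d by simp
  qed
  ultimately show ?thesis using that d by fastforce
qed

lemma cmod_power_minus_1_le: "cmod a = 1 \<Longrightarrow> cmod (a ^ n - 1) \<le> real n * cmod (a - 1)"
  using norm_power_diff[of a 1 n] by simp

lemma dir_prime_power_near_unit:
  assumes "prime p" "gnorm d = int p" "q \<in> circ (p ^ k)"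
  obtains u t where "gnorm u = 1" "dir q = dir u * t" "cmod t = 1" "cmod (t - 1) \<le> real k * cmod (dir d - 1)"
proof -
  obtain u j where u: "gnorm u = 1" "j \<le> k" "q = u * d ^ j * gcnj d ^ (k - j)"
    using circ_prime_power_form[OF assms] by blast
  have d0: "d \<noteq> 0" using assms(1,2) prime_gt_0_nat[of p] by auto
  define a where "a = dir d"
  have a: "cmod a = 1" using norm_dir[OF d0] by (simp add: a_def)
  define t where "t = a ^ j * cnj a ^ (k - j)"
  have "dir q = dir u * t" by (simp add: u(3) t_def a_def dir_power mult.assoc)
  moreover have "cmod t = 1" by (simp add: t_def norm_mult norm_power a)
  moreover have "cmod (t - 1) \<le> real k * cmod (a - 1)"
  proof -
    have e: "t - 1 = (a ^ j - 1) * cnj a ^ (k - j) + (cnj a ^ (k - j) - 1)" by (simp add: t_def algebra_simps)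
    have "cmod (t - 1) \<le> cmod ((a ^ j - 1) * cnj a ^ (k - j)) + cmod (cnj a ^ (k - j) - 1)"
      unfolding e by (rule norm_triangle_ineq)
    also have "cmod ((a ^ j - 1) * cnj a ^ (k - j)) = cmod (a ^ j - 1) * 1" by (simp add: norm_mult norm_power a)
    also have "cmod (a ^ j - 1) * 1 + cmod (cnj a ^ (k - j) - 1) \<le> real j * cmod (a - 1) * 1 + real (k - j) * cmod (cnj a - 1)"
      using cmod_power_minus_1_le[of a j] cmod_power_minus_1_le[of "cnj a" "k - j"] a by simp
    also have "cmod (cnj a - 1) = cmod (a - 1)" by (metis complex_cnj_diff complex_cnj_one complex_mod_cnj)
    also have "real j * cmod (a - 1) * 1 + real (k - j) * cmod (a - 1) = (real j + real (k - j)) * cmod (a - 1)"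
      by (simp add: algebra_simps)
    also have "real j + real (k - j) = real k" using u(2) by simp
    finally show ?thesis .
  qed
  ultimately show ?thesis using that[OF u(1), of t] unfolding a_def by blast
qed

lemma abs_avg_diff_le:
  fixes f g :: "'a \<Rightarrow> real"
  assumes "finite T" "T \<noteq> {}" "\<And>x. x \<in> T \<Longrightarrow> \<bar>f x - g x\<bar> \<le> \<eta>"
  shows "\<bar>sum f T / real (card T) - sum g T / real (card T)\<bar> \<le> \<eta>"
proof -
  have c: "0 < real (card T)" using assms by (simp add: card_gt_0_iff)
  have "\<bar>sum f T - sum g T\<bar> \<le> (\<Sum>x\<in>T. \<bar>f x - g x\<bar>)"
    unfolding sum_subtractf[symmetric] by (rule sum_abs)
  also have "\<dots> \<le> (\<Sum>x\<in>T. \<eta>)" by (intro sum_mono assms)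
  finally have "\<bar>sum f T - sum g T\<bar> \<le> real (card T) * \<eta>" by simp
  then show ?thesis using c by (simp add: diff_divide_distrib[symmetric] abs_div field_simps)
qed

lemma sum_circ_unit_shift: "gnorm u = 1 \<Longrightarrow> (\<Sum>y\<in>circ s. H (dir y * dir u)) = (\<Sum>y\<in>circ s. H (dir y))"
proof -
  assume u: "gnorm u = 1"
  then have uu: "u * gcnj u = 1" by (simp add: mult_gcnj)
  have "bij_betw (\<lambda>y. y * u) (circ s) (circ s)"
    by (rule bij_betw_byWitness[where f' = "\<lambda>y. y * gcnj u"])
      (use u uu in \<open>auto simp: circ_def gnorm_mult mult.assoc mult.commute[of "gcnj u" u]\<close>)
  then have "(\<Sum>y\<in>circ s. H (dir (y * u))) = (\<Sum>y\<in>circ s. H (dir y))" by (rule sum.reindex_bij_betw)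
  then show ?thesis by simp
qed

text \<open>Here M = m1 u, where the circle of m = s p^i is a rotation of that of the primitive norm m1, and p is the norm
of a Gaussian prime of very small argument. Up to units, a direction from the circle of p^i differs from 1
by at most 1 / (i + 1), and the units are absorbed by the symmetry of the circle of s. The points Y are the
products of the rotation with a direction from the circle of u and one from the circle of M + 1.\<close>

lemma hyp_measure_approx:
  assumes K: "\<And>w m. gnorm w = int m \<Longrightarrow> primitive w \<Longrightarrow> odd m \<Longrightarrow>
     (\<exists>u>0. coprime m u \<and> circ u \<noteq> {} \<and> circ (m * u + 1) \<noteq> {}
        \<and> card (circ u) \<le> K \<and> card (circ (m * u + 1)) \<le> K)"
    and s: "0 < s" "circ s \<noteq> {}"
  shows "\<exists>M \<kappa> Y. 0 < M \<and> 1 \<le> \<kappa> \<and> \<kappa> \<le> K * K \<and> (\<forall>j. Y j \<in> unit_circle) \<and> i < card (Gamma_sphere (4 * M + 2)) \<and>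
     (\<forall>g :: complex \<Rightarrow> real. \<forall>\<eta>. continuous_on unit_circle g \<longrightarrow>
        (\<forall>x\<in>unit_circle. \<forall>y\<in>unit_circle. cmod (x - y) \<le> 1 / real (Suc i) \<longrightarrow> \<bar>g x - g y\<bar> \<le> \<eta>) \<longrightarrow>
        \<bar>integral\<^sup>L (hyp_measure (4 * M + 2)) g
          - (\<Sum>j<\<kappa>. integral\<^sup>L (euc_measure s) (\<lambda>x. g (x * Y j))) / real \<kappa>\<bar> \<le> \<eta>)"
proof -
  have "0 < 1 / (real (Suc i) * real (Suc i))" by simp
  then obtain d p where d: "prime p" "odd p" "gnorm d = int p"
      "cmod (dir d - 1) < 1 / (real (Suc i) * real (Suc i))" "\<not> p dvd s"
    by (rule ex_gaussian_prime_avoiding[OF _ s(1)])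
  have p0: "0 < p" using d(1) prime_gt_0_nat by blast
  define P where "P = p ^ i"
  define m where "m = s * P"
  have P0: "0 < P" using p0 by (simp add: P_def)
  have m0: "0 < m" using s P0 by (simp add: m_def)
  have cop: "coprime s P" using d(1,5) prime_imp_coprime[of p s] by (simp add: P_def coprime_commute)
  have cP: "i < card (circ P)" using card_circ_prime_power_ge[OF d(1,2,3)] by (simp add: P_def)
  then have cP0: "circ P \<noteq> {}" by auto
  have "circ m \<noteq> {}"
  proof -
    obtain a b where "a \<in> circ s" "b \<in> circ P" using s(2) cP0 by blast
    then have "a * b \<in> circ m" by (simp add: circ_def gnorm_mult m_def)
    then show ?thesis by blast
  qed
  from circ_eq_mult_primitive_circ[OF m0 this] obtain m1 w c where
    m1: "odd m1" "gnorm w = int m1" "primitive w" "c \<noteq> 0" "circ m = (*) c ` circ m1" by blast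
  have m10: "0 < m1" using m1(1) by (cases m1) auto
  from K[OF m1(2,3,1)] obtain u where u: "0 < u" "coprime m1 u" "circ u \<noteq> {}" "circ (m1 * u + 1) \<noteq> {}"
      "card (circ u) \<le> K" "card (circ (m1 * u + 1)) \<le> K" by blast
  define M where "M = m1 * u"
  have M0: "0 < M" using m10 u(1) by (simp add: M_def)
  let ?S = "circ s" and ?P = "circ P" and ?U = "circ u" and ?N = "circ (M + 1)"
  have N0: "?N \<noteq> {}" using u(4) by (simp add: M_def)
  define lam where "lam = cnj (dir c)"
  have lam: "cmod lam = 1" using norm_dir[OF m1(4)] by (simp add: lam_def)
  have lam1: "lam * dir c = 1"
    using norm_dir[OF m1(4)] by (simp add: lam_def complex_norm_square[symmetric] mult.commute)
  \<comment> \<open>16 = 4 * 4 for the two factorisations M = m1 u and m = s p^i, each unique up to the four units\<close>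
  have sum_M: "(\<Sum>x\<in>circ M. H (dir x)) = (\<Sum>v\<in>?U. \<Sum>q\<in>?P. \<Sum>y\<in>?S. H (lam * dir y * dir q * dir v)) / 16"
    for H :: "complex \<Rightarrow> real"
  proof -
    have "4 * (\<Sum>x\<in>circ M. H (dir x)) = (\<Sum>x\<in>circ m1. \<Sum>v\<in>?U. H (dir x * dir v))"
      unfolding M_def using sum_circ_mult[OF u(2) m10 u(1), of "\<lambda>x. H (dir x)"] by simp
    also have "\<dots> = (\<Sum>v\<in>?U. \<Sum>x\<in>circ m1. H (dir x * dir v))" by (rule sum.swap)
    also have "\<dots> = (\<Sum>v\<in>?U. \<Sum>x\<in>circ m. H (lam * dir x * dir v))"
    proof (rule sum.cong[OF refl])
      fix v
      have "(\<Sum>x\<in>circ m. H (lam * dir x * dir v)) = (\<Sum>x\<in>circ m1. H (lam * dir (c * x) * dir v))"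
        unfolding m1(5) using inj_on_gauss_mult[OF m1(4)] by (simp add: sum.reindex)
      also have "\<dots> = (\<Sum>x\<in>circ m1. H (dir x * dir v))"
        using lam1 by (simp add: mult.assoc[symmetric])
      finally show "(\<Sum>x\<in>circ m1. H (dir x * dir v)) = (\<Sum>x\<in>circ m. H (lam * dir x * dir v))" by simp
    qed
    finally have 1: "4 * (\<Sum>x\<in>circ M. H (dir x)) = (\<Sum>v\<in>?U. \<Sum>x\<in>circ m. H (lam * dir x * dir v))" .
    have 2: "4 * (\<Sum>x\<in>circ m. H (lam * dir x * dir v)) = (\<Sum>q\<in>?P. \<Sum>y\<in>?S. H (lam * dir y * dir q * dir v))" for v
    proof -
      have "4 * (\<Sum>x\<in>circ m. H (lam * dir x * dir v)) = (\<Sum>y\<in>?S. \<Sum>q\<in>?P. H (lam * dir y * dir q * dir v))"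
        unfolding m_def using sum_circ_mult[OF cop s(1) P0, of "\<lambda>x. H (lam * dir x * dir v)"]
        by (simp add: mult.assoc)
      also have "\<dots> = (\<Sum>q\<in>?P. \<Sum>y\<in>?S. H (lam * dir y * dir q * dir v))" by (rule sum.swap)
      finally show ?thesis .
    qed
    have "16 * (\<Sum>x\<in>circ M. H (dir x)) = (\<Sum>v\<in>?U. 4 * (\<Sum>x\<in>circ m. H (lam * dir x * dir v)))"
      using 1 by (simp add: sum_distrib_left[symmetric])
    then show ?thesis unfolding 2 by simp
  qed
  have card_M: "real (card (circ M)) = real (card ?U) * (real (card ?P) * real (card ?S)) / 16"
    using sum_M[of "\<lambda>_. 1"] by simp
  have pos: "0 < card ?S" "0 < card ?P" "0 < card ?U" "0 < card ?N"
    using s cP0 u N0 by (simp_all add: card_gt_0_iff)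
  define T where "T = ?N \<times> ?U"
  define W where "W = (\<lambda>(z, v). lam * dir v * dir z)"
  have T: "finite T" "T \<noteq> {}" "card T = card ?N * card ?U" using N0 u by (simp_all add: T_def card_cartesian_product)
  have Wc: "W x \<in> unit_circle" if "x \<in> T" for x
    using that lam norm_dir circ_nonzero[of "M + 1"] circ_nonzero[OF u(1)] by (auto simp: T_def W_def norm_mult)
  define \<kappa> where "\<kappa> = card T"
  obtain b where b: "bij_betw b {..<\<kappa>} T"
    using ex_bij_betw_nat_finite[OF T(1)] unfolding \<kappa>_def lessThan_atLeast0 by blast
  define Y where "Y j = (if j < \<kappa> then W (b j) else 1)" for j
  have "1 \<le> \<kappa>" unfolding \<kappa>_def T(3) using pos by simp
  moreover have "\<kappa> \<le> K * K" unfolding \<kappa>_def T(3) using u(5,6) by (intro mult_mono) (simp_all add: M_def)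
  moreover have "Y j \<in> unit_circle" for j
    using Wc bij_betwE[OF b] by (auto simp: Y_def)
  moreover have "i < card (Gamma_sphere (4 * M + 2))"
  proof -
    have g4: "4 \<le> card ?S" "4 \<le> card ?U" "4 \<le> card ?N" using card_circ_ge_4 s u N0 by auto
    have "4 * 4 * real (Suc i) \<le> real (card ?U) * real (card ?S) * real (card ?P)"
      using g4 cP by (intro mult_mono) auto
    then have "real (Suc i) \<le> real (card (circ M))" unfolding card_M by (simp add: mult_ac)
    then have "Suc i \<le> card (circ M)" by (simp only: of_nat_le_iff)
    moreover have "4 * card (circ M) \<le> card ?N * card (circ M)" using g4 by (intro mult_right_mono) auto
    ultimately show ?thesis using card_Gamma_sphere[of M] by linarith
  qed
  moreover have "\<bar>integral\<^sup>L (hyp_measure (4 * M + 2)) g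
          - (\<Sum>j<\<kappa>. integral\<^sup>L (euc_measure s) (\<lambda>x. g (x * Y j))) / real \<kappa>\<bar> \<le> \<eta>"
    if g: "continuous_on unit_circle g"
      and osc: "\<forall>x\<in>unit_circle. \<forall>y\<in>unit_circle. cmod (x - y) \<le> 1 / real (Suc i) \<longrightarrow> \<bar>g x - g y\<bar> \<le> \<eta>"
    for g :: "complex \<Rightarrow> real" and \<eta>
  proof -
    define A where "A x = (\<Sum>q\<in>?P. (\<Sum>y\<in>?S. g (dir y * dir q * W x)) / real (card ?S)) / real (card ?P)" for x
    define B where "B x = (\<Sum>y\<in>?S. g (dir y * W x)) / real (card ?S)" for x
    have "integral\<^sup>L (hyp_measure (4 * M + 2)) g
       = (\<Sum>z\<in>?N. \<Sum>w\<in>circ M. g (dir w * dir z)) / (real (card ?N) * real (card (circ M)))"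
      by (rule integral_hyp_measure[OF M0 g])
    also have "(\<Sum>z\<in>?N. \<Sum>w\<in>circ M. g (dir w * dir z))
       = (\<Sum>z\<in>?N. (\<Sum>v\<in>?U. \<Sum>q\<in>?P. \<Sum>y\<in>?S. g (lam * dir y * dir q * dir v * dir z)) / 16)"
      by (intro sum.cong refl sum_M)
    also have "\<dots> = (\<Sum>x\<in>T. \<Sum>q\<in>?P. \<Sum>y\<in>?S. g (dir y * dir q * W x)) / 16"
      unfolding T_def W_def by (simp add: sum.cartesian_product' sum_divide_distrib[symmetric] mult_ac)
    also have "(\<Sum>x\<in>T. \<Sum>q\<in>?P. \<Sum>y\<in>?S. g (dir y * dir q * W x)) / 16 / (real (card ?N) * real (card (circ M)))
       = (\<Sum>x\<in>T. A x) / real (card T)"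
      unfolding A_def card_M T(3) sum_divide_distrib[symmetric] using pos by simp
    finally have hyp: "integral\<^sup>L (hyp_measure (4 * M + 2)) g = (\<Sum>x\<in>T. A x) / real (card T)" .
    have "integral\<^sup>L (euc_measure s) (\<lambda>x. g (x * Y j)) = B (b j)" if "j < \<kappa>" for j
    proof -
      have "W (b j) \<in> unit_circle" using that bij_betwE[OF b] Wc by auto
      then have "continuous_on unit_circle (\<lambda>x. g (x * W (b j)))"
        by (intro continuous_on_compose2[OF g] continuous_intros) (auto simp: norm_mult)
      then show ?thesis using that s(1) by (simp add: Y_def integral_euc_measure B_def)
    qed
    then have "(\<Sum>j<\<kappa>. integral\<^sup>L (euc_measure s) (\<lambda>x. g (x * Y j))) = (\<Sum>j<\<kappa>. B (b j))"
      by (intro sum.cong) auto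
    also have "\<dots> = (\<Sum>x\<in>T. B x)" by (rule sum.reindex_bij_betw[OF b])
    finally have euc: "(\<Sum>j<\<kappa>. integral\<^sup>L (euc_measure s) (\<lambda>x. g (x * Y j))) / real \<kappa> = (\<Sum>x\<in>T. B x) / real (card T)"
      by (simp add: \<kappa>_def)
    have "\<bar>A x - B x\<bar> \<le> \<eta>" if x: "x \<in> T" for x
    proof -
      have r0: "real (card ?P) \<noteq> 0" using pos(2) by linarith
      have "(\<Sum>q\<in>?P. B x) = real (card ?P) * B x" by (rule sum_constant)
      then have Bq: "B x = (\<Sum>q\<in>?P. B x) / real (card ?P)" by (simp only: nonzero_mult_div_cancel_left[OF r0])
      have "\<bar>A x - (\<Sum>q\<in>?P. B x) / real (card ?P)\<bar> \<le> \<eta>" unfolding A_def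
      proof (rule abs_avg_diff_le)
        fix q assume q: "q \<in> ?P"
        obtain e t where e: "gnorm e = 1" "dir q = dir e * t" "cmod t = 1" "cmod (t - 1) \<le> real i * cmod (dir d - 1)"
          by (rule dir_prime_power_near_unit[OF d(1,3), of q i]) (use q in \<open>auto simp: P_def\<close>)
        have "real i * cmod (dir d - 1) \<le> real (Suc i) * (1 / (real (Suc i) * real (Suc i)))"
          using d(4) by (intro mult_mono) auto
        then have t1: "cmod (t - 1) \<le> 1 / real (Suc i)" using e(4) by simp
        have "(\<Sum>y\<in>?S. g (dir y * dir q * W x)) = (\<Sum>y\<in>?S. g (dir y * dir e * t * W x))"
          by (simp add: e(2) mult.assoc)
        also have "\<dots> = (\<Sum>y\<in>?S. g (dir y * t * W x))" by (rule sum_circ_unit_shift[OF e(1)])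
        finally have shift: "(\<Sum>y\<in>?S. g (dir y * dir q * W x)) = (\<Sum>y\<in>?S. g (dir y * t * W x))" .
        show "\<bar>(\<Sum>y\<in>?S. g (dir y * dir q * W x)) / real (card ?S) - B x\<bar> \<le> \<eta>"
          unfolding shift B_def
        proof (rule abs_avg_diff_le)
          fix y assume "y \<in> ?S"
          then have y: "cmod (dir y) = 1" using s circ_nonzero norm_dir by blast
          have wx: "cmod (W x) = 1" using Wc[OF x] by simp
          have "dir y * t * W x - dir y * W x = dir y * (t - 1) * W x" by (simp add: algebra_simps)
          then have "cmod (dir y * t * W x - dir y * W x) = cmod (t - 1)" by (simp only: norm_mult y wx)
          then have "cmod (dir y * t * W x - dir y * W x) \<le> 1 / real (Suc i)" using t1 by simp
          moreover have "dir y * t * W x \<in> unit_circle" "dir y * W x \<in> unit_circle" using y wx e(3) by (simp_all add: norm_mult)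
          ultimately show "\<bar>g (dir y * t * W x) - g (dir y * W x)\<bar> \<le> \<eta>" using osc by blast
        qed (use s in auto)
      qed (use cP0 in auto)
      then show ?thesis unfolding Bq[symmetric] .
    qed
    then show ?thesis unfolding hyp euc by (intro abs_avg_diff_le T)
  qed
  ultimately show ?thesis using M0 by blast
qed

section \<open>Passage to the limit\<close>

lemma continuous_on_coordinate: "continuous_on UNIV (\<lambda>x :: nat \<Rightarrow> complex. x j)" by (rule continuous_on_product_coordinates)
lemma tendsto_coordinate: fixes G :: "nat \<Rightarrow> nat \<Rightarrow> complex" assumes "G \<longlonglongrightarrow> l" shows "(\<lambda>i. G i j) \<longlonglongrightarrow> l j"
  using continuous_on_tendsto_compose[of UNIV "\<lambda>x. x j" G l sequentially] continuous_on_coordinate assms by (simp del: tendsto_iff)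
lemma seq_compact_PiE: fixes S :: "nat \<Rightarrow> complex set" assumes "\<And>j. compact (S j)" shows "seq_compact (PiE UNIV S)"
proof -
  have "compactin (product_topology (\<lambda>_. euclidean) UNIV) (PiE UNIV S)"
    unfolding compactin_PiE using assms by simp
  then have "compact (PiE UNIV S)" unfolding euclidean_product_topology by simp
  then show ?thesis by (rule compact_imp_seq_compact)
qed
text \<open>Tychonoff's theorem for countably many compact sets in the plane, whose product is metrisable.\<close>

lemma compact_sequences_converge:
  fixes F :: "nat \<Rightarrow> nat \<Rightarrow> complex"
  assumes "\<And>j. compact (S j)" "\<And>i j. F i j \<in> S j"
  shows "\<exists>r l. strict_mono (r :: nat \<Rightarrow> nat) \<and> (\<forall>j. l j \<in> S j) \<and> (\<forall>j. (\<lambda>i. F (r i) j) \<longlonglongrightarrow> l j)"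
proof -
  have "\<forall>i. F i \<in> PiE UNIV S" using assms(2) by (simp add: PiE_iff)
  then have "\<exists>l\<in>PiE UNIV S. \<exists>r. strict_mono r \<and> (F \<circ> r) \<longlonglongrightarrow> l"
    using seq_compact_PiE[of S, OF assms(1)] unfolding seq_compact_def by (elim allE[of _ F] impE)
  then obtain l r where l: "l \<in> PiE UNIV S" and r: "strict_mono (r :: nat \<Rightarrow> nat)" "(F \<circ> r) \<longlonglongrightarrow> l"
    by (elim bexE exE conjE)
  have "\<forall>j. (\<lambda>i. F (r i) j) \<longlonglongrightarrow> l j" using tendsto_coordinate[OF r(2)] by (simp add: comp_def)
  moreover have "\<forall>j. l j \<in> S j" using l by (simp add: PiE_iff)
  ultimately show ?thesis using r(1) by (intro exI conjI)
qed

lemma circle_prob_uniform_distr: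
  assumes "finite A" "A \<noteq> {}" "f ` A \<subseteq> unit_circle"
  shows "circle_prob (distr (uniform_count_measure A) circle_borel f)"
  unfolding circle_prob_def
  using assms by (auto intro!: prob_space.prob_space_distr prob_space_uniform_count_measure measurable_uniform_count)

lemma supported_uniform_distr:
  assumes "finite A" "f ` A \<subseteq> unit_circle" "card A \<le> k"
  shows "supported_on_at_most (distr (uniform_count_measure A) circle_borel f) k"
  unfolding supported_on_at_most_def
proof (intro exI[of _ "f ` A"] conjI assms)
  show "finite (f ` A)" using assms by simp
  show "card (f ` A) \<le> k" using card_image_le[OF assms(1), of f] assms(3) by simp
  have F: "f ` A \<in> sets circle_borel"
  proof -
    have "f ` A \<in> sets borel" using assms(1) by (intro borel_closed finite_imp_closed) simp
    then show ?thesis unfolding circle_borel_def using assms(2) by (auto simp: sets_restrict_space)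
  qed
  have D: "unit_circle - f ` A \<in> sets circle_borel" using sets.compl_sets[OF F] by simp
  have meas: "f \<in> measurable (uniform_count_measure A) circle_borel"
    by (rule measurable_uniform_count) (use assms in simp)
  have "f -` (unit_circle - f ` A) \<inter> space (uniform_count_measure A) = {}"
    by (auto simp: space_uniform_count_measure)
  then show "emeasure (distr (uniform_count_measure A) circle_borel f) (unit_circle - f ` A) = 0"
    by (simp only: emeasure_distr[OF meas D] emeasure_empty)
qed

lemma integral_circle_convolution:
  fixes g :: "complex \<Rightarrow> real"
  assumes \<nu>: "circle_prob \<nu>" and A: "finite A" "A \<noteq> {}" "f ` A \<subseteq> unit_circle" and g: "continuous_on unit_circle g"
  shows "integral\<^sup>L (circle_convolution \<nu> (distr (uniform_count_measure A) circle_borel f)) g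
       = (\<Sum>a\<in>A. integral\<^sup>L \<nu> (\<lambda>x. g (x * f a))) / real (card A)"
proof -
  define \<nu>' where "\<nu>' = distr (uniform_count_measure A) circle_borel f"
  interpret N: prob_space \<nu> using \<nu> by (simp add: circle_prob_def)
  interpret N': prob_space \<nu>' using circle_prob_uniform_distr[OF A] by (simp add: circle_prob_def \<nu>'_def)
  interpret NN: pair_prob_space \<nu> \<nu>' ..
  have sets: "sets \<nu> = sets circle_borel" "sets \<nu>' = sets circle_borel"
    using \<nu> by (simp_all add: circle_prob_def \<nu>'_def)
  have sp: "space \<nu> = unit_circle" "space \<nu>' = unit_circle"
    using sets_eq_imp_space_eq[OF sets(1)] sets_eq_imp_space_eq[OF sets(2)] by simp_all
  have id: "(\<lambda>x. x) \<in> measurable circle_borel borel" unfolding circle_borel_def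
    by (intro measurable_restrict_space1) simp
  have id': "(\<lambda>x. x) \<in> measurable \<nu> borel" "(\<lambda>x. x) \<in> measurable \<nu>' borel"
    using id measurable_cong_sets[OF sets(1) refl] measurable_cong_sets[OF sets(2) refl] by blast+
  have m1: "(\<lambda>p. fst p) \<in> borel_measurable (\<nu> \<Otimes>\<^sub>M \<nu>')" by (rule measurable_compose[OF measurable_fst id'(1)])
  have m2: "(\<lambda>p. snd p) \<in> borel_measurable (\<nu> \<Otimes>\<^sub>M \<nu>')" by (rule measurable_compose[OF measurable_snd id'(2)])
  have mult: "(\<lambda>(x, y). x * y) \<in> measurable (\<nu> \<Otimes>\<^sub>M \<nu>') circle_borel"
    unfolding circle_borel_def
  proof (rule measurable_restrict_space2)
    show "(\<lambda>(x, y). x * y) \<in> space (\<nu> \<Otimes>\<^sub>M \<nu>') \<rightarrow> unit_circle" by (auto simp: space_pair_measure sp norm_mult)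
    show "(\<lambda>(x, y). x * y) \<in> borel_measurable (\<nu> \<Otimes>\<^sub>M \<nu>')"
      using borel_measurable_times[OF m1 m2] by (simp add: case_prod_unfold)
  qed
  have gm: "g \<in> borel_measurable circle_borel" by (rule borel_measurable_circle[OF g])
  obtain b where b: "\<And>x. x \<in> unit_circle \<Longrightarrow> \<bar>g x\<bar> \<le> b"
  proof -
    have "compact (g ` unit_circle)" by (intro compact_continuous_image g) simp
    then have "bounded (g ` unit_circle)" by (rule compact_imp_bounded)
    then obtain a where "\<forall>z\<in>g ` unit_circle. norm z \<le> a" unfolding bounded_iff by blast
    then show ?thesis using that[of a] by auto
  qed
  have int: "integrable (\<nu> \<Otimes>\<^sub>M \<nu>') (\<lambda>(x, y). g (x * y))"
  proof (rule NN.integrable_const_bound[where B = b])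
    show "(\<lambda>(x, y). g (x * y)) \<in> borel_measurable (\<nu> \<Otimes>\<^sub>M \<nu>')"
      using measurable_compose[OF mult gm] by (simp add: case_prod_unfold)
    show "AE x in \<nu> \<Otimes>\<^sub>M \<nu>'. norm (case x of (x, y) \<Rightarrow> g (x * y)) \<le> b"
      by (rule AE_I2) (auto simp: space_pair_measure sp norm_mult intro!: b)
  qed
  have cont: "continuous_on unit_circle (\<lambda>x. g (x * y))" "continuous_on unit_circle (\<lambda>x. g (y * x))" if "y \<in> unit_circle" for y
    using that by (auto intro!: continuous_on_compose2[OF g] continuous_intros simp: norm_mult)
  have "integral\<^sup>L (circle_convolution \<nu> \<nu>') g = integral\<^sup>L (\<nu> \<Otimes>\<^sub>M \<nu>') (\<lambda>(x, y). g (x * y))"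
    unfolding circle_convolution_def using integral_distr[OF mult gm] by (simp add: case_prod_unfold)
  also have "\<dots> = (\<integral>x. (\<integral>y. g (x * y) \<partial>\<nu>') \<partial>\<nu>)" using NN.integral_fst'[OF int] by simp
  also have "\<dots> = (\<integral>x. (\<Sum>a\<in>A. g (x * f a)) / real (card A) \<partial>\<nu>)"
  proof (rule Bochner_Integration.integral_cong[OF refl])
    fix x assume "x \<in> space \<nu>"
    then have "x \<in> unit_circle" by (simp add: sp)
    then show "(\<integral>y. g (x * y) \<partial>\<nu>') = (\<Sum>a\<in>A. g (x * f a)) / real (card A)"
      unfolding \<nu>'_def by (intro integral_uniform_distr A cont)
  qed
  also have "\<dots> = (\<integral>x. (\<Sum>a\<in>A. g (x * f a)) \<partial>\<nu>) / real (card A)" by simp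
  also have "(\<integral>x. (\<Sum>a\<in>A. g (x * f a)) \<partial>\<nu>) = (\<Sum>a\<in>A. integral\<^sup>L \<nu> (\<lambda>x. g (x * f a)))"
  proof (rule Bochner_Integration.integral_sum)
    fix a assume "a \<in> A"
    then have fa: "f a \<in> unit_circle" using A(3) by auto
    show "integrable \<nu> (\<lambda>x. g (x * f a))"
    proof (rule N.integrable_const_bound[where B = b])
      show "(\<lambda>x. g (x * f a)) \<in> borel_measurable \<nu>"
        using borel_measurable_circle[OF cont(1)[OF fa]] measurable_cong_sets[OF sets(1) refl] by auto
      show "AE x in \<nu>. norm (g (x * f a)) \<le> b" using fa by (intro AE_I2) (auto simp: sp norm_mult intro!: b)
    qed
  qed
  finally show ?thesis by (simp add: \<nu>'_def)
qed

text \<open>The approximating measures involve points Y and their number. Both are encoded in one sequence of points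
of a product of compact sets, the number being the 0-th coordinate; it is eventually constant along a
convergent subsequence. The limits of the points, with equal weights, make up the second factor of the
convolution.\<close>

theorem theorem1p3:
  "\<exists>C::nat. C > 0 \<and>
     (\<forall>\<nu> :: complex measure. attainable \<nu> \<longrightarrow>
        (\<exists>(n :: nat \<Rightarrow> nat) (\<nu>' :: complex measure).
           (\<forall>i. n i \<in> hyp_radii \<and> n i > 2) \<and>
           filterlim n at_top sequentially \<and>
           circle_prob \<nu>' \<and> supported_on_at_most \<nu>' C \<and>
           circle_weak_conv (\<lambda>i. hyp_measure (n i)) (circle_convolution \<nu> \<nu>') \<and>
           filterlim (\<lambda>i. card (Gamma_sphere (n i))) at_top sequentially))"
proof -
  obtain K where K0: "0 < K" and K: "\<And>w m. gnorm w = int m \<Longrightarrow> primitive w \<Longrightarrow> odd m \<Longrightarrow>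
     (\<exists>u>0. coprime m u \<and> circ u \<noteq> {} \<and> circ (m * u + 1) \<noteq> {}
        \<and> card (circ u) \<le> K \<and> card (circ (m * u + 1)) \<le> K)"
    using almost_prime_neighbours by blast
  show ?thesis
  proof (rule exI[of _ "K * K"], intro conjI allI impI)
    show "0 < K * K" using K0 by simp
    fix \<nu> assume "attainable \<nu>"
    then obtain s where \<nu>: "circle_prob \<nu>" and s: "strict_mono s" "range s \<subseteq> sums_of_two_squares"
      and wk: "circle_weak_conv (\<lambda>k. euc_measure (s k)) \<nu>" by (auto simp: attainable_def)
    have s0: "0 < s i" "circ (s i) \<noteq> {}" for i
    proof -
      have "s i \<in> sums_of_two_squares" using s(2) by auto
      then obtain x y where xy: "0 < s i" "int (s i) = x\<^sup>2 + y\<^sup>2" by (auto simp: sums_of_two_squares_def)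
      then have "Gauss x y \<in> circ (s i)" by (simp add: circ_def gnorm_def)
      then show "0 < s i" "circ (s i) \<noteq> {}" using xy by auto
    qed
    define good where "good i M \<kappa> Y \<longleftrightarrow> 0 < M \<and> 1 \<le> \<kappa> \<and> \<kappa> \<le> K * K \<and> (\<forall>j. Y j \<in> unit_circle) \<and> i < card (Gamma_sphere (4 * M + 2)) \<and>
     (\<forall>g :: complex \<Rightarrow> real. \<forall>\<eta>. continuous_on unit_circle g \<longrightarrow>
        (\<forall>x\<in>unit_circle. \<forall>y\<in>unit_circle. cmod (x - y) \<le> 1 / real (Suc i) \<longrightarrow> \<bar>g x - g y\<bar> \<le> \<eta>) \<longrightarrow>
        \<bar>integral\<^sup>L (hyp_measure (4 * M + 2)) g
          - (\<Sum>j<\<kappa>. integral\<^sup>L (euc_measure (s i)) (\<lambda>x. g (x * Y j))) / real \<kappa>\<bar> \<le> \<eta>)"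
      for i M \<kappa> and Y :: "nat \<Rightarrow> complex"
    have "\<forall>i. \<exists>M \<kappa> Y. good i M \<kappa> Y"
      unfolding good_def by (intro allI hyp_measure_approx[OF K s0])
    then obtain M where "\<forall>i. \<exists>\<kappa> Y. good i (M i) \<kappa> Y" by (rule choice[THEN exE])
    then obtain \<kappa> where "\<forall>i. \<exists>Y. good i (M i) (\<kappa> i) Y" by (rule choice[THEN exE])
    then obtain Y where "\<forall>i. good i (M i) (\<kappa> i) (Y i)" by (rule choice[THEN exE])
    then have good: "\<And>i. good i (M i) (\<kappa> i) (Y i)" by (rule spec)
    define F where "F i j = (case j of 0 \<Rightarrow> of_nat (\<kappa> i) | Suc j' \<Rightarrow> Y i j')" for i j
    define S where "S j = (case j of 0 \<Rightarrow> of_nat ` {1..K * K} | Suc j' \<Rightarrow> unit_circle)" for j :: nat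
    have S: "compact (S j)" for j by (auto simp: S_def finite_imp_compact split: nat.split)
    have F: "F i j \<in> S j" for i j using good[of i] by (auto simp: F_def S_def good_def split: nat.split)
    have "\<exists>r l. strict_mono (r :: nat \<Rightarrow> nat) \<and> (\<forall>j. l j \<in> S j) \<and> (\<forall>j. (\<lambda>i. F (r i) j) \<longlonglongrightarrow> l j)"
      by (rule compact_sequences_converge[of S F, OF S F])
    then obtain r l where r: "strict_mono (r :: nat \<Rightarrow> nat)"
      and l: "\<forall>j. l j \<in> S j" "\<forall>j. (\<lambda>i. F (r i) j) \<longlonglongrightarrow> l j" by (elim exE conjE)
    obtain k where k: "1 \<le> k" "k \<le> K * K" "l 0 = of_nat k" using l(1)[rule_format, of 0] by (auto simp: S_def)
    define y where "y j = l (Suc j)" for j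
    have yc: "y j \<in> unit_circle" for j using l(1)[rule_format, of "Suc j"] by (simp add: y_def S_def)
    have Ylim: "(\<lambda>i. Y (r i) j) \<longlonglongrightarrow> y j" for j using l(2)[rule_format, of "Suc j"] by (simp add: y_def F_def)
    have ev_k: "\<forall>\<^sub>F i in sequentially. \<kappa> (r i) = k"
    proof -
      have "(\<lambda>i. of_nat (\<kappa> (r i)) :: complex) \<longlonglongrightarrow> of_nat k" using l(2)[rule_format, of 0] k(3) by (simp add: F_def)
      then have "\<forall>\<^sub>F i in sequentially. dist (of_nat (\<kappa> (r i)) :: complex) (of_nat k) < 1" by (rule tendstoD) simp
      then show ?thesis
      proof eventually_elim
        case (elim i)
        have "dist (of_nat (\<kappa> (r i)) :: complex) (of_nat k) = \<bar>real (\<kappa> (r i)) - real k\<bar>"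
          by (metis dist_norm norm_of_real of_real_diff of_real_of_nat_eq)
        then show ?case using elim by linarith
      qed
    qed
    define n where "n i = 4 * M (r i) + 2" for i
    define \<nu>' where "\<nu>' = distr (uniform_count_measure {..<k}) circle_borel y"
    have A: "finite {..<k}" "{..<k} \<noteq> {}" "y ` {..<k} \<subseteq> unit_circle"
    proof -
      have "0 \<in> {..<k}" using k(1) by simp
      then show "{..<k} \<noteq> {}" by blast
    qed (use yc in auto)
    have ri: "i \<le> r i" for i using r by (rule seq_suble)
    have card_ge: "i < card (Gamma_sphere (n i))" for i
      using good[of "r i"] ri[of i] by (auto simp: good_def n_def)
    have card_top: "filterlim (\<lambda>i. card (Gamma_sphere (n i))) at_top sequentially"
      by (rule filterlim_at_top_mono[OF filterlim_ident]) (simp add: card_ge less_imp_le)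
    have n_top: "filterlim n at_top sequentially"
      unfolding filterlim_at_top
    proof
      fix B
      define c where "c = Max ((\<lambda>n. card (Gamma_sphere n)) ` {..B})"
      have "\<forall>\<^sub>F i in sequentially. Suc c \<le> i" by (rule eventually_ge_at_top)
      then show "\<forall>\<^sub>F i in sequentially. B \<le> n i"
      proof eventually_elim
        case (elim i)
        show ?case
        proof (rule ccontr)
          assume "\<not> B \<le> n i"
          then have "card (Gamma_sphere (n i)) \<le> c" unfolding c_def by (intro Max_ge) auto
          then show False using card_ge[of i] elim by simp
        qed
      qed
    qed
    have rad: "n i \<in> hyp_radii \<and> 2 < n i" for i
    proof -
      have g: "0 < M (r i)" using good[of "r i"] by (simp add: good_def)
      moreover have "0 < card (Gamma_sphere (n i))" using card_ge[of i] by simp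
      ultimately show ?thesis by (simp add: hyp_radii_def n_def)
    qed
    have conv: "circle_weak_conv (\<lambda>i. hyp_measure (n i)) (circle_convolution \<nu> \<nu>')"
      unfolding circle_weak_conv_def
    proof (intro allI impI)
      fix g :: "complex \<Rightarrow> real" assume g: "continuous_on unit_circle g"
      define a where "a i = integral\<^sup>L (hyp_measure (n i)) g" for i
      define e where "e i z = integral\<^sup>L (euc_measure (s (r i))) (\<lambda>x. g (x * z))" for i z
      define L where "L = (\<Sum>j<k. integral\<^sup>L \<nu> (\<lambda>x. g (x * y j))) / real k"
      have cont: "continuous_on unit_circle (\<lambda>x. g (x * z))" if "z \<in> unit_circle" for z
        using that by (auto intro!: continuous_on_compose2[OF g] continuous_intros simp: norm_mult)
      have lim: "(\<lambda>i. (\<Sum>j<k. e i (y j)) / real k) \<longlonglongrightarrow> L"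
        unfolding L_def
      proof (intro tendsto_intros)
        fix j
        have "(\<lambda>i. integral\<^sup>L (euc_measure (s i)) (\<lambda>x. g (x * y j))) \<longlonglongrightarrow> integral\<^sup>L \<nu> (\<lambda>x. g (x * y j))"
          using wk cont[OF yc] by (simp add: circle_weak_conv_def)
        from LIMSEQ_subseq_LIMSEQ[OF this r] show "(\<lambda>i. e i (y j)) \<longlonglongrightarrow> integral\<^sup>L \<nu> (\<lambda>x. g (x * y j))"
          by (simp add: e_def comp_def)
      qed (use k in simp)
      have ucont: "uniformly_continuous_on unit_circle g" using g by (intro compact_uniformly_continuous) auto
      have "a \<longlonglongrightarrow> L"
      proof (rule tendstoI)
        fix eps :: real assume eps: "0 < eps"
        define \<eta> where "\<eta> = eps / 4"
        have \<eta>: "0 < \<eta>" using eps by (simp add: \<eta>_def)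
        obtain \<delta> where \<delta>: "0 < \<delta>" "\<And>x x'. x \<in> unit_circle \<Longrightarrow> x' \<in> unit_circle \<Longrightarrow> dist x' x < \<delta> \<Longrightarrow> dist (g x') (g x) < \<eta>"
          using ucont \<eta> unfolding uniformly_continuous_on_def by metis
        obtain i0 where i0: "1 / real (Suc i0) < \<delta>" using nat_approx_posE[OF \<delta>(1)] by blast
        have "\<forall>\<^sub>F i in sequentially. i0 \<le> i" by (rule eventually_ge_at_top)
        moreover have "\<forall>\<^sub>F i in sequentially. \<forall>j\<in>{..<k}. dist (Y (r i) j) (y j) < \<delta>"
          by (intro eventually_ball_finite ballI tendstoD[OF Ylim \<delta>(1)]) simp
        moreover have "\<forall>\<^sub>F i in sequentially. dist ((\<Sum>j<k. e i (y j)) / real k) L < \<eta>" using lim \<eta> by (rule tendstoD)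
        ultimately show "\<forall>\<^sub>F i in sequentially. dist (a i) L < eps" using ev_k
        proof eventually_elim
          case (elim i)
          have "\<bar>a i - (\<Sum>j<\<kappa> (r i). e i (Y (r i) j)) / real (\<kappa> (r i))\<bar> \<le> \<eta>"
          proof -
            have "\<forall>x\<in>unit_circle. \<forall>y\<in>unit_circle. cmod (x - y) \<le> 1 / real (Suc (r i)) \<longrightarrow> \<bar>g x - g y\<bar> \<le> \<eta>"
            proof (intro ballI impI)
              fix x x' assume x: "x \<in> unit_circle" "x' \<in> unit_circle" "cmod (x - x') \<le> 1 / real (Suc (r i))"
              have "1 / real (Suc (r i)) \<le> 1 / real (Suc i0)" using ri[of i] elim(1) by (intro divide_left_mono) auto
              then have "dist x x' < \<delta>" using x(3) i0 by (simp add: dist_norm)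
              then show "\<bar>g x - g x'\<bar> \<le> \<eta>" using \<delta>(2)[OF x(2,1)] by (simp add: dist_real_def)
            qed
            then show ?thesis using good[of "r i"] g unfolding good_def a_def e_def n_def by blast
          qed
          then have 1: "\<bar>a i - (\<Sum>j<k. e i (Y (r i) j)) / real k\<bar> \<le> \<eta>" using elim(4) by simp
          have "\<bar>e i (Y (r i) j) - e i (y j)\<bar> \<le> \<eta>" if j: "j \<in> {..<k}" for j
          proof -
            have Yc: "Y (r i) j \<in> unit_circle" using good[of "r i"] by (simp add: good_def)
            show ?thesis
              unfolding e_def integral_euc_measure[OF s0(1) cont[OF Yc]] integral_euc_measure[OF s0(1) cont[OF yc]]
            proof (rule abs_avg_diff_le)
              fix z assume "z \<in> circ (s (r i))"
              then have z: "cmod (dir z) = 1" using circ_nonzero[OF s0(1)] norm_dir by blast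
              have "dir z * Y (r i) j - dir z * y j = dir z * (Y (r i) j - y j)" by (simp add: algebra_simps)
              then have "dist (dir z * Y (r i) j) (dir z * y j) < \<delta>" using elim(2) j z by (simp add: dist_norm norm_mult)
              then show "\<bar>g (dir z * Y (r i) j) - g (dir z * y j)\<bar> \<le> \<eta>"
                using \<delta>(2)[of "dir z * y j" "dir z * Y (r i) j"] z Yc yc[of j] by (simp add: norm_mult dist_real_def)
            qed (use s0 in auto)
          qed
          then have "\<bar>(\<Sum>j<k. e i (Y (r i) j)) / real (card {..<k}) - (\<Sum>j<k. e i (y j)) / real (card {..<k})\<bar> \<le> \<eta>"
            by (intro abs_avg_diff_le A)
          then have 2: "\<bar>(\<Sum>j<k. e i (Y (r i) j)) / real k - (\<Sum>j<k. e i (y j)) / real k\<bar> \<le> \<eta>" by simp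
          have 3: "\<bar>(\<Sum>j<k. e i (y j)) / real k - L\<bar> < \<eta>" using elim(3) by (simp add: dist_real_def)
          have "\<bar>a i - L\<bar> < 3 * \<eta>" using 1 2 3 by linarith
          then show ?case using eps by (simp add: dist_real_def \<eta>_def)
        qed
      qed
      then show "(\<lambda>i. integral\<^sup>L (hyp_measure (n i)) g) \<longlonglongrightarrow> integral\<^sup>L (circle_convolution \<nu> \<nu>') g"
        unfolding \<nu>'_def integral_circle_convolution[OF \<nu> A g] by (simp add: a_def[abs_def] L_def)
    qed
    show "\<exists>(n :: nat \<Rightarrow> nat) (\<nu>' :: complex measure).
           (\<forall>i. n i \<in> hyp_radii \<and> n i > 2) \<and>
           filterlim n at_top sequentially \<and>
           circle_prob \<nu>' \<and> supported_on_at_most \<nu>' (K * K) \<and>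
           circle_weak_conv (\<lambda>i. hyp_measure (n i)) (circle_convolution \<nu> \<nu>') \<and>
           filterlim (\<lambda>i. card (Gamma_sphere (n i))) at_top sequentially"
      using rad n_top card_top conv circle_prob_uniform_distr[OF A] supported_uniform_distr[OF A(1,3), of "K * K"] k(2)
      unfolding \<nu>'_def by (intro exI conjI) auto
  qed
qed

end
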